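(* Let $(\overline{M},g)$ be a compact surface with interior $M$ and boundary $\partial M$, and let $(u_0,\phi)$ be an admissible Cauchy-Dirichlet pair. Assume in addition that there exist $T_3>0$ and a constant $C_1>0$ such that $$e^{-\phi}\big(|\nabla^2\phi|+|\nabla\phi|^2+|\nabla\phi|\big)\le C_1\quad\text{for }(x,t)\in\partial M\times[T_3,\infty),$$ and that $\sup_{\partial M}\frac{\partial\phi}{\partial t}(\cdot,t)\to0$ as $t\to\infty$. Let $u$ be the solution of the Cauchy-Dirichlet problem $$u_t=e^{-2u}(\Delta_g u-K_g)-1\ \text{ in } M\times[0,\infty),\qquad u=\phi\ \text{ on }\partial M\times[0,\infty),\qquad u|_{t=0}=u_0\ \text{ in } M$$ (which exists for all time, is unique, and converges locally uniformly in $C^2$ in $M$ to $u_{LN}$). Then the geodesic curvature of $\partial M$ with respect to $e^{2u}g$ satisfies $$k_{e^{2u}g}=e^{-u}\Big(\frac{\partial u}{\partial n_g}+k_g\Big)\to1$$ uniformly on $\partial M$ as $t\to\infty$.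
   Context: $(\overline{M},g)$ is a smooth compact Riemannian surface with boundary $\partial M$ (possibly with several components) and interior $M$; $K_g$ is its Gauss curvature, $n_g$ the outward unit normal along $\partial M$, $k_g$ the geodesic curvature of $\partial M$ (sign convention: the Euclidean unit disk has $k=1$); $\alpha\in(0,1)$ is fixed. $\nabla\phi,\nabla^2\phi$ are the first and second covariant derivatives of $\phi(\cdot,t)$ on the curve $\partial M$ with the metric induced by $g$. $C^{k+\alpha,\frac{k+\alpha}{2}}$ denotes the usual parabolic Hölder spaces. Low-speed increasing function: $\xi\in C^1([0,\infty))$ with $\xi>0$, $\lim_{t\to\infty}\xi(t)=\infty$, and such that there are constants $T>0$ and $0<\tau<1$ with $\xi'(t)\le\tau$ for all $t\ge T$. Admissible Cauchy-Dirichlet pair $(u_0,\phi)$: $u_0\in C^{2+\alpha}(\overline{M})$; $\phi\in C^{2+\alpha,1+\frac{\alpha}{2}}(\partial M\times[0,T'])$ for all $T'>0$; for $x\in\partial M$, $u_0(x)=\phi(x,0)$ and $\phi_t(x,0)=e^{-2u_0(x)}(\Delta_g u_0(x)-K_g(x))-1$; $\phi_t\ge0$ on $\partial M\times[T,\infty)$ for some $T>0$; and there are $T_1>0$ and a low-speed increasing function $\xi$ with $\phi(x,t)\ge\log(\xi(t))$ on $\partial M\times[T_1,\infty)$. For such a pair the Cauchy-Dirichlet problem has a unique solution $u$ that lies in $C^{2+\alpha,1+\frac{\alpha}{2}}(\overline{M}\times[0,T'])$ for all $T'>0$, and $u(\cdot,t)\to u_{LN}$ locally uniformly in $C^2$ in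 $M$. The Loewner-Nirenberg solution $u_{LN}$ is the unique solution of $\Delta_g u-K_g=e^{2u}$ in $M$ with $u(p)\to+\infty$ as $p\to\partial M$. *)

theory Defs
  imports "HOL-Analysis.Analysis"
begin

section \<open>Calculus in the closed half-plane\<close>

definition half_plane :: "(real^2) set" where
  "half_plane = {p. p $ 2 \<ge> 0}"

text \<open>Partial derivatives of functions on relatively open subsets of the half-plane. At points of
  the edge, the derivative in direction 2 is one-sided, and the derivative in direction 1 only
  involves the values of the function on the edge.\<close>

definition pd_dom :: "2 \<Rightarrow> real^2 \<Rightarrow> real set" where
  "pd_dom i p = {s. p + s *\<^sub>R axis i 1 \<in> half_plane}"

definition has_pd :: "2 \<Rightarrow> (real^2 \<Rightarrow> real) \<Rightarrow> real^2 \<Rightarrow> bool" where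
  "has_pd i f p \<longleftrightarrow> (\<lambda>s. f (p + s *\<^sub>R axis i 1)) differentiable (at 0 within pd_dom i p)"

definition pd :: "2 \<Rightarrow> (real^2 \<Rightarrow> real) \<Rightarrow> real^2 \<Rightarrow> real" where
  "pd i f p = vector_derivative (\<lambda>s. f (p + s *\<^sub>R axis i 1)) (at 0 within pd_dom i p)"

text \<open>\<open>C\<^sup>k\<close> regularity with respect to the coordinates in \<open>I\<close>: all of them when \<open>V\<close> is a relatively
  open subset of the half-plane (this is then \<open>C\<^sup>k\<close> up to the edge), and only coordinate 1 when
  \<open>V\<close> is a piece of the edge.\<close>

primrec Ck_on :: "nat \<Rightarrow> 2 set \<Rightarrow> (real^2) set \<Rightarrow> (real^2 \<Rightarrow> real) \<Rightarrow> bool" where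
  "Ck_on 0 I V f \<longleftrightarrow> continuous_on V f"
| "Ck_on (Suc k) I V f \<longleftrightarrow> continuous_on V f \<and> (\<forall>i\<in>I. (\<forall>p\<in>V. has_pd i f p) \<and> Ck_on k I V (pd i f))"

definition smooth_on :: "(real^2) set \<Rightarrow> (real^2 \<Rightarrow> real) \<Rightarrow> bool" where
  "smooth_on V f \<longleftrightarrow> (\<forall>k. Ck_on k UNIV V f)"

section \<open>Compact Riemannian surfaces with boundary\<close>

type_synonym 'a chart = "'a set \<times> ('a \<Rightarrow> real^2)"

text \<open>The metric is given by its coordinate matrices: \<open>metric S c p\<close> is \<open>(g\<^sub>i\<^sub>j)\<close> in the chart
  \<open>c\<close> at the point with coordinates \<open>p\<close>.\<close>

record 'a surface =
  top_of :: "'a topology"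
  atlas :: "'a chart set"
  metric :: "'a chart \<Rightarrow> real^2 \<Rightarrow> real^2^2"

definition chart_image :: "'a chart \<Rightarrow> (real^2) set" where
  "chart_image c = snd c ` fst c"

definition chart_inv :: "'a chart \<Rightarrow> real^2 \<Rightarrow> 'a" where
  "chart_inv c = inv_into (fst c) (snd c)"

definition transition :: "'a chart \<Rightarrow> 'a chart \<Rightarrow> real^2 \<Rightarrow> real^2" where
  "transition c d p = snd d (chart_inv c p)"

definition jacobian_matrix :: "(real^2 \<Rightarrow> real^2) \<Rightarrow> real^2 \<Rightarrow> real^2^2" where
  "jacobian_matrix F p = (\<chi> k i. pd i (\<lambda>q. F q $ k) p)"

text \<open>Second countability follows from compactness. Connectedness is not required.\<close>

definition compact_smooth_surface :: "'a surface \<Rightarrow> bool" where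
  "compact_smooth_surface S \<longleftrightarrow>
     compact_space (top_of S) \<and> Hausdorff_space (top_of S) \<and>
     (\<Union>c\<in>atlas S. fst c) = topspace (top_of S) \<and>
     (\<forall>c\<in>atlas S.
        openin (top_of S) (fst c) \<and>
        openin (top_of_set half_plane) (chart_image c) \<and>
        homeomorphic_map (subtopology (top_of S) (fst c)) (top_of_set (chart_image c)) (snd c)) \<and>
     (\<forall>c\<in>atlas S. \<forall>d\<in>atlas S. \<forall>k.
        smooth_on (snd c ` (fst c \<inter> fst d)) (\<lambda>p. transition c d p $ k))"

definition riemannian_metric :: "'a surface \<Rightarrow> bool" where
  "riemannian_metric S \<longleftrightarrow>
     (\<forall>c\<in>atlas S.
        (\<forall>i j. smooth_on (chart_image c) (\<lambda>p. metric S c p $ i $ j)) \<and>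
        (\<forall>p\<in>chart_image c. transpose (metric S c p) = metric S c p \<and>
           (\<forall>v. v \<noteq> 0 \<longrightarrow> v \<bullet> (metric S c p *v v) > 0))) \<and>
     (\<forall>c\<in>atlas S. \<forall>d\<in>atlas S. \<forall>p\<in>snd c ` (fst c \<inter> fst d).
        metric S c p =
          transpose (jacobian_matrix (transition c d) p) ** metric S d (transition c d p) **
          jacobian_matrix (transition c d) p)"

definition compact_riemannian_surface :: "'a surface \<Rightarrow> bool" where
  "compact_riemannian_surface S \<longleftrightarrow> compact_smooth_surface S \<and> riemannian_metric S"

definition boundary_of :: "'a surface \<Rightarrow> 'a set" where
  "boundary_of S = {x. \<exists>c\<in>atlas S. x \<in> fst c \<and> snd c x $ 2 = 0}"

definition inner_part :: "'a surface \<Rightarrow> 'a set" where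
  "inner_part S = topspace (top_of S) - boundary_of S"

text \<open>The geometric quantities below do not depend on the chart; they are computed in some chart
  around the given point.\<close>

definition chart_at :: "'a surface \<Rightarrow> 'a \<Rightarrow> 'a chart" where
  "chart_at S x = (SOME c. c \<in> atlas S \<and> x \<in> fst c)"

definition coord_rep :: "'a chart \<Rightarrow> ('a \<Rightarrow> real) \<Rightarrow> real^2 \<Rightarrow> real" where
  "coord_rep c f p = f (chart_inv c p)"

subsection \<open>Quantities attached to a metric in coordinates\<close>

definition christoffel :: "(real^2 \<Rightarrow> real^2^2) \<Rightarrow> 2 \<Rightarrow> 2 \<Rightarrow> 2 \<Rightarrow> real^2 \<Rightarrow> real" where
  "christoffel G k i j p =
     (\<Sum>l\<in>UNIV. matrix_inv (G p) $ k $ l *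
        (pd i (\<lambda>q. G q $ j $ l) p + pd j (\<lambda>q. G q $ i $ l) p - pd l (\<lambda>q. G q $ i $ j) p)) / 2"

definition coord_laplacian :: "(real^2 \<Rightarrow> real^2^2) \<Rightarrow> (real^2 \<Rightarrow> real) \<Rightarrow> real^2 \<Rightarrow> real" where
  "coord_laplacian G f p =
     (\<Sum>i\<in>UNIV. \<Sum>j\<in>UNIV. matrix_inv (G p) $ i $ j *
        (pd i (pd j f) p - (\<Sum>k\<in>UNIV. christoffel G k i j p * pd k f p)))"

text \<open>\<open>riemann G l k i j\<close> is the component \<open>l\<close> of \<open>R(\<partial>\<^sub>i,\<partial>\<^sub>j)\<partial>\<^sub>k\<close>, where
  \<open>R(X,Y) = \<nabla>\<^sub>X\<nabla>\<^sub>Y - \<nabla>\<^sub>Y\<nabla>\<^sub>X - \<nabla>\<^bsub>[X,Y]\<^esub>\<close>; the Gauss curvature is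
  \<open>\<langle>R(\<partial>\<^sub>1,\<partial>\<^sub>2)\<partial>\<^sub>2, \<partial>\<^sub>1\<rangle> / det G\<close>, which is positive for round spheres.\<close>

definition riemann :: "(real^2 \<Rightarrow> real^2^2) \<Rightarrow> 2 \<Rightarrow> 2 \<Rightarrow> 2 \<Rightarrow> 2 \<Rightarrow> real^2 \<Rightarrow> real" where
  "riemann G l k i j p =
     pd i (christoffel G l j k) p - pd j (christoffel G l i k) p +
     (\<Sum>m\<in>UNIV. christoffel G m j k p * christoffel G l i m p -
                christoffel G m i k p * christoffel G l j m p)"

definition coord_gauss_curvature :: "(real^2 \<Rightarrow> real^2^2) \<Rightarrow> real^2 \<Rightarrow> real" where
  "coord_gauss_curvature G p = (\<Sum>l\<in>UNIV. G p $ 1 $ l * riemann G l 2 1 2 p) / det (G p)"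

text \<open>On the edge, the gradient of the coordinate function 2 is normal to the edge and points
  inwards.\<close>

definition coord_normal :: "(real^2 \<Rightarrow> real^2^2) \<Rightarrow> real^2 \<Rightarrow> real^2" where
  "coord_normal G p = (\<chi> i. - matrix_inv (G p) $ i $ 2 / sqrt (matrix_inv (G p) $ 2 $ 2))"

text \<open>The geodesic curvature is \<open>- \<langle>\<nabla>\<^sub>\<tau> \<tau>, n\<rangle>\<close> with \<open>\<tau> = \<partial>\<^sub>1 / |\<partial>\<^sub>1|\<close> and the outward unit normal
  \<open>n\<close>, and \<open>\<nabla>\<^sub>\<tau> \<tau>\<close> equals \<open>\<nabla>\<^bsub>\<partial>\<^sub>1\<^esub> \<partial>\<^sub>1 / |\<partial>\<^sub>1|\<^sup>2\<close> up to a tangential term. The boundary of the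
  Euclidean unit disk has geodesic curvature 1.\<close>

definition coord_geodesic_curvature :: "(real^2 \<Rightarrow> real^2^2) \<Rightarrow> real^2 \<Rightarrow> real" where
  "coord_geodesic_curvature G p =
     - ((\<chi> k. christoffel G k 1 1 p) \<bullet> (G p *v coord_normal G p)) / (G p $ 1 $ 1)"

subsection \<open>Global quantities\<close>

definition laplacian :: "'a surface \<Rightarrow> ('a \<Rightarrow> real) \<Rightarrow> 'a \<Rightarrow> real" where
  "laplacian S f x = (let c = chart_at S x in
     coord_laplacian (metric S c) (coord_rep c f) (snd c x))"

definition gauss_curvature :: "'a surface \<Rightarrow> 'a \<Rightarrow> real" where
  "gauss_curvature S x = (let c = chart_at S x in coord_gauss_curvature (metric S c) (snd c x))"

definition normal_derivative :: "'a surface \<Rightarrow> ('a \<Rightarrow> real) \<Rightarrow> 'a \<Rightarrow> real" where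
  "normal_derivative S f x = (let c = chart_at S x in
     \<Sum>i\<in>UNIV. coord_normal (metric S c) (snd c x) $ i * pd i (coord_rep c f) (snd c x))"

definition geodesic_curvature :: "'a surface \<Rightarrow> 'a \<Rightarrow> real" where
  "geodesic_curvature S x = (let c = chart_at S x in coord_geodesic_curvature (metric S c) (snd c x))"

definition conformal :: "('a \<Rightarrow> real) \<Rightarrow> 'a surface \<Rightarrow> 'a surface" where
  "conformal u S = S\<lparr>metric := \<lambda>c p. exp (2 * coord_rep c u p) *\<^sub>R metric S c p\<rparr>"

text \<open>Norms of the first and second covariant derivatives of a function on the boundary curve,
  which carries the metric \<open>h ds\<^sup>2\<close> with \<open>h = g\<^sub>1\<^sub>1\<close> and the Christoffel symbol \<open>h' / (2 h)\<close>.\<close>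

definition bd_grad_norm :: "'a surface \<Rightarrow> ('a \<Rightarrow> real) \<Rightarrow> 'a \<Rightarrow> real" where
  "bd_grad_norm S f x = (let c = chart_at S x; p = snd c x in
     \<bar>pd 1 (coord_rep c f) p\<bar> / sqrt (metric S c p $ 1 $ 1))"

definition bd_hess_norm :: "'a surface \<Rightarrow> ('a \<Rightarrow> real) \<Rightarrow> 'a \<Rightarrow> real" where
  "bd_hess_norm S f x = (let c = chart_at S x; p = snd c x; h = (\<lambda>q. metric S c q $ 1 $ 1) in
     \<bar>pd 1 (pd 1 (coord_rep c f)) p - pd 1 h p / (2 * h p) * pd 1 (coord_rep c f) p\<bar> / h p)"

section \<open>Hoelder spaces\<close>

text \<open>On a compact surface, the Hoelder spaces are described by local Hoelder conditions in the
  charts, i.e. on the compact subsets of the chart images.\<close>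

definition holder_on :: "real \<Rightarrow> (real^2) set \<Rightarrow> (real^2 \<Rightarrow> real) \<Rightarrow> bool" where
  "holder_on a K f \<longleftrightarrow> (\<exists>C. \<forall>p\<in>K. \<forall>q\<in>K. \<bar>f p - f q\<bar> \<le> C * dist p q powr a)"

definition C2_holder :: "real \<Rightarrow> 'a surface \<Rightarrow> ('a \<Rightarrow> real) \<Rightarrow> bool" where
  "C2_holder \<alpha> S f \<longleftrightarrow>
     (\<forall>c\<in>atlas S. Ck_on 2 UNIV (chart_image c) (coord_rep c f) \<and>
        (\<forall>K i j. compact K \<and> K \<subseteq> chart_image c \<longrightarrow> holder_on \<alpha> K (pd i (pd j (coord_rep c f)))))"

definition time_deriv :: "real set \<Rightarrow> (real \<Rightarrow> real) \<Rightarrow> real \<Rightarrow> real" where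
  "time_deriv J f t = vector_derivative f (at t within J)"

definition par_holder_on ::
    "real \<Rightarrow> real \<Rightarrow> (real^2) set \<Rightarrow> real set \<Rightarrow> (real^2 \<Rightarrow> real \<Rightarrow> real) \<Rightarrow> bool" where
  "par_holder_on a b K J F \<longleftrightarrow>
     (\<exists>C. \<forall>p\<in>K. \<forall>q\<in>K. \<forall>s\<in>J. \<forall>t\<in>J. \<bar>F p s - F q t\<bar> \<le> C * (dist p q powr a + \<bar>s - t\<bar> powr b))"

text \<open>The space \<open>C\<^bsup>2+\<alpha>,1+\<alpha>/2\<^esup>\<close> in coordinates, with derivatives in the directions in \<open>I\<close>. The
  exponent 1 in space for the first derivatives is no restriction, since these are \<open>C\<^sup>1\<close> in space.\<close>

definition coord_par_C2_holder ::
    "real \<Rightarrow> 2 set \<Rightarrow> (real^2) set \<Rightarrow> real \<Rightarrow> (real^2 \<Rightarrow> real \<Rightarrow> real) \<Rightarrow> bool" where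
  "coord_par_C2_holder \<alpha> I V T F \<longleftrightarrow>
     (\<forall>t\<in>{0..T}. Ck_on 2 I V (\<lambda>p. F p t)) \<and>
     (\<forall>p\<in>V. \<forall>t\<in>{0..T}. F p differentiable (at t within {0..T})) \<and>
     (\<forall>K. compact K \<and> K \<subseteq> V \<longrightarrow>
        par_holder_on \<alpha> (\<alpha>/2) K {0..T} (\<lambda>p. time_deriv {0..T} (F p)) \<and>
        (\<forall>i\<in>I. par_holder_on 1 ((1 + \<alpha>)/2) K {0..T} (\<lambda>p t. pd i (\<lambda>q. F q t) p)) \<and>
        (\<forall>i\<in>I. \<forall>j\<in>I. par_holder_on \<alpha> (\<alpha>/2) K {0..T} (\<lambda>p t. pd i (pd j (\<lambda>q. F q t)) p)))"

definition par_C2_holder :: "real \<Rightarrow> 'a surface \<Rightarrow> real \<Rightarrow> ('a \<Rightarrow> real \<Rightarrow> real) \<Rightarrow> bool" where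
  "par_C2_holder \<alpha> S T u \<longleftrightarrow>
     (\<forall>c\<in>atlas S. coord_par_C2_holder \<alpha> UNIV (chart_image c) T (\<lambda>p t. u (chart_inv c p) t))"

definition bd_par_C2_holder :: "real \<Rightarrow> 'a surface \<Rightarrow> real \<Rightarrow> ('a \<Rightarrow> real \<Rightarrow> real) \<Rightarrow> bool" where
  "bd_par_C2_holder \<alpha> S T \<phi> \<longleftrightarrow>
     (\<forall>c\<in>atlas S. coord_par_C2_holder \<alpha> {1} {p \<in> chart_image c. p $ 2 = 0} T
        (\<lambda>p t. \<phi> (chart_inv c p) t))"

section \<open>The Cauchy-Dirichlet problem\<close>

definition low_speed_increasing :: "(real \<Rightarrow> real) \<Rightarrow> bool" where
  "low_speed_increasing \<xi> \<longleftrightarrow>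
     (\<forall>t\<ge>0. \<xi> t > 0) \<and> filterlim \<xi> at_top at_top \<and>
     (\<exists>\<xi>'. continuous_on {0..} \<xi>' \<and>
        (\<forall>t\<ge>0. (\<xi> has_real_derivative \<xi>' t) (at t within {0..})) \<and>
        (\<exists>T>0. \<exists>\<tau>. 0 < \<tau> \<and> \<tau> < 1 \<and> (\<forall>t\<ge>T. \<xi>' t \<le> \<tau>)))"

definition admissible_pair ::
    "real \<Rightarrow> 'a surface \<Rightarrow> ('a \<Rightarrow> real) \<Rightarrow> ('a \<Rightarrow> real \<Rightarrow> real) \<Rightarrow> bool" where
  "admissible_pair \<alpha> S u\<^sub>0 \<phi> \<longleftrightarrow>
     C2_holder \<alpha> S u\<^sub>0 \<and>
     (\<forall>T>0. bd_par_C2_holder \<alpha> S T \<phi>) \<and>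
     (\<forall>x\<in>boundary_of S. u\<^sub>0 x = \<phi> x 0 \<and>
        time_deriv {0..} (\<phi> x) 0 = exp (- 2 * u\<^sub>0 x) * (laplacian S u\<^sub>0 x - gauss_curvature S x) - 1) \<and>
     (\<exists>T>0. \<forall>x\<in>boundary_of S. \<forall>t\<ge>T. time_deriv {0..} (\<phi> x) t \<ge> 0) \<and>
     (\<exists>T\<^sub>1>0. \<exists>\<xi>. low_speed_increasing \<xi> \<and> (\<forall>x\<in>boundary_of S. \<forall>t\<ge>T\<^sub>1. \<phi> x t \<ge> ln (\<xi> t)))"

definition cauchy_dirichlet_solution ::
    "real \<Rightarrow> 'a surface \<Rightarrow> ('a \<Rightarrow> real) \<Rightarrow> ('a \<Rightarrow> real \<Rightarrow> real) \<Rightarrow> ('a \<Rightarrow> real \<Rightarrow> real) \<Rightarrow> bool" where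
  "cauchy_dirichlet_solution \<alpha> S u\<^sub>0 \<phi> u \<longleftrightarrow>
     (\<forall>T>0. par_C2_holder \<alpha> S T u) \<and>
     (\<forall>x\<in>inner_part S. \<forall>t\<ge>0. time_deriv {0..} (u x) t =
        exp (- 2 * u x t) * (laplacian S (\<lambda>y. u y t) x - gauss_curvature S x) - 1) \<and>
     (\<forall>x\<in>boundary_of S. \<forall>t\<ge>0. u x t = \<phi> x t) \<and>
     (\<forall>x\<in>inner_part S. u x 0 = u\<^sub>0 x)"

end

theory Submission
  imports Defs
begin

text \<open>
  The function \<open>v = e\<^bsup>-u\<^esup>\<close> solves \<open>v\<^sub>t = v (v \<Delta>v - |\<nabla>v|\<^sup>2 + 1 + K v\<^sup>2)\<close>, and up to the term
  \<open>e\<^bsup>-u\<^esup> k\<^sub>g\<close>, which tends to 0, the claim is that the inward normal derivative of \<open>v\<close> tends to 1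
  at the boundary. On the boundary, \<open>v = e\<^bsup>-\<phi>\<^esup>\<close> tends to 0, has bounded second tangential
  derivative, and its logarithm is eventually nonincreasing and arbitrarily slow in time.

  Near a boundary point, \<open>v\<close> at time \<open>t\<^sub>0\<close> is squeezed between quadratic polynomials \<open>w\<close> in a
  chart, multiplied by \<open>e\<^bsup>\<plusminus>\<epsilon> (t - t\<^sub>0)\<^esup>\<close>; for large \<open>t\<^sub>0\<close> this factor settles the comparison at the
  initial time. If the quadratic part of \<open>w\<close> is a multiple of the metric at the base point, then
  \<open>w \<Delta>w - |\<nabla>w|\<^sup>2 + 1\<close> is nearly constant on small balls; in the flat case it is exactly constant.
  The upper barrier needs \<open>v\<close> to be small near the boundary, which follows from a coarser concave
  barrier and a uniform lower bound for \<open>u\<close>. The latter holds because \<open>u\<close> cannot touch from above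
  a negative function \<open>h\<close> with \<open>\<Delta>h \<ge> K + 1\<close>; such functions are obtained by pushing the bad set
  of a bump function along chains of balls to the boundary and out of the surface.
\<close>

section \<open>Partial derivatives on the half-plane\<close>

abbreviation open_hp :: "(real^2) set \<Rightarrow> bool" where
  "open_hp V \<equiv> openin (top_of_set half_plane) V"

definition has_pdv :: "2 \<Rightarrow> (real^2 \<Rightarrow> real) \<Rightarrow> real \<Rightarrow> real^2 \<Rightarrow> bool" where
  "has_pdv i f D p \<longleftrightarrow>
     ((\<lambda>s. f (p + s *\<^sub>R axis i 1)) has_real_derivative D) (at 0 within pd_dom i p)"

lemma axis_2_simps [simp]:
  "(axis 1 x :: real^2) $ 1 = x" "(axis 1 x :: real^2) $ 2 = 0"
  "(axis 2 x :: real^2) $ 1 = 0" "(axis 2 x :: real^2) $ 2 = x"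
  by (simp_all add: axis_def)

lemma all_2: "(\<forall>i::2. P i) \<longleftrightarrow> P 1 \<and> P 2"
  by (metis exhaust_2)

lemma vec_eq_2: "(p :: real^2) = q \<longleftrightarrow> p $ 1 = q $ 1 \<and> p $ 2 = q $ 2"
  by (simp add: vec_eq_iff all_2)

lemma compact_half_ball: "compact (cball p r \<inter> half_plane :: (real^2) set)"
proof -
  have "closed (half_plane :: (real^2) set)"
    unfolding half_plane_def by (intro closed_Collect_le continuous_intros)
  then show ?thesis by (intro compact_Int_closed) auto
qed

lemma dist_le_2: "dist (p::real^2) q \<le> \<bar>p $ 1 - q $ 1\<bar> + \<bar>p $ 2 - q $ 2\<bar>"
  using norm_le_l1_cart[of "p - q"] by (simp add: dist_norm sum_2)

lemma norm_2_sq: "(norm (p::real^2))\<^sup>2 = (p $ 1)\<^sup>2 + (p $ 2)\<^sup>2"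
  by (simp add: norm_vec_def L2_set_def sum_2)

lemma mem_half_plane [simp]: "p \<in> half_plane \<longleftrightarrow> p $ 2 \<ge> 0"
  by (simp add: half_plane_def)

lemma open_hp_subset: "open_hp V \<Longrightarrow> V \<subseteq> half_plane"
  by (rule openin_imp_subset)

lemma pd_dom_1: "p \<in> half_plane \<Longrightarrow> pd_dom 1 p = UNIV"
  by (auto simp: pd_dom_def)

lemma pd_dom_2: "pd_dom 2 p = {- p $ 2..}"
  by (auto simp: pd_dom_def)

lemma at_pd_dom_not_bot: "p \<in> half_plane \<Longrightarrow> at 0 within pd_dom i p \<noteq> bot"
proof -
  assume "p \<in> half_plane"
  then have "{0<..} \<subseteq> pd_dom i p"
    using exhaust_2[of i] by (auto simp: pd_dom_def)
  then have "at 0 within {0<..} \<le> at 0 within pd_dom i p"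
    by (rule at_le)
  then show ?thesis
    using trivial_limit_at_right_real[of 0] by (metis bot.extremum_uniqueI)
qed

lemma has_pdv_imp:
  assumes "has_pdv i f D p" "p \<in> half_plane"
  shows "has_pd i f p" "pd i f p = D"
proof -
  have v: "((\<lambda>s. f (p + s *\<^sub>R axis i 1)) has_vector_derivative D) (at 0 within pd_dom i p)"
    using assms by (simp add: has_pdv_def has_real_derivative_iff_has_vector_derivative)
  then show "has_pd i f p"
    by (auto simp: has_pd_def has_vector_derivative_def differentiable_def)
  show "pd i f p = D"
    unfolding pd_def by (rule vector_derivative_within[OF at_pd_dom_not_bot[OF assms(2)] v])
qed

lemma has_pdvI: "has_pd i f p \<Longrightarrow> has_pdv i f (pd i f p) p"
  unfolding has_pd_def has_pdv_def pd_def
  by (simp add: has_real_derivative_iff_has_vector_derivative vector_derivative_works)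

lemma eventually_line_within:
  assumes "open_hp V" "p \<in> V"
  shows "\<forall>\<^sub>F s in at 0 within pd_dom i p. p + s *\<^sub>R axis i 1 \<in> V"
proof -
  obtain T where T: "open T" "V = half_plane \<inter> T"
    using assms(1) by (auto simp: openin_open)
  have "((\<lambda>s. p + s *\<^sub>R axis i 1) \<longlongrightarrow> p + 0 *\<^sub>R axis i 1) (at 0 within pd_dom i p)"
    by (intro tendsto_intros)
  then have "\<forall>\<^sub>F s in at 0 within pd_dom i p. p + s *\<^sub>R axis i 1 \<in> T"
    using T assms(2) by (auto dest!: topological_tendstoD)
  moreover have "\<forall>\<^sub>F s in at 0 within pd_dom i p. s \<in> pd_dom i p"
    by (simp add: eventually_at_topological) blast
  ultimately show ?thesis
    by eventually_elim (auto simp: T pd_dom_def)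
qed

lemma has_pdv_cong:
  assumes "open_hp V" "p \<in> V" "\<And>q. q \<in> V \<Longrightarrow> f q = g q"
  shows "has_pdv i f D p \<longleftrightarrow> has_pdv i g D p"
  unfolding has_pdv_def
proof (rule has_field_derivative_cong_eventually)
  show "\<forall>\<^sub>F s in at 0 within pd_dom i p. f (p + s *\<^sub>R axis i 1) = g (p + s *\<^sub>R axis i 1)"
    using eventually_line_within[OF assms(1,2)] by eventually_elim (rule assms(3))
qed (use assms in auto)

lemma has_pd_iff_pdv: "p \<in> half_plane \<Longrightarrow> has_pd i f p \<longleftrightarrow> (\<exists>D. has_pdv i f D p)"
  using has_pdvI has_pdv_imp by blast

lemma pd_cong:
  assumes "open_hp V" "p \<in> V" "\<And>q. q \<in> V \<Longrightarrow> f q = g q"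
  shows "has_pd i f p \<longleftrightarrow> has_pd i g p" "has_pd i f p \<Longrightarrow> pd i f p = pd i g p"
proof -
  have p: "p \<in> half_plane" using assms(1,2) open_hp_subset by blast
  show "has_pd i f p \<longleftrightarrow> has_pd i g p"
    unfolding has_pd_iff_pdv[OF p] using has_pdv_cong[OF assms] by simp
  show "pd i f p = pd i g p" if "has_pd i f p"
    using has_pdvI[OF that] has_pdv_cong[of V p f g, OF assms] has_pdv_imp(2)[OF _ p] by metis
qed

lemma has_pdv_const: "has_pdv i (\<lambda>p. a) 0 p"
  by (simp add: has_pdv_def)

lemma has_pdv_coord: "has_pdv i (\<lambda>p. p $ j) (axis i 1 $ j) p"
  unfolding has_pdv_def by (auto intro!: derivative_eq_intros)

lemma has_pdv_add: "has_pdv i f D p \<Longrightarrow> has_pdv i g E p \<Longrightarrow> has_pdv i (\<lambda>q. f q + g q) (D + E) p"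
  unfolding has_pdv_def by (auto intro!: derivative_eq_intros)

lemma has_pdv_diff: "has_pdv i f D p \<Longrightarrow> has_pdv i g E p \<Longrightarrow> has_pdv i (\<lambda>q. f q - g q) (D - E) p"
  unfolding has_pdv_def by (auto intro!: derivative_eq_intros)

lemma has_pdv_mult:
  "has_pdv i f D p \<Longrightarrow> has_pdv i g E p \<Longrightarrow> has_pdv i (\<lambda>q. f q * g q) (f p * E + D * g p) p"
  unfolding has_pdv_def by (auto intro!: derivative_eq_intros)

lemma has_pdv_cmult: "has_pdv i f D p \<Longrightarrow> has_pdv i (\<lambda>q. a * f q) (a * D) p"
  unfolding has_pdv_def by (auto intro!: derivative_eq_intros)

lemma has_pdv_chain_real:
  assumes "(h has_real_derivative h') (at (f p))" "has_pdv i f D p"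
  shows "has_pdv i (\<lambda>q. h (f q)) (h' * D) p"
  using DERIV_chain2[of h h' "\<lambda>s. f (p + s *\<^sub>R axis i 1)" 0 D "pd_dom i p"] assms
  unfolding has_pdv_def by simp

lemma has_pdv_eqD: "has_pdv i f D p \<Longrightarrow> has_pdv i f E p \<Longrightarrow> p \<in> half_plane \<Longrightarrow> D = E"
  using has_pdv_imp(2) by blast

section \<open>Classes of regularity\<close>

lemma Ck_on_continuous: "Ck_on k I V f \<Longrightarrow> continuous_on V f"
  by (cases k) auto

lemma Ck_on_1: "Ck_on 1 I V f \<longleftrightarrow>
    continuous_on V f \<and> (\<forall>i\<in>I. (\<forall>p\<in>V. has_pd i f p) \<and> continuous_on V (pd i f))"
  by (simp only: One_nat_def Ck_on.simps)

lemma Ck_on_2: "Ck_on 2 I V f \<longleftrightarrow>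
    continuous_on V f \<and> (\<forall>i\<in>I. (\<forall>p\<in>V. has_pd i f p) \<and> Ck_on 1 I V (pd i f))"
  by (simp only: numeral_2_eq_2 One_nat_def Ck_on.simps)

lemma Ck_on_Suc_D: "Ck_on (Suc k) I V f \<Longrightarrow> Ck_on k I V f"
  by (induction k arbitrary: f) auto

lemma Ck_on_2_D1: "Ck_on 2 I V f \<Longrightarrow> Ck_on 1 I V f"
  using Ck_on_Suc_D[of 1] by (simp add: numeral_2_eq_2)

lemma Ck_on_mono: "Ck_on k I V f \<Longrightarrow> W \<subseteq> V \<Longrightarrow> Ck_on k I W f"
  by (induction k arbitrary: f) (auto intro: continuous_on_subset)

lemma Ck_on_cong:
  assumes "open_hp V" "\<And>q. q \<in> V \<Longrightarrow> f q = g q"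
  shows "Ck_on k UNIV V f \<longleftrightarrow> Ck_on k UNIV V g"
  using assms(2)
proof (induction k arbitrary: f g)
  case 0
  then show ?case by (simp cong: continuous_on_cong)
next
  case (Suc k)
  have c: "continuous_on V f \<longleftrightarrow> continuous_on V g"
    using Suc.prems by (simp cong: continuous_on_cong)
  have h: "has_pd i f p \<longleftrightarrow> has_pd i g p" if "p \<in> V" for i p
    using pd_cong(1)[OF assms(1) that Suc.prems] .
  have "Ck_on k UNIV V (pd i f) \<longleftrightarrow> Ck_on k UNIV V (pd i g)" if "\<forall>p\<in>V. has_pd i f p" for i
    using that pd_cong(2)[OF assms(1) _ Suc.prems] by (intro Suc.IH) auto
  then show ?case using c h by auto
qed

lemma Ck_on_SucI:
  assumes "open_hp V" "continuous_on V f"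
    and "\<And>i p. p \<in> V \<Longrightarrow> has_pdv i f (D i p) p" "\<And>i. Ck_on k UNIV V (D i)"
  shows "Ck_on (Suc k) UNIV V f"
proof -
  have H: "p \<in> half_plane" if "p \<in> V" for p using that assms(1) open_hp_subset by blast
  have "Ck_on k UNIV V (pd i f)" for i
    using assms(4)[of i] Ck_on_cong[OF assms(1), of "pd i f" "D i" k] has_pdv_imp(2)[OF assms(3) H]
    by auto
  moreover have "has_pd i f p" if "p \<in> V" for i p
    using has_pdv_imp(1)[OF assms(3)[OF that] H[OF that]] .
  ultimately show ?thesis using assms(2) by simp
qed

lemma Ck_on_Suc_pdv: "Ck_on (Suc k) UNIV V f \<Longrightarrow> p \<in> V \<Longrightarrow> has_pdv i f (pd i f p) p"
  by (auto intro: has_pdvI)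

lemma Ck_on_1_pdv: "Ck_on 1 UNIV V f \<Longrightarrow> p \<in> V \<Longrightarrow> has_pdv i f (pd i f p) p"
  by (auto intro: has_pdvI simp: Ck_on_1)

lemma Ck_on_2_pdv: "Ck_on 2 UNIV V f \<Longrightarrow> p \<in> V \<Longrightarrow> has_pdv i f (pd i f p) p"
  by (auto intro: has_pdvI simp: Ck_on_2)

lemma Ck_on_2_pdv2: "Ck_on 2 UNIV V f \<Longrightarrow> p \<in> V \<Longrightarrow> has_pdv i (pd j f) (pd i (pd j f) p) p"
  unfolding Ck_on_2 by (blast intro: Ck_on_1_pdv)

lemma Ck_on_const: "open_hp V \<Longrightarrow> Ck_on k UNIV V (\<lambda>p. a)"
proof (induction k arbitrary: a)
  case (Suc k)
  show ?case
    by (rule Ck_on_SucI[where D = "\<lambda>i p. 0"])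
       (auto intro: Suc simp: has_pdv_const)
qed simp

lemma Ck_on_coord: "open_hp V \<Longrightarrow> Ck_on k UNIV V (\<lambda>p. p $ j)"
proof (cases k)
  case (Suc m)
  assume V: "open_hp V"
  show ?thesis unfolding Suc
    by (rule Ck_on_SucI[where D = "\<lambda>i p. axis i 1 $ j"])
       (auto intro!: V Ck_on_const has_pdv_coord continuous_intros)
qed (auto intro!: continuous_intros)

lemma Ck_on_add:
  assumes V: "open_hp V"
  shows "Ck_on k UNIV V f \<Longrightarrow> Ck_on k UNIV V g \<Longrightarrow> Ck_on k UNIV V (\<lambda>p. f p + g p)"
proof (induction k arbitrary: f g)
  case (Suc k)
  have D: "Ck_on k UNIV V (\<lambda>p. pd i f p + pd i g p)" for i
    using Suc.prems by (intro Suc.IH) auto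
  show ?case
  proof (rule Ck_on_SucI[OF V _ _ D])
    show "continuous_on V (\<lambda>p. f p + g p)"
      using Suc.prems by (intro continuous_on_add) auto
    show "has_pdv i (\<lambda>p. f p + g p) (pd i f p + pd i g p) p" if "p \<in> V" for i p
      using Suc.prems that by (intro has_pdv_add Ck_on_Suc_pdv)
  qed
qed (auto intro: continuous_on_add)

lemma Ck_on_mult:
  assumes V: "open_hp V"
  shows "Ck_on k UNIV V f \<Longrightarrow> Ck_on k UNIV V g \<Longrightarrow> Ck_on k UNIV V (\<lambda>p. f p * g p)"
proof (induction k arbitrary: f g)
  case (Suc k)
  have "Ck_on k UNIV V (pd i f)" "Ck_on k UNIV V (pd i g)" for i
    using Suc.prems by auto
  moreover have "Ck_on k UNIV V f" "Ck_on k UNIV V g"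
    using Suc.prems Ck_on_Suc_D by blast+
  ultimately have D: "Ck_on k UNIV V (\<lambda>p. f p * pd i g p + pd i f p * g p)" for i
    by (intro Ck_on_add[OF V] Suc.IH)
  show ?case
  proof (rule Ck_on_SucI[OF V _ _ D])
    show "continuous_on V (\<lambda>p. f p * g p)"
      using Suc.prems by (intro continuous_on_mult) auto
    show "has_pdv i (\<lambda>p. f p * g p) (f p * pd i g p + pd i f p * g p) p" if "p \<in> V" for i p
      using Suc.prems that by (intro has_pdv_mult Ck_on_Suc_pdv)
  qed
qed (auto intro: continuous_on_mult)

lemma Ck_on_cmult: "open_hp V \<Longrightarrow> Ck_on k UNIV V f \<Longrightarrow> Ck_on k UNIV V (\<lambda>p. a * f p)"
  by (intro Ck_on_mult Ck_on_const)

lemma Ck_on_minus: "open_hp V \<Longrightarrow> Ck_on k UNIV V f \<Longrightarrow> Ck_on k UNIV V (\<lambda>p. - f p)"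
  using Ck_on_cmult[of V k f "-1"] by simp

lemma Ck_on_diff:
  "open_hp V \<Longrightarrow> Ck_on k UNIV V f \<Longrightarrow> Ck_on k UNIV V g \<Longrightarrow> Ck_on k UNIV V (\<lambda>p. f p - g p)"
  using Ck_on_add[OF _ _ Ck_on_minus] by fastforce

lemma smooth_on_Ck: "smooth_on V f \<Longrightarrow> Ck_on k UNIV V f"
  by (simp add: smooth_on_def)

section \<open>Total derivatives and the chain rule\<close>

lemma open_hp_square:
  assumes "open_hp V" "p \<in> V"
  obtains e where "e > 0" "\<And>q. q $ 2 \<ge> 0 \<Longrightarrow> \<bar>q $ 1 - p $ 1\<bar> < e \<Longrightarrow> \<bar>q $ 2 - p $ 2\<bar> < e \<Longrightarrow> q \<in> V"
proof -
  obtain d where d: "d > 0" "\<And>q. q \<in> half_plane \<Longrightarrow> dist q p < d \<Longrightarrow> q \<in> V"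
    using assms by (force simp: openin_euclidean_subtopology_iff)
  have "q \<in> V" if "q $ 2 \<ge> 0" "\<bar>q $ 1 - p $ 1\<bar> < d/2" "\<bar>q $ 2 - p $ 2\<bar> < d/2" for q
    using that dist_le_2[of q p] by (intro d(2)) auto
  then show ?thesis using that[of "d/2"] d(1) by auto
qed

lemma C1_has_derivative:
  assumes V: "open_hp V" and f: "Ck_on 1 UNIV V f" and p: "p \<in> V"
  shows "(f has_derivative (\<lambda>v. v $ 1 * pd 1 f p + v $ 2 * pd 2 f p)) (at p within half_plane)"
proof -
  define mk :: "real \<Rightarrow> real \<Rightarrow> real^2" where "mk = (\<lambda>x y. vector [x, y])"
  have mk [simp]: "mk x y $ 1 = x" "mk x y $ 2 = y" for x y
    by (simp_all add: mk_def)
  have mk_p: "mk (q $ 1) (q $ 2) = q" for q by (simp add: vec_eq_2)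
  obtain e where e: "e > 0"
    "\<And>q. q $ 2 \<ge> 0 \<Longrightarrow> \<bar>q $ 1 - p $ 1\<bar> < e \<Longrightarrow> \<bar>q $ 2 - p $ 2\<bar> < e \<Longrightarrow> q \<in> V"
    using open_hp_square[OF V p] by metis
  have pH: "p $ 2 \<ge> 0" using p V open_hp_subset by fastforce
  define X where "X = {p $ 1 - e<..<p $ 1 + e}"
  define Y where "Y = {p $ 2 - e<..<p $ 2 + e} \<inter> {0..}"
  have XY: "mk x y \<in> V" if "x \<in> X" "y \<in> Y" for x y
    using that by (intro e(2)) (auto simp: X_def Y_def)
  have pX: "p $ 1 \<in> X" and pY: "p $ 2 \<in> Y" using e(1) pH by (auto simp: X_def Y_def)
  have fx: "((\<lambda>x. f (mk x (p $ 2))) has_derivative (\<lambda>t. t * pd 1 f p)) (at (p $ 1) within X)"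
  proof -
    have "((\<lambda>s. f (p + s *\<^sub>R axis 1 1)) has_real_derivative pd 1 f p) (at 0)"
      using Ck_on_1_pdv[OF f p, of 1] pd_dom_1[of p] pH by (simp add: has_pdv_def)
    then have "((\<lambda>x. f (p + (x - p $ 1) *\<^sub>R axis 1 1)) has_real_derivative pd 1 f p) (at (p $ 1))"
      using DERIV_shift[of "\<lambda>x. f (p + (x - p $ 1) *\<^sub>R axis 1 1)" "pd 1 f p" 0 "p $ 1"] by simp
    moreover have "p + (x - p $ 1) *\<^sub>R axis 1 1 = mk x (p $ 2)" for x
      by (simp add: vec_eq_2)
    ultimately show ?thesis
      by (simp add: has_field_derivative_def has_derivative_at_withinI mult_commute_abs)
  qed
  have fy: "((\<lambda>y. f (mk x y)) has_derivative blinfun_apply (blinfun_scaleR_left (pd 2 f (mk x y))))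
      (at y within Y)" if x: "x \<in> X" and y: "y \<in> Y" for x y
  proof -
    have "((\<lambda>s. f (mk x y + s *\<^sub>R axis 2 1)) has_real_derivative pd 2 f (mk x y)) (at 0 within
        {-y..})"
      using Ck_on_1_pdv[OF f XY[OF x y], of 2] by (simp add: has_pdv_def pd_dom_2)
    then have "((\<lambda>s. f (mk x y + s *\<^sub>R axis 2 1)) has_real_derivative pd 2 f (mk x y))
        (at 0 within (\<lambda>t. t - y) ` Y)"
      by (rule DERIV_subset) (auto simp: Y_def)
    then have "((\<lambda>s. f (mk x y + s *\<^sub>R axis 2 1)) \<circ> (\<lambda>t. t - y) has_real_derivative pd 2 f (mk x
        y) * 1)
        (at y within Y)"
      by (intro DERIV_image_chain) (auto intro!: derivative_eq_intros)
    moreover have "(\<lambda>s. f (mk x y + s *\<^sub>R axis 2 1)) \<circ> (\<lambda>t. t - y) = (\<lambda>t. f (mk x t))"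
      by (auto simp: fun_eq_iff vec_eq_2 intro!: arg_cong[where f = f])
    ultimately show ?thesis
      by (simp add: has_field_derivative_def mult_commute_abs)
  qed
  have "continuous_on (X \<times> Y) (\<lambda>z. pd 2 f (mk (fst z) (snd z)))"
  proof (rule continuous_on_compose2[of V "pd 2 f"])
    show "continuous_on V (pd 2 f)" using f by (simp add: Ck_on_1)
    show "continuous_on (X \<times> Y) (\<lambda>z. mk (fst z) (snd z))"
    proof -
      have "mk x y = x *\<^sub>R axis 1 1 + y *\<^sub>R axis 2 1" for x y by (simp add: vec_eq_2)
      then show ?thesis by (auto intro!: continuous_intros)
    qed
  qed (use XY in auto)
  then have "continuous_on (X \<times> Y) (\<lambda>z. blinfun_scaleR_left (pd 2 f (mk (fst z) (snd z))))"
    by (intro bounded_linear.continuous_on[OF bounded_linear_blinfun_scaleR_left])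
  then have fyc: "continuous (at (p $ 1, p $ 2) within X \<times> Y)
      (\<lambda>(x, y). blinfun_scaleR_left (pd 2 f (mk x y)))"
    using pX pY by (auto simp: continuous_on_eq_continuous_within case_prod_unfold)
  have "((\<lambda>(x, y). f (mk x y)) has_derivative
      (\<lambda>(tx, ty). tx * pd 1 f p + blinfun_scaleR_left (pd 2 f (mk (p $ 1) (p $ 2))) ty))
      (at (p $ 1, p $ 2) within X \<times> Y)"
    by (rule has_derivative_partialsI[OF fx fy fyc pY])
       (auto simp: Y_def intro!: convex_Int)
  then have D: "((\<lambda>(x, y). f (mk x y)) has_derivative (\<lambda>(tx, ty). tx * pd 1 f p + ty * pd 2 f p))
      (at (p $ 1, p $ 2) within X \<times> Y)"
    by (simp add: mk_p)
  define B where "B = {q::real^2. q $ 1 \<in> {p $ 1 - e<..<p $ 1 + e} \<and> q $ 2 \<in> {p $ 2 - e<..<p $ 2 +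
      e}}"
  have B: "open B"
    unfolding B_def greaterThanLessThan_iff
    by (intro open_Collect_conj open_Collect_less continuous_intros)
  have pB: "p \<in> B" using e(1) by (simp add: B_def)
  have im: "(\<lambda>q::real^2. (q $ 1, q $ 2)) ` (half_plane \<inter> B) \<subseteq> X \<times> Y"
    by (auto simp: B_def X_def Y_def)
  have pr: "((\<lambda>q::real^2. (q $ 1, q $ 2)) has_derivative (\<lambda>v. (v $ 1, v $ 2))) (at p within
      half_plane \<inter> B)"
    by (intro has_derivative_Pair bounded_linear_imp_has_derivative bounded_linear_vec_nth)
  have "((\<lambda>q. (\<lambda>(x, y). f (mk x y)) (q $ 1, q $ 2)) has_derivative
      (\<lambda>v. (\<lambda>(tx, ty). tx * pd 1 f p + ty * pd 2 f p) (v $ 1, v $ 2))) (at p within half_plane \<inter> B)"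
    by (rule has_derivative_in_compose[OF pr]) (rule has_derivative_subset[OF D im])
  then have "(f has_derivative (\<lambda>v. v $ 1 * pd 1 f p + v $ 2 * pd 2 f p)) (at p within half_plane
      \<inter> B)"
    by (simp add: mk_p)
  moreover have "at p within half_plane \<inter> B = at p within half_plane"
    using B pB by (intro at_within_nhd[of _ B]) auto
  ultimately show ?thesis by simp
qed

lemma has_pdv_compose:
  assumes W: "open_hp W" and V: "open_hp V"
    and F: "\<And>k. Ck_on 1 UNIV W (\<lambda>q. F q $ k)" and f: "Ck_on 1 UNIV V f"
    and im: "F ` W \<subseteq> V" and p: "p \<in> W"
  shows "has_pdv i (\<lambda>q. f (F q))
    (pd 1 f (F p) * pd i (\<lambda>q. F q $ 1) p + pd 2 f (F p) * pd i (\<lambda>q. F q $ 2) p) p"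
proof -
  define S where "S = {s. p + s *\<^sub>R axis i 1 \<in> W}"
  define L where "L = (\<lambda>s. p + s *\<^sub>R axis i (1::real))"
  have L0: "L 0 = p" by (simp add: L_def)
  have S: "S \<subseteq> pd_dom i p" using W open_hp_subset by (force simp: S_def pd_dom_def)
  have F_eq: "F q = (F q $ 1) *\<^sub>R axis 1 1 + (F q $ 2) *\<^sub>R axis 2 1" for q
    by (simp add: vec_eq_2)
  define a where "a = (\<lambda>k. pd i (\<lambda>q. F q $ k) p)"
  have comp: "((\<lambda>s. F (L s) $ k) has_derivative (\<lambda>t. t * a k)) (at 0 within S)" for k
    using DERIV_subset[OF Ck_on_1_pdv[OF F p, of i k, unfolded has_pdv_def] S]
    by (simp add: has_field_derivative_def L_def a_def mult_commute_abs)
  have "((\<lambda>s. (F (L s) $ 1) *\<^sub>R axis 1 1 + (F (L s) $ 2) *\<^sub>R axis 2 1) has_derivative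
      (\<lambda>t. (t * a 1) *\<^sub>R axis 1 1 + (t * a 2) *\<^sub>R axis 2 (1::real) :: real^2)) (at 0 within S)"
    by (intro has_derivative_add has_derivative_scaleR_left comp)
  then have 1: "((\<lambda>s. F (L s)) has_derivative
      (\<lambda>t. (t * a 1) *\<^sub>R axis 1 1 + (t * a 2) *\<^sub>R axis 2 (1::real) :: real^2)) (at 0 within S)"
    by (simp only: F_eq[symmetric])
  have Fp: "F p \<in> V" using im p by auto
  have sub: "(\<lambda>s. F (L s)) ` S \<subseteq> half_plane"
    using im open_hp_subset[OF V] by (auto simp: S_def L_def)
  have 2: "(f has_derivative (\<lambda>v. v $ 1 * pd 1 f (F p) + v $ 2 * pd 2 f (F p)))
      (at (F (L 0)) within (\<lambda>s. F (L s)) ` S)"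
    unfolding L0 by (rule has_derivative_subset[OF C1_has_derivative[OF V f Fp] sub])
  have "((\<lambda>s. f (F (L s))) has_real_derivative (pd 1 f (F p) * a 1 + pd 2 f (F p) * a 2)) (at 0
      within S)"
    using has_derivative_in_compose[OF 1 2] unfolding has_field_derivative_def
    by (rule has_derivative_eq_rhs) (simp add: fun_eq_iff algebra_simps)
  moreover have "at 0 within S = at 0 within pd_dom i p"
  proof -
    have "S = pd_dom i p \<inter> S" using S by auto
    obtain T where T: "open T" "W = half_plane \<inter> T" using W by (auto simp: openin_open)
    have "open (L -` T)"
      unfolding L_def by (intro open_vimage T continuous_intros)
    moreover have "0 \<in> L -` T" using p T L0 by simp
    moreover have "S \<inter> (L -` T) - {0} = pd_dom i p \<inter> (L -` T) - {0}"
      by (auto simp: S_def pd_dom_def L_def T)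
    ultimately show ?thesis using at_within_nhd[of 0 "L -` T" S "pd_dom i p"] by simp
  qed
  ultimately show ?thesis by (simp add: has_pdv_def L_def a_def)
qed

lemma Ck_on_compose:
  assumes W: "open_hp W" and V: "open_hp V" and im: "F ` W \<subseteq> V"
  shows "(\<And>k. Ck_on n UNIV W (\<lambda>q. F q $ k)) \<Longrightarrow> Ck_on n UNIV V f \<Longrightarrow> Ck_on n UNIV W (\<lambda>q. f (F q))"
proof (induction n arbitrary: f)
  case 0
  have "continuous_on W F"
    using 0(1) continuous_on_vec_lambda[of W "\<lambda>k q. F q $ k"] by simp
  then show ?case using 0(2) im by (auto intro: continuous_on_compose2)
next
  case (Suc n)
  have f1: "Ck_on 1 UNIV V f"
    using Suc.prems(2) by (auto simp: Ck_on_1 dest: Ck_on_continuous)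
  have F1: "Ck_on 1 UNIV W (\<lambda>q. F q $ k)" for k
    using Suc.prems(1)[of k] by (auto simp: Ck_on_1 dest: Ck_on_continuous)
  have c: "continuous_on W F"
    using F1 continuous_on_vec_lambda[of W "\<lambda>k q. F q $ k"] by (auto simp: Ck_on_1)
  have IH: "Ck_on n UNIV W (\<lambda>q. pd k f (F q))" for k
    by (rule Suc.IH[OF Ck_on_Suc_D[OF Suc.prems(1)]]) (use Suc.prems(2) in simp)
  have D: "Ck_on n UNIV W
     (\<lambda>p. pd 1 f (F p) * pd i (\<lambda>q. F q $ 1) p + pd 2 f (F p) * pd i (\<lambda>q. F q $ 2) p)" for i
    by (intro Ck_on_add[OF W] Ck_on_mult[OF W] IH) (use Suc.prems(1) in simp_all)
  show ?case
  proof (rule Ck_on_SucI[OF W _ _ D])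
    show "continuous_on W (\<lambda>q. f (F q))"
      using continuous_on_compose2[OF _ c im] f1 by (auto simp: Ck_on_1)
  qed (rule has_pdv_compose[OF W V F1 f1 im])
qed

lemma open_imp_open_hp: "open V \<Longrightarrow> V \<subseteq> half_plane \<Longrightarrow> open_hp V"
  by (metis inf.absorb2 openin_open)

lemma has_pdv_line:
  assumes "has_pdv i f D (p + s *\<^sub>R axis i 1)"
  shows "((\<lambda>t. f (p + t *\<^sub>R axis i 1)) has_real_derivative D) (at s within pd_dom i p)"
proof -
  let ?q = "p + s *\<^sub>R axis i 1"
  have im: "(\<lambda>t. t - s) ` pd_dom i p \<subseteq> pd_dom i ?q"
    by (auto simp: pd_dom_def algebra_simps)
  have "((\<lambda>t. f (?q + t *\<^sub>R axis i 1)) \<circ> (\<lambda>t. t - s) has_real_derivative D * 1)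
        (at s within pd_dom i p)"
    using assms DERIV_subset[OF _ im]
    by (intro DERIV_image_chain) (auto intro!: derivative_eq_intros simp: has_pdv_def)
  moreover have "(\<lambda>t. f (?q + t *\<^sub>R axis i 1)) \<circ> (\<lambda>t. t - s) = (\<lambda>t. f (p + t *\<^sub>R axis i 1))"
    by (auto simp: fun_eq_iff algebra_simps)
  ultimately show ?thesis by simp
qed

lemma mvt_line:
  assumes "h > 0" "p \<in> half_plane"
    and D: "\<And>s. 0 \<le> s \<Longrightarrow> s \<le> h \<Longrightarrow> has_pdv i f (D s) (p + s *\<^sub>R axis i 1)"
  obtains s where "0 < s" "s < h" "f (p + h *\<^sub>R axis i 1) - f p = h * D s"
proof -
  have sub: "{0..h} \<subseteq> pd_dom i p"
    using assms(2) exhaust_2[of i] by (auto simp: pd_dom_def)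
  have "((\<lambda>t. f (p + t *\<^sub>R axis i 1)) has_derivative (\<lambda>t. t * D s)) (at s within {0..h})"
    if "0 \<le> s" "s \<le> h" for s
    using DERIV_subset[OF has_pdv_line[OF D[OF that]] sub]
    by (simp add: has_field_derivative_def mult_commute_abs)
  from mvt_simple[OF assms(1) this] show ?thesis using that by force
qed

lemma mixed_pd_eq:
  assumes V: "open_hp V" and f: "Ck_on 2 UNIV V f" and p: "p \<in> V"
  shows "pd 1 (pd 2 f) p = pd 2 (pd 1 f) p"
proof -
  have pH: "p $ 2 \<ge> 0" using p V open_hp_subset by fastforce
  obtain e where e: "e > 0"
    "\<And>q. q $ 2 \<ge> 0 \<Longrightarrow> \<bar>q $ 1 - p $ 1\<bar> < e \<Longrightarrow> \<bar>q $ 2 - p $ 2\<bar> < e \<Longrightarrow> q \<in> V"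
    using open_hp_square[OF V p] by metis
  define P where "P = (\<lambda>s t. p + s *\<^sub>R axis 1 1 + t *\<^sub>R axis 2 (1::real))"
  have P_V: "P s t \<in> V" if "0 \<le> s" "s < e" "0 \<le> t" "t < e" for s t
    using that pH by (intro e(2)) (auto simp: P_def)
  have P_alt: "P s t = p + t *\<^sub>R axis 2 1 + s *\<^sub>R axis 1 1" for s t by (simp add: P_def)
  have ex: "\<exists>a b c d. 0 < a \<and> a < h \<and> 0 < b \<and> b < h \<and> 0 < c \<and> c < h \<and> 0 < d \<and> d < h \<and>
      pd 2 (pd 1 f) (P a b) = pd 1 (pd 2 f) (P c d)" if h: "0 < h" "h < e" for h
  proof -
    have "has_pdv 1 (\<lambda>q. f (q + h *\<^sub>R axis 2 1) - f q)
        (pd 1 f (P s h) - pd 1 f (P s 0)) (p + s *\<^sub>R axis 1 1)" if "0 \<le> s" "s \<le> h" for s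
    proof -
      have "has_pdv 1 f (pd 1 f (P s h)) (P s h)" "has_pdv 1 f (pd 1 f (P s 0)) (P s 0)"
        using that h by (auto intro!: Ck_on_2_pdv[OF f] P_V)
      moreover have "pd_dom 1 (P s h) = UNIV" "pd_dom 1 (p + s *\<^sub>R axis 1 1) = UNIV"
        using pH h by (auto intro!: pd_dom_1 simp: P_def)
      ultimately show ?thesis
        unfolding has_pdv_def P_def
        by (auto intro!: derivative_eq_intros simp: algebra_simps)
    qed
    from mvt_line[OF h(1) _ this] pH obtain a where a: "0 < a" "a < h"
      "(f (P h h) - f (P h 0)) - (f (P 0 h) - f (P 0 0)) = h * (pd 1 f (P a h) - pd 1 f (P a 0))"
      by (auto simp: P_def)
    have "has_pdv 2 (pd 1 f) (pd 2 (pd 1 f) (P a t)) (P a 0 + t *\<^sub>R axis 2 1)"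
      if "0 \<le> t" "t \<le> h" for t
      using Ck_on_2_pdv2[OF f P_V[of a t], of 2 1] that a h by (simp add: P_def)
    from mvt_line[OF h(1) _ this] pH obtain b where b: "0 < b" "b < h"
      "pd 1 f (P a h) - pd 1 f (P a 0) = h * pd 2 (pd 1 f) (P a b)"
      by (auto simp: P_def)
    have "has_pdv 2 (\<lambda>q. f (q + h *\<^sub>R axis 1 1) - f q)
        (pd 2 f (P h t) - pd 2 f (P 0 t)) (p + t *\<^sub>R axis 2 1)" if "0 \<le> t" "t \<le> h" for t
    proof -
      have "has_pdv 2 f (pd 2 f (P h t)) (P h t)" "has_pdv 2 f (pd 2 f (P 0 t)) (P 0 t)"
        using that h by (auto intro!: Ck_on_2_pdv[OF f] P_V)
      moreover have "pd_dom 2 (P h t) = pd_dom 2 (p + t *\<^sub>R axis 2 1)"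
        "pd_dom 2 (P 0 t) = pd_dom 2 (p + t *\<^sub>R axis 2 1)"
        by (auto simp: P_def pd_dom_2)
      ultimately show ?thesis
        unfolding has_pdv_def P_def
        by (auto intro!: derivative_eq_intros simp: algebra_simps)
    qed
    from mvt_line[OF h(1) _ this] pH obtain d where d: "0 < d" "d < h"
      "(f (P h h) - f (P 0 h)) - (f (P h 0) - f (P 0 0)) = h * (pd 2 f (P h d) - pd 2 f (P 0 d))"
      by (auto simp: P_alt)
    have "has_pdv 1 (pd 2 f) (pd 1 (pd 2 f) (P s d)) (P 0 d + s *\<^sub>R axis 1 1)"
      if "0 \<le> s" "s \<le> h" for s
      using Ck_on_2_pdv2[OF f P_V[of s d], of 1 2] that d h by (simp add: P_alt)
    from mvt_line[OF h(1) _ this] pH d obtain c where c: "0 < c" "c < h"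
      "pd 2 f (P h d) - pd 2 f (P 0 d) = h * pd 1 (pd 2 f) (P c d)"
      by (auto simp: P_alt)
    have "h * (h * pd 2 (pd 1 f) (P a b)) = h * (h * pd 1 (pd 2 f) (P c d))"
      using a(3)[unfolded b(3)] d(3)[unfolded c(3)] by linarith
    then have "pd 2 (pd 1 f) (P a b) = pd 1 (pd 2 f) (P c d)" using h by simp
    with a b c d show ?thesis by blast
  qed
  define h where "h = (\<lambda>n. e / 2 * inverse (real (Suc n)))"
  have h: "0 < h n" "h n < e" for n
  proof -
    have "inverse (real (Suc n)) \<le> 1" by (simp add: field_simps)
    then have "h n \<le> e / 2 * 1" unfolding h_def using e(1) by (intro mult_left_mono) auto
    then show "h n < e" using e(1) by simp
    show "0 < h n" using e(1) by (simp add: h_def)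
  qed
  have h_lim: "h \<longlonglongrightarrow> 0"
    unfolding h_def by (intro tendsto_mult_right_zero LIMSEQ_inverse_real_of_nat)
  from ex[OF h] obtain a b c d where abcd: "\<And>n. 0 < a n" "\<And>n. a n < h n" "\<And>n. 0 < b n" "\<And>n.
      b n < h n"
     "\<And>n. 0 < c n" "\<And>n. c n < h n" "\<And>n. 0 < d n" "\<And>n. d n < h n"
     "\<And>n. pd 2 (pd 1 f) (P (a n) (b n)) = pd 1 (pd 2 f) (P (c n) (d n))" by metis
  have lims: "a \<longlonglongrightarrow> 0" "b \<longlonglongrightarrow> 0" "c \<longlonglongrightarrow> 0" "d \<longlonglongrightarrow> 0"
    using abcd(1-8)[THEN less_imp_le] by (auto intro: tendsto_sandwich[OF _ _ tendsto_const h_lim])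
  have PV: "P (a n) (b n) \<in> V" "P (c n) (d n) \<in> V" for n
    using less_trans[OF abcd(2) h(2), of n] less_trans[OF abcd(4) h(2), of n]
      less_trans[OF abcd(6) h(2), of n] less_trans[OF abcd(8) h(2), of n] abcd(1,3,5,7)[of n]
    by (auto intro!: P_V)
  have P_lim: "(\<lambda>n. P (a n) (b n)) \<longlonglongrightarrow> p" "(\<lambda>n. P (c n) (d n)) \<longlonglongrightarrow> p"
    unfolding P_def using lims by (auto intro!: tendsto_eq_intros)
  have cont: "continuous_on V (pd 2 (pd 1 f))" "continuous_on V (pd 1 (pd 2 f))"
    using f by (simp_all add: Ck_on_2 Ck_on_1)
  have "(\<lambda>n. pd 2 (pd 1 f) (P (a n) (b n))) \<longlonglongrightarrow> pd 2 (pd 1 f) p"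
    using continuous_on_tendsto_compose[OF cont(1) P_lim(1) p] PV by simp
  moreover have "(\<lambda>n. pd 2 (pd 1 f) (P (a n) (b n))) \<longlonglongrightarrow> pd 1 (pd 2 f) p"
    using continuous_on_tendsto_compose[OF cont(2) P_lim(2) p] PV abcd(9) by simp
  ultimately show ?thesis by (metis LIMSEQ_unique)
qed

section \<open>The second derivative test\<close>

lemma second_derivative_test_real:
  fixes g :: "real \<Rightarrow> real"
  assumes d: "d > 0" and g: "\<And>s. \<bar>s\<bar> < d \<Longrightarrow> (g has_real_derivative g' s) (at s)"
    and g': "(g' has_real_derivative c) (at 0)" and m: "\<And>s. \<bar>s\<bar> < d \<Longrightarrow> g 0 \<le> g s"
  shows "g' 0 = 0" "c \<ge> 0"
proof -
  show z: "g' 0 = 0"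
    by (rule DERIV_local_min[OF g[of 0] d]) (use m d in auto)
  show "c \<ge> 0"
  proof (rule ccontr)
    assume "\<not> c \<ge> 0"
    then obtain e where e: "e > 0" "\<And>h. 0 < h \<Longrightarrow> h < e \<Longrightarrow> g' h < 0"
      using DERIV_neg_dec_right[OF g'] z by auto
    define h where "h = min d e / 2"
    have h: "0 < h" "h < d" "h < e" using d e by (auto simp: h_def)
    obtain s where "0 < s" "s < h" "g h - g 0 = (h - 0) * g' s"
      using MVT2[of 0 h g g'] g h by auto
    moreover from this have "g' s < 0" using e h by auto
    ultimately have "g h < g 0" using h by (smt (verit) mult_pos_neg)
    then show False using m[of h] h by simp
  qed
qed

lemma second_derivative_test:
  assumes V: "open V" "V \<subseteq> {q. q $ 2 > 0}" and f: "Ck_on 2 UNIV V f" and p: "p \<in> V"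
    and m: "\<And>q. q \<in> V \<Longrightarrow> f p \<le> f q"
  shows "pd i f p = 0"
    and "v1\<^sup>2 * pd 1 (pd 1 f) p + v1 * v2 * (pd 1 (pd 2 f) p + pd 2 (pd 1 f) p) + v2\<^sup>2 * pd 2 (pd
        2 f) p \<ge> 0"
proof -
  have VH: "open_hp V" using V by (intro open_imp_open_hp) auto
  obtain e where e: "e > 0" "ball p e \<subseteq> V"
    using V(1) p by (meson open_contains_ball)
  have at: "at q within half_plane = at q" if "q \<in> V" for q
    using that V at_within_nhd[of q V half_plane UNIV] by fastforce
  have main: "v $ 1 * pd 1 f p + v $ 2 * pd 2 f p = 0 \<and>
     v $ 1 * (v $ 1 * pd 1 (pd 1 f) p + v $ 2 * pd 2 (pd 1 f) p)
       + v $ 2 * (v $ 1 * pd 1 (pd 2 f) p + v $ 2 * pd 2 (pd 2 f) p) \<ge> 0" for v :: "real^2"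
  proof -
    define L where "L = (\<lambda>s. p + s *\<^sub>R v)"
    define d where "d = e / (norm v + 1)"
    have nv: "norm v + 1 > 0" by (smt (verit) norm_ge_zero)
    have d: "d > 0" unfolding d_def using nv e(1) by simp
    have LV: "L s \<in> V" if "\<bar>s\<bar> < d" for s
    proof -
      have "norm (s *\<^sub>R v) \<le> \<bar>s\<bar> * (norm v + 1)" by (simp add: mult_left_mono)
      also have "\<dots> < e" using that nv by (simp add: d_def field_simps)
      finally show ?thesis using e(2) by (auto simp: L_def dist_norm)
    qed
    have DL: "((\<lambda>s. h (L s)) has_real_derivative (v $ 1 * pd 1 h (L s) + v $ 2 * pd 2 h (L s)))
        (at s)"
      if "Ck_on 1 UNIV V h" "\<bar>s\<bar> < d" for h s
    proof -
      have 1: "(L has_derivative (\<lambda>t. t *\<^sub>R v)) (at s)"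
        unfolding L_def by (auto intro!: derivative_eq_intros)
      have 2: "(h has_derivative (\<lambda>v. v $ 1 * pd 1 h (L s) + v $ 2 * pd 2 h (L s))) (at (L s))"
        using C1_has_derivative[OF VH that(1) LV[OF that(2)]] at[OF LV[OF that(2)]] by simp
      show ?thesis
        using has_derivative_compose[OF 1 2] unfolding has_field_derivative_def
        by (rule has_derivative_eq_rhs) (simp add: fun_eq_iff algebra_simps)
    qed
    have C1: "Ck_on 1 UNIV V f" "Ck_on 1 UNIV V (pd i f)" for i
      using f by (auto simp: Ck_on_2 intro: Ck_on_2_D1)
    note test = second_derivative_test_real[of d "\<lambda>s. f (L s)"
        "\<lambda>s. v $ 1 * pd 1 f (L s) + v $ 2 * pd 2 f (L s)", OF d DL[OF C1(1)]]
    have L0: "L 0 = p" by (simp add: L_def)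
    have "((\<lambda>s. v $ 1 * pd 1 f (L s) + v $ 2 * pd 2 f (L s)) has_real_derivative
        v $ 1 * (v $ 1 * pd 1 (pd 1 f) p + v $ 2 * pd 2 (pd 1 f) p)
       + v $ 2 * (v $ 1 * pd 1 (pd 2 f) p + v $ 2 * pd 2 (pd 2 f) p)) (at 0)"
      using DL[OF C1(2), of 0] d L0 by (auto intro!: derivative_eq_intros)
    from test[OF _ this] show ?thesis
      using m LV L0 by simp
  qed
  show "pd i f p = 0"
    using main[of "axis i 1"] exhaust_2[of i] by auto
  show "v1\<^sup>2 * pd 1 (pd 1 f) p + v1 * v2 * (pd 1 (pd 2 f) p + pd 2 (pd 1 f) p) + v2\<^sup>2 * pd 2 (pd 2
      f) p \<ge> 0"
    using main[of "vector [v1, v2]"] by (simp add: algebra_simps power2_eq_square)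
qed

lemma quadratic_form_trace_nonneg:
  fixes a b c p q r s :: real
  assumes form: "\<And>x y. x\<^sup>2 * p + x * y * (q + r) + y\<^sup>2 * s \<ge> 0" and A: "a > 0" "b\<^sup>2 \<le> a * c"
  shows "a * p + b * (q + r) + c * s \<ge> 0"
proof -
  have s: "s \<ge> 0" using form[of 0 1] by simp
  have "0 \<le> (a\<^sup>2 * p + a * b * (q + r) + b\<^sup>2 * s) + (a * c - b\<^sup>2) * s"
    using form[of a b] A s by (simp add: mult_nonneg_nonneg)
  also have "\<dots> = a * (a * p + b * (q + r) + c * s)"
    by algebra
  finally show ?thesis using A(1) by (meson linorder_not_le mult_pos_neg)
qed

lemma elliptic_at_min:
  assumes "open V" "V \<subseteq> {q. q $ 2 > 0}" "Ck_on 2 UNIV V f" "p \<in> V"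
    and "\<And>q. q \<in> V \<Longrightarrow> f p \<le> f q"
    and A: "a11 > 0" "a12\<^sup>2 \<le> a11 * a22"
  shows "a11 * pd 1 (pd 1 f) p + a12 * (pd 1 (pd 2 f) p + pd 2 (pd 1 f) p) + a22 * pd 2 (pd 2 f) p
      \<ge> 0"
proof (rule quadratic_form_trace_nonneg[OF _ A])
  fix x y :: real
  show "x\<^sup>2 * pd 1 (pd 1 f) p + x * y * (pd 1 (pd 2 f) p + pd 2 (pd 1 f) p) + y\<^sup>2 * pd 2 (pd 2 f)
      p \<ge> 0"
    by (rule second_derivative_test(2)[OF assms(1-4)]) (rule assms(5))
qed

section \<open>Metrics in coordinates\<close>

definition pos_def_2 :: "real^2^2 \<Rightarrow> bool" where
  "pos_def_2 G \<longleftrightarrow> G $ 2 $ 1 = G $ 1 $ 2 \<and> G $ 1 $ 1 > 0 \<and> G $ 2 $ 2 > 0 \<and>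
     G $ 1 $ 1 * G $ 2 $ 2 - G $ 1 $ 2 * G $ 1 $ 2 > 0"

lemma pos_def_2I:
  fixes G :: "real^2^2"
  assumes "transpose G = G" "\<And>v. v \<noteq> 0 \<Longrightarrow> v \<bullet> (G *v v) > 0"
  shows "pos_def_2 G"
proof -
  have sym: "G $ 2 $ 1 = G $ 1 $ 2"
    using arg_cong[OF assms(1), of "\<lambda>A. A $ 1 $ 2"] by (simp add: transpose_def)
  have form: "v \<bullet> (G *v v) = v $ 1 * (G $ 1 $ 1 * v $ 1 + G $ 1 $ 2 * v $ 2)
      + v $ 2 * (G $ 2 $ 1 * v $ 1 + G $ 2 $ 2 * v $ 2)" for v
    by (simp add: inner_vec_def matrix_vector_mult_def sum_2)
  have pos: "G $ 1 $ 1 > 0" "G $ 2 $ 2 > 0"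
    using assms(2)[of "axis 1 1"] assms(2)[of "axis 2 1"] form[of "axis 1 1"] form[of "axis 2 1"]
    by (auto simp: vec_eq_2)
  define v :: "real^2" where "v = vector [- G $ 1 $ 2, G $ 1 $ 1]"
  have "v \<noteq> 0" using pos by (auto simp: vec_eq_2 v_def)
  from assms(2)[OF this]
  have "0 < G $ 1 $ 1 * (G $ 1 $ 1 * G $ 2 $ 2 - G $ 1 $ 2 * G $ 1 $ 2)"
    unfolding form v_def sym by (simp add: algebra_simps)
  then have "G $ 1 $ 1 * G $ 2 $ 2 - G $ 1 $ 2 * G $ 1 $ 2 > 0"
    using pos by (simp add: zero_less_mult_iff)
  then show ?thesis using sym pos by (simp add: pos_def_2_def)
qed

lemma matrix_inv_2:
  assumes "pos_def_2 G"
  shows "matrix_inv G $ 1 $ 1 = G $ 2 $ 2 / det G" "matrix_inv G $ 1 $ 2 = - G $ 1 $ 2 / det G"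
    "matrix_inv G $ 2 $ 1 = - G $ 1 $ 2 / det G" "matrix_inv G $ 2 $ 2 = G $ 1 $ 1 / det G"
    "det G = G $ 1 $ 1 * G $ 2 $ 2 - G $ 1 $ 2 * G $ 1 $ 2" "det G > 0"
proof -
  show d: "det G = G $ 1 $ 1 * G $ 2 $ 2 - G $ 1 $ 2 * G $ 1 $ 2" "det G > 0"
    using assms by (simp_all add: pos_def_2_def det_2)
  have "\<exists>B. G ** B = mat 1 \<and> B ** G = mat 1"
    using d(2) by (simp add: invertible_det_nz flip: invertible_def)
  then have "matrix_inv G ** G = mat 1"
    unfolding matrix_inv_def by (rule someI2_ex) simp
  then have e: "(matrix_inv G ** G) $ i $ j = (if i = j then 1 else 0)" for i j
    by (simp add: mat_def)
  have e': "matrix_inv G $ i $ 1 * G $ 1 $ j + matrix_inv G $ i $ 2 * G $ 2 $ j = (if i =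
      j then 1 else 0)" for i j
    using e[of i j] by (simp add: matrix_matrix_mult_def sum_2)
  have s: "G $ 2 $ 1 = G $ 1 $ 2" using assms by (simp add: pos_def_2_def)
  note e11 = e'[of 1 1, unfolded s, simplified] and e12 = e'[of 1 2, unfolded s, simplified]
    and e21 = e'[of 2 1, unfolded s, simplified] and e22 = e'[of 2 2, unfolded s, simplified]
  have "matrix_inv G $ 1 $ 1 * det G = G $ 2 $ 2" unfolding d using e11 e12 by algebra
  then show "matrix_inv G $ 1 $ 1 = G $ 2 $ 2 / det G" using d(2) by (simp add: field_simps)
  have "matrix_inv G $ 1 $ 2 * det G = - G $ 1 $ 2" unfolding d using e11 e12 by algebra
  then show "matrix_inv G $ 1 $ 2 = - G $ 1 $ 2 / det G" using d(2) by (simp add: field_simps)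
  have "matrix_inv G $ 2 $ 1 * det G = - G $ 1 $ 2" unfolding d using e21 e22 by algebra
  then show "matrix_inv G $ 2 $ 1 = - G $ 1 $ 2 / det G" using d(2) by (simp add: field_simps)
  have "matrix_inv G $ 2 $ 2 * det G = G $ 1 $ 1" unfolding d using e21 e22 by algebra
  then show "matrix_inv G $ 2 $ 2 = G $ 1 $ 1 / det G" using d(2) by (simp add: field_simps)
qed

lemma matrix_inv_pos:
  assumes "pos_def_2 G"
  shows "matrix_inv G $ 1 $ 1 > 0" "matrix_inv G $ 2 $ 2 > 0"
    "matrix_inv G $ 2 $ 1 = matrix_inv G $ 1 $ 2"
    "(matrix_inv G $ 1 $ 2)\<^sup>2 < matrix_inv G $ 1 $ 1 * matrix_inv G $ 2 $ 2"
proof -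
  note m = matrix_inv_2[OF assms]
  show "matrix_inv G $ 1 $ 1 > 0" "matrix_inv G $ 2 $ 2 > 0"
    "matrix_inv G $ 2 $ 1 = matrix_inv G $ 1 $ 2"
    using assms m(6) unfolding m(1-4) by (auto simp: pos_def_2_def)
  have "(G $ 1 $ 2)\<^sup>2 < G $ 1 $ 1 * G $ 2 $ 2" using m(5,6) by (simp add: power2_eq_square)
  then show "(matrix_inv G $ 1 $ 2)\<^sup>2 < matrix_inv G $ 1 $ 1 * matrix_inv G $ 2 $ 2"
    using m(6) unfolding m(1-4)
    by (simp add: power2_eq_square divide_strict_right_mono mult.commute)
qed

lemma pos_def_2_scaleR:
  assumes "pos_def_2 G" "E > 0"
  shows "pos_def_2 (E *\<^sub>R G)" "matrix_inv (E *\<^sub>R G) $ i $ j = matrix_inv G $ i $ j / E"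
proof -
  have "E * E * (G $ 1 $ 1 * G $ 2 $ 2 - G $ 1 $ 2 * G $ 1 $ 2) > 0"
    using assms by (simp add: pos_def_2_def)
  also have "E * E * (G $ 1 $ 1 * G $ 2 $ 2 - G $ 1 $ 2 * G $ 1 $ 2)
      = (E * G $ 1 $ 1) * (E * G $ 2 $ 2) - (E * G $ 1 $ 2) * (E * G $ 1 $ 2)"
    by algebra
  finally show pos: "pos_def_2 (E *\<^sub>R G)"
    using assms by (simp add: pos_def_2_def)
  have det: "det (E *\<^sub>R G) = E * E * det G"
    by (simp add: det_2 algebra_simps)
  have D: "det G > 0" using matrix_inv_2[OF assms(1)] by simp
  show "matrix_inv (E *\<^sub>R G) $ i $ j = matrix_inv G $ i $ j / E"
    using exhaust_2[of i] exhaust_2[of j] assms(2) D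
    by (elim disjE; simp only: matrix_inv_2(1-4)[OF pos] matrix_inv_2(1-4)[OF assms(1)] det
        vector_scaleR_component) (simp_all add: field_simps)
qed

definition christoffel_fst :: "(real^2 \<Rightarrow> real^2^2) \<Rightarrow> 2 \<Rightarrow> 2 \<Rightarrow> 2 \<Rightarrow> real^2 \<Rightarrow> real" where
  "christoffel_fst G l i j p =
     (pd i (\<lambda>q. G q $ j $ l) p + pd j (\<lambda>q. G q $ i $ l) p - pd l (\<lambda>q. G q $ i $ j) p) / 2"

lemma christoffel_eq:
  "christoffel G k i j p =
     matrix_inv (G p) $ k $ 1 * christoffel_fst G 1 i j p +
     matrix_inv (G p) $ k $ 2 * christoffel_fst G 2 i j p"
  by (simp add: christoffel_def christoffel_fst_def sum_2 field_simps)

lemma christoffel_lower: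
  assumes "pos_def_2 (G p)"
  shows "G p $ 1 $ 1 * christoffel G 1 i j p + G p $ 1 $ 2 * christoffel G 2 i j p =
      christoffel_fst G 1 i j p"
    "G p $ 1 $ 2 * christoffel G 1 i j p + G p $ 2 $ 2 * christoffel G 2 i j p = christoffel_fst G
        2 i j p"
proof -
  note m = matrix_inv_2[OF assms]
  obtain D where D: "D = det (G p)" by simp
  have D0: "D \<noteq> 0" "D = G p $ 1 $ 1 * G p $ 2 $ 2 - G p $ 1 $ 2 * G p $ 1 $ 2" using m(5,6) D
      by auto
  show "G p $ 1 $ 1 * christoffel G 1 i j p + G p $ 1 $ 2 * christoffel G 2 i j p =
      christoffel_fst G 1 i j p"
    unfolding christoffel_eq m(1-4) D[symmetric] using D0(1)
    by (simp add: field_simps) (use D0(2) in algebra)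
  show "G p $ 1 $ 2 * christoffel G 1 i j p + G p $ 2 $ 2 * christoffel G 2 i j p =
      christoffel_fst G 2 i j p"
    unfolding christoffel_eq m(1-4) D[symmetric] using D0(1)
    by (simp add: field_simps) (use D0(2) in algebra)
qed

lemma coord_normal_eq:
  shows "coord_normal G p $ 1 = - matrix_inv (G p) $ 1 $ 2 / sqrt (matrix_inv (G p) $ 2 $ 2)"
    "coord_normal G p $ 2 = - matrix_inv (G p) $ 2 $ 2 / sqrt (matrix_inv (G p) $ 2 $ 2)"
  by (simp_all add: coord_normal_def)

lemma coord_geodesic_curvature_eq:
  assumes "pos_def_2 (G p)"
  shows "coord_geodesic_curvature G p =
    christoffel G 2 1 1 p / (sqrt (matrix_inv (G p) $ 2 $ 2) * G p $ 1 $ 1)"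
proof -
  define r where "r = sqrt (matrix_inv (G p) $ 2 $ 2)"
  have r: "r > 0" using matrix_inv_pos[OF assms] by (simp add: r_def)
  note m = matrix_inv_2[OF assms]
  have D: "det (G p) \<noteq> 0" using m(6) by simp
  have s: "G p $ 2 $ 1 = G p $ 1 $ 2" using assms by (simp add: pos_def_2_def)
  have "G p $ 1 $ 1 * (matrix_inv (G p) $ 1 $ 2) + G p $ 1 $ 2 * (matrix_inv (G p) $ 2 $ 2) = 0"
    unfolding m(1-4) using D by (simp add: field_simps)
  then have 1: "(G p *v coord_normal G p) $ 1 = 0"
    using r unfolding matrix_vector_mult_def
    by (simp add: sum_2 coord_normal_eq flip: r_def) (simp add: field_simps)
  have "G p $ 1 $ 2 * (matrix_inv (G p) $ 1 $ 2) + G p $ 2 $ 2 * (matrix_inv (G p) $ 2 $ 2) = 1"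
    unfolding m(1-4) using D by (simp add: field_simps) (use m(5) in algebra)
  moreover have "(G p *v coord_normal G p) $ 2 =
      - (G p $ 1 $ 2 * matrix_inv (G p) $ 1 $ 2 + G p $ 2 $ 2 * matrix_inv (G p) $ 2 $ 2) / r"
    unfolding matrix_vector_mult_def
    by (simp add: sum_2 s coord_normal_eq diff_divide_distrib flip: r_def)
  ultimately have 2: "(G p *v coord_normal G p) $ 2 = - 1 / r"
    by simp
  show ?thesis
    unfolding coord_geodesic_curvature_def inner_vec_def sum_2 using 1 2 r
    by (simp add: r_def[symmetric])
qed

lemma coord_geodesic_curvature_conformal:
  assumes V: "open_hp V" and p: "p \<in> V" and G: "\<And>i j. Ck_on 1 UNIV V (\<lambda>q. G q $ i $ j)"
    and pos: "pos_def_2 (G p)" and u: "Ck_on 1 UNIV V u"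
  shows "coord_geodesic_curvature (\<lambda>q. exp (2 * u q) *\<^sub>R G q) p = exp (- u p) *
     ((\<Sum>i\<in>UNIV. coord_normal G p $ i * pd i u p) + coord_geodesic_curvature G p)"
proof -
  define E where "E = exp (2 * u p)"
  define e where "e = exp (u p)"
  have e: "e > 0" "E = e * e" "exp (- u p) = 1 / e"
    unfolding E_def e_def by (simp_all add: exp_minus field_simps flip: exp_add)
  have pH: "p \<in> half_plane" using p V open_hp_subset by blast
  let ?G = "\<lambda>q. exp (2 * u q) *\<^sub>R G q"
  have dG: "pd k (\<lambda>q. ?G q $ i $ j) p = E * (2 * pd k u p * G p $ i $ j + pd k (\<lambda>q. G q $ i $ j)
      p)" for k i j
  proof -
    have "has_pdv k (\<lambda>q. exp (2 * u q) * G q $ i $ j)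
       (exp (2 * u p) * pd k (\<lambda>q. G q $ i $ j) p + exp (2 * u p) * (2 * pd k u p) * G p $ i $ j) p"
      by (intro has_pdv_mult has_pdv_chain_real[OF DERIV_exp] has_pdv_cmult Ck_on_1_pdv[OF u p]
          Ck_on_1_pdv[OF G p])
    from has_pdv_imp(2)[OF this pH] show ?thesis by (simp add: E_def algebra_simps)
  qed
  have "E > 0" by (simp add: E_def)
  note sc = pos_def_2_scaleR[OF pos this, unfolded E_def]
  have pos': "pos_def_2 (?G p)" by (rule sc(1))
  have D: "det (G p) > 0" using matrix_inv_2[OF pos] by simp
  have inv: "matrix_inv (?G p) $ i $ j = matrix_inv (G p) $ i $ j / E" for i j
    using sc(2) by (simp add: E_def)
  define r where "r = sqrt (matrix_inv (G p) $ 2 $ 2)"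
  have r: "r > 0" "r * r = matrix_inv (G p) $ 2 $ 2" using matrix_inv_pos[OF pos]
      by (simp_all add: r_def)
  have r': "sqrt (matrix_inv (?G p) $ 2 $ 2) = r / e"
    using e by (simp add: inv r_def real_sqrt_divide)
  have c: "christoffel_fst ?G l 1 1 p = E * ((if l = 1 then 2 * pd 1 u p * G p $ 1 $ 1 else
       2 * pd 1 u p * G p $ 1 $ l) - pd l u p * G p $ 1 $ 1 + christoffel_fst G l 1 1 p)" for l
    unfolding christoffel_fst_def dG by (simp add: field_simps)
  note m = matrix_inv_2[OF pos]
  have id1: "matrix_inv (G p) $ 2 $ 1 * G p $ 1 $ 1 + matrix_inv (G p) $ 2 $ 2 * G p $ 1 $ 2 = 0"
    unfolding m(1-4) using D by (simp add: field_simps)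
  have chr: "christoffel ?G 2 1 1 p = christoffel G 2 1 1 p
      - G p $ 1 $ 1 * (matrix_inv (G p) $ 2 $ 1 * pd 1 u p + matrix_inv (G p) $ 2 $ 2 * pd 2 u p)"
  proof -
    have "E \<noteq> 0" using e by simp
    then have "christoffel ?G 2 1 1 p = christoffel G 2 1 1 p
      - G p $ 1 $ 1 * (matrix_inv (G p) $ 2 $ 1 * pd 1 u p + matrix_inv (G p) $ 2 $ 2 * pd 2 u p)
      + 2 * pd 1 u p * (matrix_inv (G p) $ 2 $ 1 * G p $ 1 $ 1 + matrix_inv (G p) $ 2 $ 2 * G p $
          1 $ 2)"
      unfolding christoffel_eq c inv by (simp add: algebra_simps add_divide_distrib
          diff_divide_distrib)
    then show ?thesis using id1 by simp
  qed
  have s21: "matrix_inv (G p) $ 2 $ 1 = matrix_inv (G p) $ 1 $ 2" using m by simp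
  have G11: "G p $ 1 $ 1 > 0" using pos by (simp add: pos_def_2_def)
  have "coord_geodesic_curvature ?G p = christoffel ?G 2 1 1 p / (r / e * (E * G p $ 1 $ 1))"
    unfolding coord_geodesic_curvature_eq[of ?G p, OF pos'] r' by (simp add: E_def)
  also have "\<dots> = 1 / e * (- (matrix_inv (G p) $ 1 $ 2 * pd 1 u p + matrix_inv (G p) $ 2 $ 2 * pd 2
      u p) / r
      + christoffel G 2 1 1 p / (r * G p $ 1 $ 1))"
    unfolding chr s21 e(2) using e(1) r(1) G11 by (simp add: field_simps)
  finally show ?thesis
    unfolding coord_geodesic_curvature_eq[of G p, OF pos] e(3) sum_2 coord_normal_eq
        r_def[symmetric]
    by (simp add: add_divide_distrib diff_divide_distrib)
qed

section \<open>Change of coordinates: algebra\<close>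

lemma christoffel_fst_algebra:
  fixes J g :: "2 \<Rightarrow> 2 \<Rightarrow> real" and dJ dg :: "2 \<Rightarrow> 2 \<Rightarrow> 2 \<Rightarrow> real"
  assumes symJ: "\<And>m i j. dJ m i j = dJ m j i" and symg: "g 2 1 = g 1 2" "\<And>r. dg r 2 1 = dg r 1 2"
    and dG: "\<And>k i j. dG k i j = (\<Sum>m\<in>UNIV. \<Sum>n\<in>UNIV. dJ m k i * g m n * J n j
        + J m i * (\<Sum>r\<in>UNIV. dg r m n * J r k) * J n j + J m i * g m n * dJ n k j)"
  shows "(dG i j l + dG j i l - dG l i j) / 2 =
     (\<Sum>r\<in>UNIV. J r l * ((\<Sum>m\<in>UNIV. \<Sum>n\<in>UNIV. (dg m n r + dg n m r - dg r m n) / 2 * J m i * J n j)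
       + (\<Sum>m\<in>UNIV. g r m * dJ m i j)))"
  unfolding dG sum_2 symg symJ[of _ j i] symJ[of _ l i] symJ[of _ l j]
  by (simp add: field_simps)

lemma christoffel_cancel_algebra:
  fixes J g :: "2 \<Rightarrow> 2 \<Rightarrow> real"
  assumes symg: "g 2 1 = g 1 2" and g: "g 1 1 * g 2 2 - g 1 2 * g 1 2 \<noteq> 0"
    and J: "J 1 1 * J 2 2 - J 1 2 * J 2 1 \<noteq> 0"
    and G: "\<And>i j. G i j = (\<Sum>m\<in>UNIV. \<Sum>n\<in>UNIV. J m i * g m n * J n j)"
    and eq: "\<And>l. (\<Sum>k\<in>UNIV. G l k * Z k) =
      (\<Sum>r\<in>UNIV. J r l * (\<Sum>m\<in>UNIV. g r m * W m))"
  shows "(\<Sum>k\<in>UNIV. J m k * Z k) = W m"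
proof -
  define X where "X = (\<lambda>m. (\<Sum>k\<in>UNIV. J m k * Z k) - W m)"
  define Y where "Y = (\<lambda>r. g r 1 * X 1 + g r 2 * X 2)"
  have "J 1 l * Y 1 + J 2 l * Y 2 = 0" for l
    using eq[of l] unfolding G X_def Y_def sum_2 by (simp add: algebra_simps)
  from this[of 1] this[of 2]
  have "(J 1 1 * J 2 2 - J 1 2 * J 2 1) * Y 1 = 0" "(J 1 1 * J 2 2 - J 1 2 * J 2 1) * Y 2 = 0"
    by algebra+
  with J have "Y 1 = 0" "Y 2 = 0" by simp_all
  then have "(g 1 1 * g 2 2 - g 1 2 * g 1 2) * X 1 = 0" "(g 1 1 * g 2 2 - g 1 2 * g 1 2) * X 2 = 0"
    unfolding Y_def symg by algebra+
  with g have "X 1 = 0" "X 2 = 0" by simp_all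
  then show ?thesis using exhaust_2[of m] by (auto simp: X_def)
qed

lemma hessian_algebra:
  fixes J :: "2 \<Rightarrow> 2 \<Rightarrow> real" and dJ :: "2 \<Rightarrow> 2 \<Rightarrow> 2 \<Rightarrow> real"
  assumes chr: "\<And>m. (\<Sum>k\<in>UNIV. J m k * Z k) = (\<Sum>r\<in>UNIV. \<Sum>s\<in>UNIV. Gd m r s * J r i * J s j) +
      dJ m i j"
    and f1: "\<And>k. fc k = (\<Sum>m\<in>UNIV. fd m * J m k)"
    and f2: "ffc = (\<Sum>m\<in>UNIV. (\<Sum>r\<in>UNIV. ffd r m * J r i) * J m j + fd m * dJ m i j)"
  shows "ffc - (\<Sum>k\<in>UNIV. Z k * fc k) =
    (\<Sum>r\<in>UNIV. \<Sum>m\<in>UNIV. J r i * J m j * (ffd r m - (\<Sum>s\<in>UNIV. Gd s r m * fd s)))"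
proof -
  have d: "dJ m i j = J m 1 * Z 1 + J m 2 * Z 2 - (Gd m 1 1 * J 1 i * J 1 j + Gd m 1 2 * J 1 i * J
      2 j
      + (Gd m 2 1 * J 2 i * J 1 j + Gd m 2 2 * J 2 i * J 2 j))" for m
    using chr[of m] by (simp add: sum_2)
  show ?thesis unfolding f1 f2 sum_2 d by (simp add: algebra_simps)
qed

lemma inverse_metric_algebra:
  fixes J :: "2 \<Rightarrow> 2 \<Rightarrow> real" and A B :: "real^2^2"
  assumes A: "pos_def_2 A" and B: "pos_def_2 B"
    and AB: "\<And>i j. A $ i $ j = (\<Sum>m\<in>UNIV. \<Sum>n\<in>UNIV. J m i * B $ m $ n * J n j)"
  shows "(\<Sum>i\<in>UNIV. \<Sum>j\<in>UNIV. J r i * matrix_inv A $ i $ j * J s j) = matrix_inv B $ r $ s"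
    and "J 1 1 * J 2 2 - J 1 2 * J 2 1 \<noteq> 0"
proof -
  note a = matrix_inv_2[OF A] and b = matrix_inv_2[OF B]
  have s: "B $ 2 $ 1 = B $ 1 $ 2" using B by (simp add: pos_def_2_def)
  define D where "D = J 1 1 * J 2 2 - J 1 2 * J 2 1"
  have det: "det A = D * D * det B"
    unfolding a(5) b(5) AB D_def sum_2 s by algebra
  then show J: "J 1 1 * J 2 2 - J 1 2 * J 2 1 \<noteq> 0" using a(6) unfolding D_def by auto
  then have nz: "D \<noteq> 0" "det B \<noteq> 0" using b(6) by (auto simp: D_def)
  have key: "(J r 1 * A $ 2 $ 2 * J s 1 - J r 1 * A $ 1 $ 2 * J s 2) + (J r 2 * A $ 1 $ 1 * J s 2
      - J r 2 * A $ 1 $ 2 * J s 1)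
    = D * D * (if r = 1 then (if s = 1 then B $ 2 $ 2 else - B $ 1 $ 2) else
        (if s = 1 then - B $ 1 $ 2 else B $ 1 $ 1))"
    using exhaust_2[of r] exhaust_2[of s] unfolding AB D_def sum_2 s
    by (elim disjE; simp add: algebra_simps)
  have "(\<Sum>i\<in>UNIV. \<Sum>j\<in>UNIV. J r i * matrix_inv A $ i $ j * J s j) =
     ((J r 1 * A $ 2 $ 2 * J s 1 - J r 1 * A $ 1 $ 2 * J s 2) + (J r 2 * A $ 1 $ 1 * J s 2
      - J r 2 * A $ 1 $ 2 * J s 1)) / det A"
    unfolding sum_2 a(1-4) by (simp add: add_divide_distrib diff_divide_distrib)
  also have "\<dots> = matrix_inv B $ r $ s"
    unfolding key det using nz exhaust_2[of r] exhaust_2[of s]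
    by (elim disjE; simp only: b(1-4); simp add: field_simps)
  finally show "(\<Sum>i\<in>UNIV. \<Sum>j\<in>UNIV. J r i * matrix_inv A $ i $ j * J s j) = matrix_inv B $ r $ s" .
qed

lemma trace_algebra:
  fixes J P H h :: "2 \<Rightarrow> 2 \<Rightarrow> real"
  assumes P: "\<And>r s. (\<Sum>i\<in>UNIV. \<Sum>j\<in>UNIV. J r i * P i j * J s j) = Q r s"
    and H: "\<And>i j. H i j = (\<Sum>r\<in>UNIV. \<Sum>m\<in>UNIV. J r i * J m j * h r m)"
  shows "(\<Sum>i\<in>UNIV. \<Sum>j\<in>UNIV. P i j * H i j) = (\<Sum>i\<in>UNIV. \<Sum>j\<in>UNIV. Q i j * h i j)"
  unfolding H P[symmetric] sum_2 by (simp add: algebra_simps)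

section \<open>Charts\<close>

locale riemannian_surface =
  fixes S :: "'a surface"
  assumes S: "compact_riemannian_surface S"
begin

lemma smooth: "compact_smooth_surface S" and riem: "riemannian_metric S"
  using S by (auto simp: compact_riemannian_surface_def)

lemma chart_open: "c \<in> atlas S \<Longrightarrow> openin (top_of S) (fst c)"
  and chart_image_open: "c \<in> atlas S \<Longrightarrow> open_hp (chart_image c)"
  and chart_homeo: "c \<in> atlas S \<Longrightarrow>
      homeomorphic_map (subtopology (top_of S) (fst c)) (top_of_set (chart_image c)) (snd c)"
  and charts_cover: "(\<Union>c\<in>atlas S. fst c) = topspace (top_of S)"
  and compact_S: "compact_space (top_of S)"
  and Hausdorff_S: "Hausdorff_space (top_of S)"
  using smooth by (auto simp: compact_smooth_surface_def)

lemma chart_topspace: "c \<in> atlas S \<Longrightarrow> topspace (subtopology (top_of S) (fst c)) = fst c"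
  using openin_subset[OF chart_open, of c] by auto

lemma chart_inj: "c \<in> atlas S \<Longrightarrow> inj_on (snd c) (fst c)"
  using homeomorphic_imp_injective_map[OF chart_homeo] chart_topspace by metis

lemma chart_inv [simp]: "c \<in> atlas S \<Longrightarrow> x \<in> fst c \<Longrightarrow> chart_inv c (snd c x) = x"
  by (simp add: chart_inv_def chart_inj)

lemma chart_inv_in: "p \<in> chart_image c \<Longrightarrow> chart_inv c p \<in> fst c"
  by (simp add: chart_inv_def chart_image_def inv_into_into)

lemma snd_chart_inv [simp]: "p \<in> chart_image c \<Longrightarrow> snd c (chart_inv c p) = p"
  by (simp add: chart_inv_def chart_image_def f_inv_into_f)

lemma snd_in_image [simp]: "x \<in> fst c \<Longrightarrow> snd c x \<in> chart_image c"
  by (simp add: chart_image_def)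

lemma chart_image_half_plane: "c \<in> atlas S \<Longrightarrow> p \<in> chart_image c \<Longrightarrow> p $ 2 \<ge> 0"
  using open_hp_subset[OF chart_image_open] by fastforce

definition overlap :: "'a chart \<Rightarrow> 'a chart \<Rightarrow> (real^2) set" where
  "overlap c d = snd c ` (fst c \<inter> fst d)"

lemma overlap_subset: "overlap c d \<subseteq> chart_image c"
  by (auto simp: overlap_def chart_image_def)

lemma chart_image_openin:
  assumes c: "c \<in> atlas S" and U: "openin (top_of S) U" "U \<subseteq> fst c"
  shows "open_hp (snd c ` U)"
proof -
  have "openin (subtopology (top_of S) (fst c)) U"
    using U by (auto simp: openin_subtopology)
  then have "openin (top_of_set (chart_image c)) (snd c ` U)"
    using homeomorphic_imp_open_map[OF chart_homeo[OF c]] by (auto simp: open_map_def)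
  then show ?thesis
    using chart_image_open[OF c] openin_trans by blast
qed

lemma overlap_open: "c \<in> atlas S \<Longrightarrow> d \<in> atlas S \<Longrightarrow> open_hp (overlap c d)"
  unfolding overlap_def by (intro chart_image_openin openin_Int chart_open) auto

lemma transition_snd:
  "c \<in> atlas S \<Longrightarrow> x \<in> fst c \<Longrightarrow> transition c d (snd c x) = snd d x"
  by (simp add: transition_def)

lemma transition_in: "c \<in> atlas S \<Longrightarrow> p \<in> overlap c d \<Longrightarrow> transition c d p \<in> overlap d c"
  by (auto simp: overlap_def transition_snd)

lemma transition_smooth:
  "c \<in> atlas S \<Longrightarrow> d \<in> atlas S \<Longrightarrow> Ck_on k UNIV (overlap c d) (\<lambda>p. transition c d p $ m)"
  using smooth unfolding compact_smooth_surface_def overlap_def by (blast intro: smooth_on_Ck)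

lemma coord_rep_transition:
  "c \<in> atlas S \<Longrightarrow> d \<in> atlas S \<Longrightarrow> p \<in> overlap c d \<Longrightarrow>
    coord_rep c f p = coord_rep d f (transition c d p)"
  by (auto simp: overlap_def transition_snd coord_rep_def)

lemma metric_smooth: "c \<in> atlas S \<Longrightarrow> Ck_on k UNIV (chart_image c) (\<lambda>p. metric S c p $ i $ j)"
  using riem unfolding riemannian_metric_def by (blast intro: smooth_on_Ck)

lemma metric_pos: "c \<in> atlas S \<Longrightarrow> p \<in> chart_image c \<Longrightarrow> pos_def_2 (metric S c p)"
  using riem unfolding riemannian_metric_def by (auto intro!: pos_def_2I)

definition jac :: "'a chart \<Rightarrow> 'a chart \<Rightarrow> real^2 \<Rightarrow> 2 \<Rightarrow> 2 \<Rightarrow> real" where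
  "jac c d p m i = pd i (\<lambda>q. transition c d q $ m) p"

definition jac2 :: "'a chart \<Rightarrow> 'a chart \<Rightarrow> real^2 \<Rightarrow> 2 \<Rightarrow> 2 \<Rightarrow> 2 \<Rightarrow> real" where
  "jac2 c d p m i j = pd i (pd j (\<lambda>q. transition c d q $ m)) p"

lemma metric_transition:
  assumes "c \<in> atlas S" "d \<in> atlas S" "p \<in> overlap c d"
  shows "metric S c p $ i $ j = (\<Sum>m\<in>UNIV. \<Sum>n\<in>UNIV.
     jac c d p m i * metric S d (transition c d p) $ m $ n * jac c d p n j)"
proof -
  have "metric S c p = transpose (jacobian_matrix (transition c d) p) **
      metric S d (transition c d p) ** jacobian_matrix (transition c d) p"
    using riem assms unfolding riemannian_metric_def overlap_def by blast
  from arg_cong[OF this, of "\<lambda>A. A $ i $ j"] show ?thesis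
    by (simp add: matrix_matrix_mult_def transpose_def jacobian_matrix_def jac_def sum_2
        algebra_simps)
qed

context
  fixes c d :: "'a chart" and p :: "real^2"
  assumes c: "c \<in> atlas S" and d: "d \<in> atlas S" and p: "p \<in> overlap c d"
begin

lemma jac_pdv: "has_pdv i (\<lambda>q. transition c d q $ m) (jac c d p m i) p"
  unfolding jac_def by (rule Ck_on_1_pdv[OF transition_smooth[OF c d] p])

lemma jac2_pdv: "has_pdv i (\<lambda>q. jac c d q m j) (jac2 c d p m i j) p"
  unfolding jac_def jac2_def by (rule Ck_on_2_pdv2[OF transition_smooth[OF c d] p])

lemma jac2_sym: "jac2 c d p m i j = jac2 c d p m j i"
  using mixed_pd_eq[OF overlap_open[OF c d] transition_smooth[OF c d] p, of m]
    exhaust_2[of i] exhaust_2[of j] by (auto simp: jac2_def)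

lemma p_half_plane: "p \<in> half_plane"
  using p overlap_open[OF c d] open_hp_subset by blast

lemma jac_nz: "jac c d p 1 1 * jac c d p 2 2 - jac c d p 1 2 * jac c d p 2 1 \<noteq> 0"
  and inverse_metric_transition: "(\<Sum>i\<in>UNIV. \<Sum>j\<in>UNIV. jac c d p r i * matrix_inv (metric S c p) $ i
      $ j * jac c d p s j)
    = matrix_inv (metric S d (transition c d p)) $ r $ s"
proof -
  have "transition c d p \<in> chart_image d" using transition_in[OF c p] overlap_subset by blast
  note * = metric_pos[OF c subsetD[OF overlap_subset p]] metric_pos[OF d this]
  show "jac c d p 1 1 * jac c d p 2 2 - jac c d p 1 2 * jac c d p 2 1 \<noteq> 0"
    "(\<Sum>i\<in>UNIV. \<Sum>j\<in>UNIV. jac c d p r i * matrix_inv (metric S c p) $ i $ j * jac c d p s j)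
    = matrix_inv (metric S d (transition c d p)) $ r $ s"
    using inverse_metric_algebra[OF * metric_transition[OF c d p]] by auto
qed

lemma pdv_transition:
  assumes "Ck_on 1 UNIV (chart_image d) f"
  shows "has_pdv i (\<lambda>q. f (transition c d q)) (\<Sum>m\<in>UNIV. pd m f (transition c d p) * jac c d p m i)
      p"
  unfolding sum_2 jac_def
proof (rule has_pdv_compose[OF overlap_open[OF c d] chart_image_open[OF d] transition_smooth[OF c
    d] assms _ p])
  show "transition c d ` overlap c d \<subseteq> chart_image d"
    using transition_in[OF c] overlap_subset by blast
qed

lemma pd_metric_transition:
  "pd k (\<lambda>q. metric S c q $ i $ j) p = (\<Sum>m\<in>UNIV. \<Sum>n\<in>UNIV.
     jac2 c d p m k i * metric S d (transition c d p) $ m $ n * jac c d p n j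
   + jac c d p m i * (\<Sum>r\<in>UNIV. pd r (\<lambda>q. metric S d q $ m $ n) (transition c d p) * jac c d p r k)
       * jac c d p n j
   + jac c d p m i * metric S d (transition c d p) $ m $ n * jac2 c d p n k j)"
proof -
  let ?t = "transition c d"
  have "has_pdv k (\<lambda>q. \<Sum>m\<in>UNIV. \<Sum>n\<in>UNIV. jac c d q m i * metric S d (?t q) $ m $ n * jac c d q n j)
    (\<Sum>m\<in>UNIV. \<Sum>n\<in>UNIV. jac c d p m i * metric S d (?t p) $ m $ n * jac2 c d p n k j +
      (jac c d p m i * (\<Sum>r\<in>UNIV. pd r (\<lambda>q. metric S d q $ m $ n) (?t p) * jac c d p r k) +
       jac2 c d p m k i * metric S d (?t p) $ m $ n) * jac c d p n j) p"
    unfolding sum_2[of "\<lambda>m. \<Sum>n\<in>UNIV. _ m n"] sum_2[of "\<lambda>n. _ n * jac c d _ n j"]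
    unfolding sum_2
    using pdv_transition[OF metric_smooth[OF d], unfolded sum_2]
    by (intro has_pdv_add has_pdv_mult jac2_pdv)
  then have "has_pdv k (\<lambda>q. metric S c q $ i $ j)
    (\<Sum>m\<in>UNIV. \<Sum>n\<in>UNIV. jac c d p m i * metric S d (?t p) $ m $ n * jac2 c d p n k j +
      (jac c d p m i * (\<Sum>r\<in>UNIV. pd r (\<lambda>q. metric S d q $ m $ n) (?t p) * jac c d p r k) +
       jac2 c d p m k i * metric S d (?t p) $ m $ n) * jac c d p n j) p"
    by (rule has_pdv_cong[OF overlap_open[OF c d] p, THEN iffD1, rotated])
       (simp add: metric_transition[OF c d])
  from has_pdv_imp(2)[OF this p_half_plane] show ?thesis
    by (simp add: algebra_simps)
qed

lemma christoffel_transition: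
  "(\<Sum>k\<in>UNIV. jac c d p m k * christoffel (metric S c) k i j p) =
   (\<Sum>r\<in>UNIV. \<Sum>s\<in>UNIV. christoffel (metric S d) m r s (transition c d p) * jac c d p r i * jac c d
       p s j)
     + jac2 c d p m i j"
proof -
  let ?t = "transition c d"
  have tp: "?t p \<in> chart_image d" using transition_in[OF c p] overlap_subset by blast
  have Gc: "pos_def_2 (metric S c p)" by (rule metric_pos[OF c subsetD[OF overlap_subset p]])
  have Gd: "pos_def_2 (metric S d (?t p))" by (rule metric_pos[OF d tp])
  define g where "g = (\<lambda>i j. metric S d (?t p) $ i $ j)"
  define dg where "dg = (\<lambda>r i j. pd r (\<lambda>q. metric S d q $ i $ j) (?t p))"
  have symg: "g 2 1 = g 1 2" using Gd by (simp add: g_def pos_def_2_def)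
  have symdg: "dg r 2 1 = dg r 1 2" for r
    unfolding dg_def
  proof (rule pd_cong(2)[OF chart_image_open[OF d] tp])
    show "metric S d q $ 2 $ 1 = metric S d q $ 1 $ 2" if "q \<in> chart_image d" for q
      using metric_pos[OF d that] by (simp add: pos_def_2_def)
    show "has_pd r (\<lambda>q. metric S d q $ 2 $ 1) (?t p)"
      using metric_smooth[OF d, of 1 2 1] tp by (auto simp: Ck_on_1)
  qed
  have fst_d: "christoffel_fst (metric S d) l r s (?t p) = (dg r s l + dg s r l - dg l r s) / 2"
      for l r s
    by (simp add: christoffel_fst_def dg_def)
  have low: "(\<Sum>m\<in>UNIV. g r m * christoffel (metric S d) m s t (?t p)) =
      christoffel_fst (metric S d) r s t (?t p)" for r s t
    using christoffel_lower[of "metric S d", OF Gd] exhaust_2[of r] by (auto simp: sum_2 g_def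
        symg[unfolded g_def])
  show ?thesis
  proof (rule christoffel_cancel_algebra[where g = g and G = "\<lambda>i j. metric S c p $ i $ j"
      and J = "jac c d p"
        and Z = "\<lambda>k. christoffel (metric S c) k i j p" and W = "\<lambda>m. (\<Sum>r\<in>UNIV. \<Sum>s\<in>UNIV.
          christoffel (metric S d) m r s (?t p) * jac c d p r i * jac c d p s j) + jac2 c d p m i
              j"])
    show "g 2 1 = g 1 2" by fact
    show "g 1 1 * g 2 2 - g 1 2 * g 1 2 \<noteq> 0" using Gd by (simp add: g_def pos_def_2_def)
    show "jac c d p 1 1 * jac c d p 2 2 - jac c d p 1 2 * jac c d p 2 1 \<noteq> 0" by (rule jac_nz)
    show "metric S c p $ i $ j = (\<Sum>m\<in>UNIV. \<Sum>n\<in>UNIV. jac c d p m i * g m n * jac c d p n j)" for i j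
      unfolding g_def by (rule metric_transition[OF c d p])
    fix l
    have "(\<Sum>k\<in>UNIV. metric S c p $ l $ k * christoffel (metric S c) k i j p) =
        christoffel_fst (metric S c) l i j p"
      using christoffel_lower[of "metric S c", OF Gc] exhaust_2[of l] Gc
          by (auto simp: sum_2 pos_def_2_def)
    also have "\<dots> = (\<Sum>r\<in>UNIV. jac c d p r l * ((\<Sum>m\<in>UNIV. \<Sum>n\<in>UNIV.
        (dg m n r + dg n m r - dg r m n) / 2 * jac c d p m i * jac c d p n j)
       + (\<Sum>m\<in>UNIV. g r m * jac2 c d p m i j)))"
      unfolding christoffel_fst_def
      by (rule christoffel_fst_algebra[where g = g and dg = dg and dJ = "jac2 c d p"
          and J = "jac c d p"
            and dG = "\<lambda>k i j. pd k (\<lambda>q. metric S c q $ i $ j) p", OF jac2_sym symg symdg])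
         (unfold g_def dg_def, rule pd_metric_transition)
    also have "\<dots> = (\<Sum>r\<in>UNIV. jac c d p r l * (\<Sum>m\<in>UNIV. g r m *
       ((\<Sum>r\<in>UNIV. \<Sum>s\<in>UNIV. christoffel (metric S d) m r s (?t p) * jac c d p r i * jac c d p s j)
         + jac2 c d p m i j)))"
      unfolding fst_d[symmetric] low[symmetric] sum_2 by (simp add: algebra_simps)
    finally show "(\<Sum>k\<in>UNIV. metric S c p $ l $ k * christoffel (metric S c) k i j p) = \<dots>" .
  qed
qed

end

end

section \<open>Chart independence\<close>

lemma coord_laplacian_cong:
  assumes V: "open_hp V" and p: "p \<in> V" and f: "Ck_on 2 UNIV V f" and fg: "\<And>q. q \<in> V \<Longrightarrow> f q = g q"
  shows "coord_laplacian G f p = coord_laplacian G g p"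
proof -
  have 1: "pd i f q = pd i g q" if "q \<in> V" for i q
    using pd_cong(2)[OF V that fg] f that by (auto simp: Ck_on_2)
  have 2: "pd i (pd j f) p = pd i (pd j g) p" for i j
    using pd_cong(2)[OF V p 1] f p by (auto simp: Ck_on_2 Ck_on_1)
  show ?thesis unfolding coord_laplacian_def using 1[OF p] 2 by simp
qed

lemma has_pdv_1_edge_cong:
  assumes V: "open_hp V" and p: "p \<in> V" "p $ 2 = 0" and fg: "\<And>q. q \<in> V \<Longrightarrow> q $ 2 = 0 \<Longrightarrow> f q = g q"
  shows "has_pdv 1 f D p \<longleftrightarrow> has_pdv 1 g D p"
  unfolding has_pdv_def
proof (rule has_field_derivative_cong_eventually)
  show "\<forall>\<^sub>F s in at 0 within pd_dom 1 p. f (p + s *\<^sub>R axis 1 1) = g (p + s *\<^sub>R axis 1 1)"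
    using eventually_line_within[OF V p(1), of 1] by eventually_elim (simp add: fg p)
qed (use assms in auto)

context riemannian_surface
begin

context
  fixes c d :: "'a chart" and V :: "(real^2) set" and h :: "real^2 \<Rightarrow> real"
  assumes c: "c \<in> atlas S" and d: "d \<in> atlas S"
    and V: "open_hp V" "V \<subseteq> chart_image d" and h: "Ck_on 2 UNIV V h"
begin

definition transition_preimage :: "(real^2) set" where
  "transition_preimage = {q \<in> overlap c d. transition c d q \<in> V}"

lemma transition_preimage_open: "open_hp transition_preimage"
proof -
  have co: "continuous_on (overlap c d) (transition c d)"
    using Ck_on_continuous[OF transition_smooth[OF c d]]
      continuous_on_vec_lambda[of "overlap c d" "\<lambda>k q. transition c d q $ k"] by simp
  have "openin (top_of_set (overlap c d)) (overlap c d \<inter> transition c d -` V)"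
    using continuous_openin_preimage[OF co _ V(1)] transition_in[OF c] open_hp_subset[OF
        overlap_open[OF d c]]
    by blast
  moreover have "overlap c d \<inter> transition c d -` V = transition_preimage"
    by (auto simp: transition_preimage_def)
  ultimately show ?thesis using openin_trans overlap_open[OF c d] by metis
qed

lemma transition_preimage_subset: "transition_preimage \<subseteq> overlap c d"
  by (auto simp: transition_preimage_def)

lemma transition_C2: "Ck_on 2 UNIV transition_preimage (\<lambda>q. h (transition c d q))"
proof (rule Ck_on_compose[OF transition_preimage_open V(1) _ _ h])
  show "transition c d ` transition_preimage \<subseteq> V" by (auto simp: transition_preimage_def)
  show "Ck_on 2 UNIV transition_preimage (\<lambda>q. transition c d q $ k)" for k
    using Ck_on_mono[OF transition_smooth[OF c d] transition_preimage_subset] .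
qed

lemma transition_pdv:
  assumes "q \<in> transition_preimage" "Ck_on 1 UNIV V f"
  shows "has_pdv i (\<lambda>q. f (transition c d q)) (\<Sum>m\<in>UNIV. pd m f (transition c d q) * jac c d q m i)
      q"
  unfolding sum_2 jac_def
proof (rule has_pdv_compose[OF transition_preimage_open V(1) _ assms(2) _ assms(1)])
  show "transition c d ` transition_preimage \<subseteq> V" by (auto simp: transition_preimage_def)
  show "Ck_on 1 UNIV transition_preimage (\<lambda>q. transition c d q $ k)" for k
    using Ck_on_mono[OF transition_smooth[OF c d] transition_preimage_subset] .
qed

lemma transition_pd:
  assumes q: "q \<in> transition_preimage"
  shows "pd i (\<lambda>q. h (transition c d q)) q = (\<Sum>m\<in>UNIV. pd m h (transition c d q) * jac c d q m i)"
  using has_pdv_imp(2)[OF transition_pdv[OF q Ck_on_2_D1[OF h]] subsetD[OF open_hp_subset[OF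
      transition_preimage_open] q]] .

lemma transition_pd2:
  assumes p: "p \<in> transition_preimage"
  shows "pd i (pd j (\<lambda>q. h (transition c d q))) p =
    (\<Sum>m\<in>UNIV. (\<Sum>r\<in>UNIV. pd r (pd m h) (transition c d p) * jac c d p r i) * jac c d p m j
      + pd m h (transition c d p) * jac2 c d p m i j)"
proof -
  have pH: "p \<in> half_plane" using open_hp_subset[OF transition_preimage_open] p by auto
  have p': "p \<in> overlap c d" using p transition_preimage_subset by auto
  have h1: "Ck_on 1 UNIV V (pd m h)" for m using h by (simp add: Ck_on_2)
  have "has_pdv i (\<lambda>q. \<Sum>m\<in>UNIV. pd m h (transition c d q) * jac c d q m j)
     (\<Sum>m\<in>UNIV. pd m h (transition c d p) * jac2 c d p m i j +
        (\<Sum>r\<in>UNIV. pd r (pd m h) (transition c d p) * jac c d p r i) * jac c d p m j) p"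
    using transition_pdv[OF p h1] jac2_pdv[OF c d p']
    unfolding sum_2[of "\<lambda>m. pd m h _ * _ m"] sum_2[of "\<lambda>m. _ m + _ m"]
    by (intro has_pdv_add has_pdv_mult) auto
  then have "has_pdv i (pd j (\<lambda>q. h (transition c d q)))
     (\<Sum>m\<in>UNIV. pd m h (transition c d p) * jac2 c d p m i j +
        (\<Sum>r\<in>UNIV. pd r (pd m h) (transition c d p) * jac c d p r i) * jac c d p m j) p"
    by (rule has_pdv_cong[OF transition_preimage_open p, THEN iffD1, rotated]) (simp add:
        transition_pd)
  from has_pdv_imp(2)[OF this pH] show ?thesis by (simp add: add.commute)
qed

lemma coord_laplacian_transition:
  assumes p: "p \<in> transition_preimage"
  shows "coord_laplacian (metric S c) (\<lambda>q. h (transition c d q)) p =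
    coord_laplacian (metric S d) h (transition c d p)"
proof -
  have p': "p \<in> overlap c d" using p transition_preimage_subset by auto
  have H: "pd i (pd j (\<lambda>q. h (transition c d q))) p -
       (\<Sum>k\<in>UNIV. christoffel (metric S c) k i j p * pd k (\<lambda>q. h (transition c d q)) p) =
     (\<Sum>r\<in>UNIV. \<Sum>m\<in>UNIV. jac c d p r i * jac c d p m j * (pd r (pd m h) (transition c d p) -
       (\<Sum>s\<in>UNIV. christoffel (metric S d) s r m (transition c d p) * pd s h (transition c d p))))"
           for i j
  proof (rule hessian_algebra[where J = "jac c d p" and dJ = "jac2 c d p" and fd = "\<lambda>m.
      pd m h (transition c d p)"
        and Gd = "\<lambda>s r m. christoffel (metric S d) s r m (transition c d p)"
        and ffd = "\<lambda>r m. pd r (pd m h) (transition c d p)"])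
    show "(\<Sum>k\<in>UNIV. jac c d p m k * christoffel (metric S c) k i j p) =
         (\<Sum>r\<in>UNIV. \<Sum>s\<in>UNIV. christoffel (metric S d) m r s (transition c d p) * jac c d p r i *
             jac c d p s j)
          + jac2 c d p m i j" for m
      by (rule christoffel_transition[OF c d p'])
  qed (simp_all only: transition_pd[OF p] transition_pd2[OF p])
  show ?thesis
    unfolding coord_laplacian_def
    by (rule trace_algebra[where J = "jac c d p", OF inverse_metric_transition[OF c d p'] H])
qed

end

definition C2_near :: "('a \<Rightarrow> real) \<Rightarrow> 'a \<Rightarrow> bool" where
  "C2_near f x \<longleftrightarrow> (\<exists>c\<in>atlas S. x \<in> fst c \<and>
     (\<exists>V. open_hp V \<and> V \<subseteq> chart_image c \<and> snd c x \<in> V \<and> Ck_on 2 UNIV V (coord_rep c f)))"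

lemma C2_near_transfer:
  assumes c: "c \<in> atlas S" "x \<in> fst c" and d: "d \<in> atlas S" "x \<in> fst d"
    and V: "open_hp V" "V \<subseteq> chart_image d" "snd d x \<in> V" "Ck_on 2 UNIV V (coord_rep d f)"
  shows "\<exists>W. open_hp W \<and> W \<subseteq> chart_image c \<and> snd c x \<in> W \<and> Ck_on 2 UNIV W (coord_rep c f) \<and>
     coord_laplacian (metric S c) (coord_rep c f) (snd c x) =
     coord_laplacian (metric S d) (coord_rep d f) (snd d x)"
proof -
  define W where "W = transition_preimage c d V"
  note a = c(1) d(1) V(1,2,4)
  have o: "open_hp W" unfolding W_def by (rule transition_preimage_open[OF a])
  have sub: "W \<subseteq> overlap c d" unfolding W_def by (rule transition_preimage_subset[OF a])
  have x: "snd c x \<in> W"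
    using c d V(3) by (auto simp: W_def transition_preimage_def[OF a] overlap_def transition_snd)
  have eq: "coord_rep d f (transition c d q) = coord_rep c f q" if "q \<in> W" for q
    using coord_rep_transition[OF c(1) d(1)] that sub by (metis subsetD)
  have C2: "Ck_on 2 UNIV W (\<lambda>q. coord_rep d f (transition c d q))"
    unfolding W_def by (rule transition_C2[OF a])
  then have C2': "Ck_on 2 UNIV W (coord_rep c f)"
    using Ck_on_cong[where f = "\<lambda>q. coord_rep d f (transition c d q)", OF o eq] by blast
  have "coord_laplacian (metric S c) (coord_rep c f) (snd c x) =
      coord_laplacian (metric S c) (\<lambda>q. coord_rep d f (transition c d q)) (snd c x)"
    by (rule coord_laplacian_cong[OF o x C2']) (simp add: eq)
  also have "\<dots> = coord_laplacian (metric S d) (coord_rep d f) (snd d x)"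
    using coord_laplacian_transition[OF a, of "snd c x"] x c by (simp add: W_def transition_snd)
  finally show ?thesis using o x C2' sub overlap_subset by blast
qed

lemma C2_near_chart:
  assumes "C2_near f x" "c \<in> atlas S" "x \<in> fst c"
  obtains V where "open_hp V" "V \<subseteq> chart_image c" "snd c x \<in> V" "Ck_on 2 UNIV V (coord_rep c f)"
  using assms C2_near_transfer[OF assms(2,3)] unfolding C2_near_def by metis

lemma chart_at:
  assumes "x \<in> topspace (top_of S)"
  shows "chart_at S x \<in> atlas S" "x \<in> fst (chart_at S x)"
proof -
  have "x \<in> (\<Union>c\<in>atlas S. fst c)" using charts_cover assms by simp
  then have "\<exists>c. c \<in> atlas S \<and> x \<in> fst c" by blast
  from someI_ex[OF this] show "chart_at S x \<in> atlas S" "x \<in> fst (chart_at S x)"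
    by (simp_all add: chart_at_def)
qed

lemma chart_subset: "c \<in> atlas S \<Longrightarrow> x \<in> fst c \<Longrightarrow> x \<in> topspace (top_of S)"
  using charts_cover by blast

lemma laplacian_chart:
  assumes f: "C2_near f x" and c: "c \<in> atlas S" "x \<in> fst c"
  shows "laplacian S f x = coord_laplacian (metric S c) (coord_rep c f) (snd c x)"
proof -
  note d = chart_at[OF chart_subset[OF c]]
  obtain V where V: "open_hp V" "V \<subseteq> chart_image c" "snd c x \<in> V" "Ck_on 2 UNIV V (coord_rep c f)"
    using C2_near_chart[OF f c] .
  then show ?thesis
    using C2_near_transfer[OF d c V] by (auto simp: laplacian_def Let_def)
qed

section \<open>The boundary\<close>

lemma boundary_subset: "x \<in> boundary_of S \<Longrightarrow> x \<in> topspace (top_of S)"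
  using chart_subset by (auto simp: boundary_of_def)

lemma edge_transition:
  assumes c: "c \<in> atlas S" and d: "d \<in> atlas S" and p: "p \<in> overlap c d" and e: "transition c d p
      $ 2 = 0"
  shows "p $ 2 = 0"
proof (rule ccontr)
  assume "p $ 2 \<noteq> 0"
  then have p2: "p $ 2 > 0" using p_half_plane[OF c d p] by simp
  obtain T where T: "open T" "overlap c d = half_plane \<inter> T"
    using overlap_open[OF c d] by (auto simp: openin_open)
  define V where "V = {q. q $ 2 > 0} \<inter> T"
  have V: "open V" "V \<subseteq> {q. q $ 2 > 0}" "V \<subseteq> overlap c d" "p \<in> V"
    using T p p2 by (auto simp: V_def intro!: open_Int open_Collect_less continuous_intros)
  have "pd i (\<lambda>q. transition c d q $ 2) p = 0" for i
  proof (rule second_derivative_test(1)[OF V(1,2) _ V(4)])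
    show "Ck_on 2 UNIV V (\<lambda>q. transition c d q $ 2)"
      using Ck_on_mono[OF transition_smooth[OF c d] V(3)] .
    show "transition c d p $ 2 \<le> transition c d q $ 2" if "q \<in> V" for q
      using e p_half_plane[OF d c transition_in[OF c]] that V(3) by auto
  qed
  then have "jac c d p 2 1 = 0" "jac c d p 2 2 = 0" by (simp_all add: jac_def)
  then show False using jac_nz[OF c d p] by simp
qed

lemma boundary_chart:
  assumes c: "c \<in> atlas S" "x \<in> fst c"
  shows "x \<in> boundary_of S \<longleftrightarrow> snd c x $ 2 = 0"
proof
  assume "x \<in> boundary_of S"
  then obtain d where d: "d \<in> atlas S" "x \<in> fst d" "snd d x $ 2 = 0"
    by (auto simp: boundary_of_def)
  have "snd c x \<in> overlap c d" using c d by (auto simp: overlap_def)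
  from edge_transition[OF c(1) d(1) this] show "snd c x $ 2 = 0"
    using c d by (simp add: transition_snd)
qed (use c in \<open>auto simp: boundary_of_def\<close>)

lemma inner_chart:
  assumes c: "c \<in> atlas S" "x \<in> fst c"
  shows "x \<in> inner_part S \<longleftrightarrow> snd c x $ 2 > 0"
  using boundary_chart[OF c] chart_subset[OF c] chart_image_half_plane[OF c(1) snd_in_image[OF
      c(2)]]
  by (auto simp: inner_part_def)

context
  fixes c d :: "'a chart" and p :: "real^2"
  assumes c: "c \<in> atlas S" and d: "d \<in> atlas S" and p: "p \<in> overlap c d" and edge: "p $ 2 = 0"
begin

lemma transition_edge: "q \<in> overlap c d \<Longrightarrow> q $ 2 = 0 \<Longrightarrow> transition c d q $ 2 = 0"
proof -
  assume q: "q \<in> overlap c d" "q $ 2 = 0"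
  have "transition d c (transition c d q) = q"
    using q c d by (auto simp: overlap_def transition_snd)
  then show "transition c d q $ 2 = 0"
    using edge_transition[OF d c transition_in[OF c q(1)]] q by simp
qed

lemma jac_21: "q \<in> overlap c d \<Longrightarrow> q $ 2 = 0 \<Longrightarrow> jac c d q 2 1 = 0"
proof -
  assume q: "q \<in> overlap c d" "q $ 2 = 0"
  have "has_pdv 1 (\<lambda>q. transition c d q $ 2) 0 q"
    using has_pdv_1_edge_cong[OF overlap_open[OF c d] q, of "\<lambda>q. transition c d q $ 2" "\<lambda>q. 0"]
      transition_edge has_pdv_const by blast
  then show "jac c d q 2 1 = 0"
    using has_pdv_imp(2) p_half_plane[OF c d q(1)] unfolding jac_def by blast
qed

lemma jac2_211: "jac2 c d p 2 1 1 = 0"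
proof -
  have "has_pdv 1 (\<lambda>q. jac c d q 2 1) 0 p"
    using has_pdv_1_edge_cong[OF overlap_open[OF c d] p edge, of "\<lambda>q. jac c d q 2 1" "\<lambda>q. 0"]
      jac_21 has_pdv_const by blast
  then show ?thesis
    using has_pdv_eqD[OF jac2_pdv[OF c d p] _ p_half_plane[OF c d p]] by blast
qed

lemma jac_11_22: "jac c d p 1 1 \<noteq> 0" "jac c d p 2 2 > 0"
proof -
  have nz: "jac c d p 1 1 * jac c d p 2 2 \<noteq> 0"
    using jac_nz[OF c d p] jac_21[OF p edge] by simp
  then show "jac c d p 1 1 \<noteq> 0" by auto
  have "((\<lambda>s. (transition c d (p + s *\<^sub>R axis 2 1) $ 2 - transition c d p $ 2) / s) \<longlongrightarrow> jac c d p 2 2)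
      (at 0 within pd_dom 2 p)"
    using jac_pdv[OF c d p, of 2 2] by (simp add: has_pdv_def has_field_derivative_iff)
  moreover have "\<forall>\<^sub>F s in at 0 within pd_dom 2 p.
      0 \<le> (transition c d (p + s *\<^sub>R axis 2 1) $ 2 - transition c d p $ 2) / s"
  proof -
    have "\<forall>\<^sub>F s in at 0 within pd_dom 2 p. s \<in> pd_dom 2 p"
      by (simp add: eventually_at_topological) blast
    with eventually_line_within[OF overlap_open[OF c d] p, of 2]
    show ?thesis
    proof eventually_elim
      case (elim s)
      then show ?case
        using p_half_plane[OF d c transition_in[OF c elim(1)]] transition_edge[OF p edge] edge
        by (simp add: pd_dom_2)
    qed
  qed
  ultimately have "jac c d p 2 2 \<ge> 0"
    using tendsto_lowerbound at_pd_dom_not_bot[OF p_half_plane[OF c d p]] by blast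
  then show "jac c d p 2 2 > 0" using nz by (cases "jac c d p 2 2 = 0") auto
qed

lemma chart_images: "p \<in> chart_image c" "transition c d p \<in> chart_image d"
  using p transition_in[OF c p] overlap_subset by blast+

lemma edge_inverse_metric:
  "(jac c d p 2 2)\<^sup>2 * matrix_inv (metric S c p) $ 2 $ 2 = matrix_inv (metric S d (transition c d
      p)) $ 2 $ 2"
  "jac c d p 2 2 * (jac c d p 1 1 * matrix_inv (metric S c p) $ 1 $ 2 + jac c d p 1 2 * matrix_inv
      (metric S c p) $ 2 $ 2)
    = matrix_inv (metric S d (transition c d p)) $ 1 $ 2"
  using inverse_metric_transition[OF c d p, of 2 2] inverse_metric_transition[OF c d p,
      of 1 2] jac_21[OF p edge]
  by (simp_all add: sum_2 power2_eq_square algebra_simps)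

lemma edge_sqrt_inverse_metric:
  "sqrt (matrix_inv (metric S d (transition c d p)) $ 2 $ 2) =
     jac c d p 2 2 * sqrt (matrix_inv (metric S c p) $ 2 $ 2)"
  using jac_11_22 by (simp add: edge_inverse_metric(1)[symmetric] real_sqrt_mult)

lemma edge_metric_11:
  assumes "q \<in> overlap c d" "q $ 2 = 0"
  shows "metric S c q $ 1 $ 1 = (jac c d q 1 1)\<^sup>2 * metric S d (transition c d q) $ 1 $ 1"
  using metric_transition[OF c d assms(1), of 1 1] jac_21[OF assms]
  by (simp add: sum_2 power2_eq_square)

lemma coord_geodesic_curvature_transition:
  "coord_geodesic_curvature (metric S c) p = coord_geodesic_curvature (metric S d) (transition c d
      p)"
proof -
  note Gc = metric_pos[OF c chart_images(1)] and Gd = metric_pos[OF d chart_images(2)]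
  define J1 where "J1 = jac c d p 1 1"
  define J2 where "J2 = jac c d p 2 2"
  have J: "J1 \<noteq> 0" "J2 > 0" using jac_11_22 by (simp_all add: J1_def J2_def)
  define r where "r = sqrt (matrix_inv (metric S c p) $ 2 $ 2)"
  define g where "g = metric S d (transition c d p) $ 1 $ 1"
  have rg: "r > 0" "g > 0"
    using matrix_inv_pos[OF Gc] Gd by (auto simp: r_def g_def pos_def_2_def)
  have "J2 * christoffel (metric S c) 2 1 1 p = J1\<^sup>2 * christoffel (metric S d) 2 1 1 (transition
      c d p)"
    using christoffel_transition[OF c d p, of 2 1 1] jac_21[OF p edge] jac2_211
    by (simp add: sum_2 J1_def J2_def power2_eq_square)
  then have "christoffel (metric S c) 2 1 1 p = J1\<^sup>2 * christoffel (metric S d) 2 1 1 (transition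
      c d p) / J2"
    using J by (simp add: field_simps)
  then show ?thesis
    unfolding coord_geodesic_curvature_eq[of "metric S c", OF Gc] coord_geodesic_curvature_eq[of
        "metric S d", OF Gd]
      edge_sqrt_inverse_metric edge_metric_11[OF p edge] J1_def[symmetric] J2_def[symmetric]
      r_def[symmetric] g_def[symmetric]
    using J rg by (simp add: field_simps)
qed

context
  fixes f :: "'a \<Rightarrow> real"
  assumes f: "\<And>c. c \<in> atlas S \<Longrightarrow> Ck_on 2 UNIV (chart_image c) (coord_rep c f)"
begin

lemma edge_pd:
  assumes "q \<in> overlap c d"
  shows "pd i (coord_rep c f) q = (\<Sum>m\<in>UNIV. pd m (coord_rep d f) (transition c d q) * jac c d q m
      i)"
proof -
  have "has_pdv i (\<lambda>q. coord_rep d f (transition c d q))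
      (\<Sum>m\<in>UNIV. pd m (coord_rep d f) (transition c d q) * jac c d q m i) q"
    by (rule pdv_transition[OF c d assms Ck_on_2_D1[OF f[OF d]]])
  then have "has_pdv i (coord_rep c f)
      (\<Sum>m\<in>UNIV. pd m (coord_rep d f) (transition c d q) * jac c d q m i) q"
    by (rule has_pdv_cong[OF overlap_open[OF c d] assms, THEN iffD1, rotated])
       (simp add: coord_rep_transition[OF c d])
  from has_pdv_imp(2)[OF this p_half_plane[OF c d assms]] show ?thesis .
qed

lemma normal_derivative_transition:
  "(\<Sum>i\<in>UNIV. coord_normal (metric S c) p $ i * pd i (coord_rep c f) p) =
   (\<Sum>i\<in>UNIV. coord_normal (metric S d) (transition c d p) $ i * pd i (coord_rep d f) (transition c
       d p))"
proof -
  define J1 where "J1 = jac c d p 1 1"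
  define J2 where "J2 = jac c d p 2 2"
  define J12 where "J12 = jac c d p 1 2"
  have J: "J1 \<noteq> 0" "J2 > 0" using jac_11_22 by (simp_all add: J1_def J2_def)
  define a where "a = matrix_inv (metric S c p) $ 1 $ 2"
  define b where "b = matrix_inv (metric S c p) $ 2 $ 2"
  define r where "r = sqrt b"
  have r: "r > 0" using matrix_inv_pos[OF metric_pos[OF c chart_images(1)]]
      by (auto simp: r_def b_def)
  define f1 where "f1 = pd 1 (coord_rep d f) (transition c d p)"
  define f2 where "f2 = pd 2 (coord_rep d f) (transition c d p)"
  have "pd 1 (coord_rep c f) p = f1 * J1" "pd 2 (coord_rep c f) p = f1 * J12 + f2 * J2"
    using edge_pd[OF p] jac_21[OF p edge] by (simp_all add: sum_2 f1_def f2_def J1_def J2_def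
        J12_def)
  moreover have "matrix_inv (metric S d (transition c d p)) $ 1 $ 2 = J2 * (J1 * a + J12 * b)"
     "matrix_inv (metric S d (transition c d p)) $ 2 $ 2 = J2\<^sup>2 * b"
    using edge_inverse_metric by (simp_all add: J1_def J2_def J12_def a_def b_def)
  ultimately show ?thesis
    unfolding sum_2 coord_normal_eq edge_sqrt_inverse_metric J2_def[symmetric]
      f1_def[symmetric] f2_def[symmetric] a_def[symmetric] b_def[symmetric]
    unfolding r_def[symmetric] using J r by (simp add: field_simps power2_eq_square)
qed

lemma edge_norms_transition:
  "\<bar>pd 1 (coord_rep c f) p\<bar> / sqrt (metric S c p $ 1 $ 1) =
     \<bar>pd 1 (coord_rep d f) (transition c d p)\<bar> / sqrt (metric S d (transition c d p) $ 1 $ 1)"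
  "\<bar>pd 1 (pd 1 (coord_rep c f)) p - pd 1 (\<lambda>q. metric S c q $ 1 $ 1) p / (2 * metric S c p $ 1 $ 1) *
       pd 1 (coord_rep c f) p\<bar> / metric S c p $ 1 $ 1 =
   \<bar>pd 1 (pd 1 (coord_rep d f)) (transition c d p) - pd 1 (\<lambda>q. metric S d q $ 1 $ 1) (transition c
       d p) /
       (2 * metric S d (transition c d p) $ 1 $ 1) * pd 1 (coord_rep d f) (transition c d p)\<bar> /
       metric S d (transition c d p) $ 1 $ 1"
proof -
  let ?t = "transition c d"
  define J where "J = jac c d p 1 1"
  define K where "K = jac2 c d p 1 1 1"
  define g where "g = metric S d (?t p) $ 1 $ 1"
  define f1 where "f1 = pd 1 (coord_rep d f) (?t p)"
  define f11 where "f11 = pd 1 (pd 1 (coord_rep d f)) (?t p)"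
  define g1 where "g1 = pd 1 (\<lambda>q. metric S d q $ 1 $ 1) (?t p)"
  have J: "J \<noteq> 0" using jac_11_22 by (simp add: J_def)
  have g: "g > 0" using metric_pos[OF d chart_images(2)] by (simp add: pos_def_2_def g_def)
  have Gc: "metric S c p $ 1 $ 1 = J\<^sup>2 * g"
    using edge_metric_11[OF p edge] by (simp add: J_def g_def)
  have 1: "pd 1 (coord_rep c f) p = f1 * J"
    using edge_pd[OF p, of 1] jac_21[OF p edge] by (simp add: sum_2 f1_def J_def)
  have "has_pdv 1 (pd 1 (coord_rep c f)) (f1 * K + (f11 * J) * J) p"
  proof -
    have f1': "Ck_on 1 UNIV (chart_image d) (pd 1 (coord_rep d f))"
      using f[OF d] by (simp add: Ck_on_2)
    have "has_pdv 1 (\<lambda>q. pd 1 (coord_rep d f) (?t q)) (f11 * J) p"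
      using pdv_transition[OF c d p f1', of 1] jac_21[OF p edge] by (simp add: sum_2 f11_def J_def)
    then have "has_pdv 1 (\<lambda>q. pd 1 (coord_rep d f) (?t q) * jac c d q 1 1) (f1 * K + (f11 * J) *
        J) p"
      using has_pdv_mult[OF _ jac2_pdv[OF c d p]] by (simp add: f1_def K_def J_def)
    then show ?thesis
      by (rule has_pdv_1_edge_cong[OF overlap_open[OF c d] p edge, THEN iffD1, rotated])
         (simp add: edge_pd sum_2 jac_21)
  qed
  then have 2: "pd 1 (pd 1 (coord_rep c f)) p = f1 * K + (f11 * J) * J"
    using has_pdv_imp(2) p_half_plane[OF c d p] by blast
  have "has_pdv 1 (\<lambda>q. metric S c q $ 1 $ 1) (2 * J * K * g + J\<^sup>2 * (g1 * J)) p"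
  proof -
    have "has_pdv 1 (\<lambda>q. metric S d (?t q) $ 1 $ 1) (g1 * J) p"
      using pdv_transition[OF c d p metric_smooth[OF d], of 1 1 1] jac_21[OF p edge]
      by (simp add: sum_2 g1_def J_def)
    from has_pdv_mult[OF has_pdv_mult[OF jac2_pdv[OF c d p, of 1 1 1] jac2_pdv[OF c d p,
        of 1 1 1]] this]
    have "has_pdv 1 (\<lambda>q. jac c d q 1 1 * jac c d q 1 1 * metric S d (?t q) $ 1 $ 1)
        (2 * J * K * g + J\<^sup>2 * (g1 * J)) p"
      by (simp add: J_def K_def g_def power2_eq_square algebra_simps)
    then show ?thesis
      by (rule has_pdv_1_edge_cong[OF overlap_open[OF c d] p edge, THEN iffD1, rotated])
         (simp add: edge_metric_11 power2_eq_square)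
  qed
  then have 3: "pd 1 (\<lambda>q. metric S c q $ 1 $ 1) p = 2 * J * K * g + J\<^sup>2 * (g1 * J)"
    using has_pdv_imp(2) p_half_plane[OF c d p] by blast
  show "\<bar>pd 1 (coord_rep c f) p\<bar> / sqrt (metric S c p $ 1 $ 1) =
     \<bar>pd 1 (coord_rep d f) (?t p)\<bar> / sqrt (metric S d (?t p) $ 1 $ 1)"
    unfolding 1 Gc f1_def[symmetric] g_def[symmetric] using J g
    by (simp add: real_sqrt_mult abs_mult)
  have "f1 * K + f11 * J * J - (2 * J * K * g + J\<^sup>2 * (g1 * J)) / (2 * (J\<^sup>2 * g)) * (f1 * J)
      = J\<^sup>2 * (f11 - g1 / (2 * g) * f1)"
    using J g by (simp add: field_simps power2_eq_square)
  then show "\<bar>pd 1 (pd 1 (coord_rep c f)) p - pd 1 (\<lambda>q. metric S c q $ 1 $ 1) p / (2 * metric S c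
      p $ 1 $ 1) *
       pd 1 (coord_rep c f) p\<bar> / metric S c p $ 1 $ 1 =
   \<bar>pd 1 (pd 1 (coord_rep d f)) (?t p) - pd 1 (\<lambda>q. metric S d q $ 1 $ 1) (?t p) /
       (2 * metric S d (?t p) $ 1 $ 1) * pd 1 (coord_rep d f) (?t p)\<bar> /
       metric S d (?t p) $ 1 $ 1"
    unfolding 1 2 3 Gc f1_def[symmetric] f11_def[symmetric] g_def[symmetric] g1_def[symmetric]
    using J g by (simp add: abs_mult)
qed

end

end

lemma chart_transition:
  assumes "c \<in> atlas S" "d \<in> atlas S" "x \<in> fst c" "x \<in> fst d"
  shows "snd c x \<in> overlap c d" "transition c d (snd c x) = snd d x"
  using assms by (auto simp: overlap_def transition_snd)

lemma geodesic_curvature_chart: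
  assumes x: "x \<in> boundary_of S" and c: "c \<in> atlas S" "x \<in> fst c"
  shows "geodesic_curvature S x = coord_geodesic_curvature (metric S c) (snd c x)"
proof -
  note d = chart_at[OF boundary_subset[OF x]]
  show ?thesis
    using coord_geodesic_curvature_transition[OF c(1) d(1) chart_transition(1)[OF c(1) d(1) c(2)
        d(2)]]
      chart_transition(2)[OF c(1) d(1) c(2) d(2)] boundary_chart[OF c] x
    by (simp add: geodesic_curvature_def Let_def)
qed

lemma normal_derivative_chart:
  assumes x: "x \<in> boundary_of S" and c: "c \<in> atlas S" "x \<in> fst c"
    and f: "\<And>c. c \<in> atlas S \<Longrightarrow> Ck_on 2 UNIV (chart_image c) (coord_rep c f)"
  shows "normal_derivative S f x =
    (\<Sum>i\<in>UNIV. coord_normal (metric S c) (snd c x) $ i * pd i (coord_rep c f) (snd c x))"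
proof -
  note d = chart_at[OF boundary_subset[OF x]]
  show ?thesis
    using normal_derivative_transition[OF c(1) d(1) chart_transition(1)[OF c(1) d(1) c(2) d(2)] _ f]
      chart_transition(2)[OF c(1) d(1) c(2) d(2)] boundary_chart[OF c] x
    by (simp add: normal_derivative_def Let_def)
qed

lemma boundary_pd:
  assumes c: "c \<in> atlas S" and p: "p \<in> chart_image c" "p $ 2 = 0"
    and f: "Ck_on 2 UNIV (chart_image c) (coord_rep c f)" and eq: "\<And>y. y \<in> boundary_of S \<Longrightarrow> f y =
        \<phi> y"
  shows "pd 1 (coord_rep c \<phi>) p = pd 1 (coord_rep c f) p"
    "pd 1 (pd 1 (coord_rep c \<phi>)) p = pd 1 (pd 1 (coord_rep c f)) p"
proof -
  have e: "coord_rep c f q = coord_rep c \<phi> q" if "q \<in> chart_image c" "q $ 2 = 0" for q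
    using eq boundary_chart[OF c chart_inv_in[OF that(1)]] that by (simp add: coord_rep_def)
  have H: "q \<in> half_plane" if "q \<in> chart_image c" for q
    using open_hp_subset[OF chart_image_open[OF c]] that by auto
  have 1: "pd 1 (coord_rep c f) q = pd 1 (coord_rep c \<phi>) q" if q: "q \<in> chart_image c" "q $ 2 = 0"
      for q
  proof -
    have "has_pdv 1 (coord_rep c \<phi>) (pd 1 (coord_rep c f) q) q"
      using has_pdv_1_edge_cong[where f = "coord_rep c f", OF chart_image_open[OF c] q e]
          Ck_on_2_pdv[OF f q(1)] by blast
    from has_pdv_imp(2)[OF this H[OF q(1)]] show ?thesis by simp
  qed
  have "has_pdv 1 (pd 1 (coord_rep c \<phi>)) (pd 1 (pd 1 (coord_rep c f)) p) p"
    using has_pdv_1_edge_cong[where f = "pd 1 (coord_rep c f)", OF chart_image_open[OF c] p 1]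
        Ck_on_2_pdv2[OF f p(1)] by blast
  from has_pdv_imp(2)[OF this H[OF p(1)]]
  show "pd 1 (pd 1 (coord_rep c \<phi>)) p = pd 1 (pd 1 (coord_rep c f)) p" .
  show "pd 1 (coord_rep c \<phi>) p = pd 1 (coord_rep c f) p" using 1[OF p] by simp
qed

lemma boundary_norms_chart:
  assumes x: "x \<in> boundary_of S" and c: "c \<in> atlas S" "x \<in> fst c"
    and f: "\<And>c. c \<in> atlas S \<Longrightarrow> Ck_on 2 UNIV (chart_image c) (coord_rep c f)"
    and eq: "\<And>y. y \<in> boundary_of S \<Longrightarrow> f y = \<phi> y"
  shows "bd_grad_norm S \<phi> x = \<bar>pd 1 (coord_rep c f) (snd c x)\<bar> / sqrt (metric S c (snd c x) $ 1 $
      1)"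
    "bd_hess_norm S \<phi> x = \<bar>pd 1 (pd 1 (coord_rep c f)) (snd c x) -
        pd 1 (\<lambda>q. metric S c q $ 1 $ 1) (snd c x) / (2 * metric S c (snd c x) $ 1 $ 1) *
       pd 1 (coord_rep c f) (snd c x)\<bar> / metric S c (snd c x) $ 1 $ 1"
proof -
  note d = chart_at[OF boundary_subset[OF x]]
  have e: "snd (chart_at S x) x $ 2 = 0" "snd c x $ 2 = 0"
    using boundary_chart[OF c] boundary_chart[OF d] x by auto
  note t = edge_norms_transition[OF c(1) d(1) chart_transition(1)[OF c(1) d(1) c(2) d(2)] e(2) f]
  note bp = boundary_pd[OF d(1) snd_in_image[OF d(2)] e(1) f[OF d(1)] eq]
  show "bd_grad_norm S \<phi> x = \<bar>pd 1 (coord_rep c f) (snd c x)\<bar> / sqrt (metric S c (snd c x) $ 1 $ 1)"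
    using t(1) chart_transition(2)[OF c(1) d(1) c(2) d(2)] bp by (simp add: bd_grad_norm_def
        Let_def)
  show "bd_hess_norm S \<phi> x = \<bar>pd 1 (pd 1 (coord_rep c f)) (snd c x) -
        pd 1 (\<lambda>q. metric S c q $ 1 $ 1) (snd c x) / (2 * metric S c (snd c x) $ 1 $ 1) *
       pd 1 (coord_rep c f) (snd c x)\<bar> / metric S c (snd c x) $ 1 $ 1"
    using t(2) chart_transition(2)[OF c(1) d(1) c(2) d(2)] bp by (simp add: bd_hess_norm_def
        Let_def)
qed

lemma geodesic_curvature_conformal:
  assumes x: "x \<in> boundary_of S"
    and f: "\<And>c. c \<in> atlas S \<Longrightarrow> Ck_on 2 UNIV (chart_image c) (coord_rep c f)"
  shows "geodesic_curvature (conformal f S) x =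
    exp (- f x) * (normal_derivative S f x + geodesic_curvature S x)"
proof -
  note d = chart_at[OF boundary_subset[OF x]]
  have "chart_at (conformal f S) x = chart_at S x"
    by (simp add: chart_at_def conformal_def)
  then have "geodesic_curvature (conformal f S) x =
      coord_geodesic_curvature (\<lambda>p. exp (2 * coord_rep (chart_at S x) f p) *\<^sub>R metric S (chart_at
          S x) p)
        (snd (chart_at S x) x)"
    by (simp add: geodesic_curvature_def Let_def conformal_def)
  also have "\<dots> = exp (- coord_rep (chart_at S x) f (snd (chart_at S x) x)) *
      (normal_derivative S f x + geodesic_curvature S x)"
    using coord_geodesic_curvature_conformal[OF chart_image_open[OF d(1)] snd_in_image[OF d(2)]
        metric_smooth[OF d(1)] metric_pos[OF d(1) snd_in_image[OF d(2)]] Ck_on_2_D1[OF f[OF d(1)]]]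
    by (simp add: normal_derivative_def geodesic_curvature_def Let_def)
  finally show ?thesis using d by (simp add: coord_rep_def)
qed

end

section \<open>First touching\<close>

lemma first_touch:
  fixes D :: "'b \<Rightarrow> real \<Rightarrow> real"
  assumes min: "\<And>t. t \<in> {a..b} \<Longrightarrow> \<exists>x\<in>G. \<forall>y\<in>G. D x t \<le> D y t"
    and Lip: "\<And>x s t. x \<in> G \<Longrightarrow> s \<in> {a..b} \<Longrightarrow> t \<in> {a..b} \<Longrightarrow> \<bar>D x s - D x t\<bar> \<le> C * \<bar>s - t\<bar>"
    and init: "\<And>x. x \<in> G \<Longrightarrow> D x a > 0"
    and neg: "x0 \<in> G" "t0 \<in> {a..b}" "D x0 t0 \<le> 0"
  obtains x t where "x \<in> G" "a < t" "t \<le> b" "D x t = 0"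
    "\<And>y s. y \<in> G \<Longrightarrow> a \<le> s \<Longrightarrow> s \<le> t \<Longrightarrow> D y s \<ge> 0"
proof -
  from min obtain z where z: "\<And>t. t \<in> {a..b} \<Longrightarrow> z t \<in> G"
    "\<And>t y. t \<in> {a..b} \<Longrightarrow> y \<in> G \<Longrightarrow> D (z t) t \<le> D y t" by metis
  define m where "m = (\<lambda>t. D (z t) t)"
  have C: "0 \<le> C * \<bar>s - t\<bar>" if "s \<in> {a..b}" "t \<in> {a..b}" for s t
    using Lip[OF neg(1) that] by linarith
  have half: "m s - m t \<le> C * \<bar>s - t\<bar>" if "s \<in> {a..b}" "t \<in> {a..b}" for s t
    using z(2)[OF that(1) z(1)[OF that(2)]] Lip[OF z(1)[OF that(2)] that] unfolding m_def
        by linarith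
  have mL: "\<bar>m s - m t\<bar> \<le> C * \<bar>s - t\<bar>" if "s \<in> {a..b}" "t \<in> {a..b}" for s t
    using half[OF that] half[OF that(2,1)] by (simp add: abs_minus_commute abs_le_iff)
  have cont: "continuous_on {a..b} m"
    unfolding continuous_on_iff
  proof (intro ballI allI impI)
    fix t and e :: real assume t: "t \<in> {a..b}" and e: "e > 0"
    have "dist (m s) (m t) < e" if "s \<in> {a..b}" "dist s t < e / (\<bar>C\<bar> + 1)" for s
    proof -
      have "\<bar>m s - m t\<bar> \<le> (\<bar>C\<bar> + 1) * \<bar>s - t\<bar>"
        using mL[OF that(1) t] mult_right_mono[of C "\<bar>C\<bar> + 1" "\<bar>s - t\<bar>"] by linarith
      also have "\<dots> < e" using that(2) by (simp add: dist_real_def field_simps)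
      finally show ?thesis by (simp add: dist_real_def)
    qed
    then show "\<exists>d>0. \<forall>s\<in>{a..b}. dist s t < d \<longrightarrow> dist (m s) (m t) < e"
      using e by (intro exI[of _ "e / (\<bar>C\<bar> + 1)"]) auto
  qed
  define Z where "Z = {t \<in> {a..b}. m t \<le> 0}"
  have "closedin (top_of_set {a..b}) ({a..b} \<inter> m -` {..0})"
    by (rule continuous_closedin_preimage[OF cont]) simp
  moreover have "{a..b} \<inter> m -` {..0} = Z" by (auto simp: Z_def)
  ultimately have cZ: "compact Z"
    using closedin_compact[OF compact_Icc[of a b]] by simp
  have "t0 \<in> Z" using neg z(2)[OF neg(2,1)] by (auto simp: Z_def m_def)
  then obtain t where t: "t \<in> Z" "\<And>s. s \<in> Z \<Longrightarrow> t \<le> s"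
    using compact_attains_inf[OF cZ] by blast
  have tab: "t \<in> {a..b}" "m t \<le> 0" using t by (auto simp: Z_def)
  have ma: "m a > 0" unfolding m_def using init z(1)[of a] tab by auto
  then have ta: "a < t" using tab by (cases "t = a") auto
  have before: "m s > 0" if "a \<le> s" "s < t" for s
    using t(2)[of s] that tab by (force simp: Z_def)
  have mt: "m t = 0"
  proof (rule ccontr)
    assume "m t \<noteq> 0"
    then have "m t < 0" using tab by simp
    then obtain s where s: "a \<le> s" "s \<le> t" "m s = 0"
      using IVT2'[of m t 0 a] ma ta tab continuous_on_subset[OF cont, of "{a..t}"] by auto
    then show False using before[of s] \<open>m t < 0\<close> by (cases "s = t") auto
  qed
  have "D y s \<ge> 0" if "y \<in> G" "a \<le> s" "s \<le> t" for y s
  proof -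
    have "m s \<ge> 0" using before[of s] mt that by (cases "s = t") auto
    then show ?thesis using z(2)[of s y] that tab unfolding m_def by auto
  qed
  then show ?thesis using that[of "z t" t] z(1)[OF tab(1)] ta tab mt by (auto simp: m_def)
qed

lemma deriv_le_0_of_left:
  fixes f :: "real \<Rightarrow> real"
  assumes "(f has_real_derivative l) (at t)" "a < t" "\<And>s. a \<le> s \<Longrightarrow> s \<le> t \<Longrightarrow> f t \<le> f s"
  shows "l \<le> 0"
proof (rule ccontr)
  assume "\<not> l \<le> 0"
  then obtain d where d: "d > 0" "\<And>h. 0 < h \<Longrightarrow> h < d \<Longrightarrow> f (t - h) < f t"
    using DERIV_pos_inc_left[OF assms(1)] by auto
  define h where "h = min d (t - a) / 2"
  have "0 < h" "h < d" "a \<le> t - h" using d(1) assms(2) by (auto simp: h_def min_def field_simps)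
  then show False using d(2)[of h] assms(3)[of "t - h"] by auto
qed

lemma exp_Lipschitz:
  fixes c :: real
  assumes "s \<in> {a..b}" "t \<in> {a..b}" "\<bar>c\<bar> \<le> K"
  shows "\<bar>exp (c * (s - b)) - exp (c * (t - b))\<bar> \<le> K * exp (K * (b - a)) * \<bar>s - t\<bar>"
proof -
  have "norm (exp (c * (s - b)) - exp (c * (t - b))) \<le> K * exp (K * (b - a)) * norm (s - t)"
  proof (rule field_differentiable_bound[where S = "{a..b}" and f' = "\<lambda>r. c * exp (c * (r - b))"])
    show "((\<lambda>r. exp (c * (r - b))) has_field_derivative c * exp (c * (r - b))) (at r within
        {a..b})" for r
      by (auto intro!: derivative_eq_intros)
    show "norm (c * exp (c * (r - b))) \<le> K * exp (K * (b - a))" if "r \<in> {a..b}" for r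
    proof -
      have "c * (r - b) \<le> \<bar>c\<bar> * \<bar>r - b\<bar>" by (metis abs_ge_self abs_mult)
      also have "\<dots> \<le> K * (b - a)" using that assms(3) by (intro mult_mono) auto
      finally have "exp (c * (r - b)) \<le> exp (K * (b - a))" by simp
      then show ?thesis using assms(3) unfolding real_norm_def abs_mult abs_exp_cancel
        by (intro mult_mono) auto
    qed
  qed (use assms in auto)
  then show ?thesis by simp
qed

lemma edge_taylor:
  fixes g g' g'' :: "real \<Rightarrow> real"
  assumes g: "\<And>s. \<bar>s\<bar> \<le> h \<Longrightarrow> (g has_real_derivative g' s) (at s)"
    and g': "\<And>s. \<bar>s\<bar> \<le> h \<Longrightarrow> (g' has_real_derivative g'' s) (at s)"
    and C: "\<And>s. \<bar>s\<bar> \<le> h \<Longrightarrow> \<bar>g'' s\<bar> \<le> C" and s: "\<bar>s\<bar> \<le> h"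
  shows "\<bar>g s - g 0 - g' 0 * s\<bar> \<le> C * s\<^sup>2"
proof -
  let ?I = "{-\<bar>s\<bar>..\<bar>s\<bar>}"
  have 1: "\<bar>g' r - g' 0\<bar> \<le> C * \<bar>s\<bar>" if "r \<in> ?I" for r
  proof -
    have C0: "0 \<le> C" using C[OF s] by linarith
    have "norm (g' r - g' 0) \<le> C * norm (r - 0)"
      by (rule field_differentiable_bound[where S = "?I" and f' = g''])
         (use that s C in \<open>auto intro!: DERIV_subset[OF g']\<close>)
    also have "\<dots> \<le> C * \<bar>s\<bar>" using that C0 by (intro mult_left_mono) auto
    finally show ?thesis by simp
  qed
  have "norm ((g s - g' 0 * s) - (g 0 - g' 0 * 0)) \<le> (C * \<bar>s\<bar>) * norm (s - 0)"
  proof (rule field_differentiable_bound[where S = "?I" and f' = "\<lambda>r. g' r - g' 0"])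
    show "((\<lambda>s. g s - g' 0 * s) has_field_derivative g' r - g' 0) (at r within ?I)" if "r \<in> ?I"
        for r
      using that s by (auto intro!: derivative_eq_intros DERIV_subset[OF g])
  qed (use 1 in auto)
  then show ?thesis by (simp add: power2_eq_square algebra_simps)
qed

section \<open>Quadratic barriers\<close>

definition quad :: "real \<Rightarrow> real \<Rightarrow> real \<Rightarrow> real \<Rightarrow> real \<Rightarrow> real \<Rightarrow> real \<Rightarrow> real^2 \<Rightarrow> real" where
  "quad c0 c1 c2 c11 c12 c22 q p = c0 + c1 * (p $ 1 - q) + c2 * p $ 2 +
     c11 * ((p $ 1 - q) * (p $ 1 - q)) + 2 * c12 * ((p $ 1 - q) * p $ 2) + c22 * (p $ 2 * p $ 2)"

lemma quad_pdv:
  "has_pdv 1 (quad c0 c1 c2 c11 c12 c22 q) (quad c1 (2 * c11) (2 * c12) 0 0 0 q p) p"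
  "has_pdv 2 (quad c0 c1 c2 c11 c12 c22 q) (quad c2 (2 * c12) (2 * c22) 0 0 0 q p) p"
  unfolding has_pdv_def quad_def by (auto intro!: derivative_eq_intros simp: algebra_simps)

lemma quad_pd:
  assumes "p \<in> half_plane"
  shows "pd 1 (quad c0 c1 c2 c11 c12 c22 q) p = quad c1 (2 * c11) (2 * c12) 0 0 0 q p"
    "pd 2 (quad c0 c1 c2 c11 c12 c22 q) p = quad c2 (2 * c12) (2 * c22) 0 0 0 q p"
  using has_pdv_imp(2)[OF _ assms] quad_pdv by blast+

lemma quad_0 [simp]: "quad c0 0 0 0 0 0 q p = c0"
  by (simp add: quad_def)

lemma quad_pd2:
  assumes "p \<in> half_plane"
  shows "pd 1 (pd 1 (quad c0 c1 c2 c11 c12 c22 q)) p = 2 * c11"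
    "pd 2 (pd 1 (quad c0 c1 c2 c11 c12 c22 q)) p = 2 * c12"
    "pd 1 (pd 2 (quad c0 c1 c2 c11 c12 c22 q)) p = 2 * c12"
    "pd 2 (pd 2 (quad c0 c1 c2 c11 c12 c22 q)) p = 2 * c22"
proof -
  have H: "open_hp half_plane" by simp
  have "has_pdv i (pd j (quad c0 c1 c2 c11 c12 c22 q)) D p"
    if "has_pdv i f D p" "\<And>r. r \<in> half_plane \<Longrightarrow> pd j (quad c0 c1 c2 c11 c12 c22 q) r = f r"
        for i j f D
    using that(1) has_pdv_cong[where f = "pd j (quad c0 c1 c2 c11 c12 c22 q)"
        and g = f, OF H assms that(2)] by blast
  note * = has_pdv_imp(2)[OF this[OF _ quad_pd(1)] assms] has_pdv_imp(2)[OF this[OF _ quad_pd(2)]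
      assms]
  show "pd 1 (pd 1 (quad c0 c1 c2 c11 c12 c22 q)) p = 2 * c11"
    "pd 2 (pd 1 (quad c0 c1 c2 c11 c12 c22 q)) p = 2 * c12"
    "pd 1 (pd 2 (quad c0 c1 c2 c11 c12 c22 q)) p = 2 * c12"
    "pd 2 (pd 2 (quad c0 c1 c2 c11 c12 c22 q)) p = 2 * c22"
    using *[OF quad_pdv(1)] *[OF quad_pdv(2)] by simp_all
qed

lemma quad_Ck: "open_hp W \<Longrightarrow> Ck_on k UNIV W (quad c0 c1 c2 c11 c12 c22 q)"
  unfolding quad_def
  by (intro Ck_on_add Ck_on_mult Ck_on_const Ck_on_diff Ck_on_coord)

lemma quad_continuous: "continuous_on W (quad c0 c1 c2 c11 c12 c22 q)"
  unfolding quad_def by (intro continuous_intros)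

lemma frozen_quad_identity:
  fixes a11 a12 a22 :: real
  assumes D: "a11 * a22 - a12\<^sup>2 \<noteq> 0"
    and g: "g11 = a22 / (a11 * a22 - a12\<^sup>2)" "g12 = - a12 / (a11 * a22 - a12\<^sup>2)" "g22 =
        a11 / (a11 * a22 - a12\<^sup>2)"
    and w: "w = c0 + c1 * s + c2 * y + \<beta> * (g11 * (s * s) + 2 * g12 * (s * y) + g22 * (y * y))"
      "w1 = c1 + 2 * \<beta> * (g11 * s + g12 * y)" "w2 = c2 + 2 * \<beta> * (g12 * s + g22 * y)"
  shows "w * (2 * \<beta> * (a11 * g11 + 2 * a12 * g12 + a22 * g22)) - (a11 * w1\<^sup>2 + 2 * a12 * w1 * w2 +
      a22 * w2\<^sup>2) + 1
    = 1 - (c2\<^sup>2 * a22 + 2 * c2 * c1 * a12 + c1\<^sup>2 * a11) + 4 * \<beta> * c0"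
proof -
  define z1 where "z1 = g11 * s + g12 * y"
  define z2 where "z2 = g12 * s + g22 * y"
  define d where "d = a11 * a22 - a12\<^sup>2"
  have d0: "d \<noteq> 0" using D by (simp add: d_def)
  have g': "g11 = a22 / d" "g12 = - a12 / d" "g22 = a11 / d" using g by (simp_all add: d_def)
  have i1: "a11 * g11 + a12 * g12 = 1" "a12 * g12 + a22 * g22 = 1"
    unfolding g' using d0 by (simp_all add: field_simps) (simp_all add: d_def power2_eq_square)
  have i2: "a12 * g11 + a22 * g12 = 0" "a11 * g12 + a12 * g22 = 0"
    unfolding g' using d0 by (simp_all add: field_simps)
  have tr: "a11 * g11 + 2 * a12 * g12 + a22 * g22 = 2" using i1 by simp
  have "a11 * z1 + a12 * z2 = (a11 * g11 + a12 * g12) * s + (a11 * g12 + a12 * g22) * y"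
    by (simp add: z1_def z2_def algebra_simps)
  then have e1: "a11 * z1 + a12 * z2 = s" using i1 i2 by simp
  have "a12 * z1 + a22 * z2 = (a12 * g11 + a22 * g12) * s + (a12 * g12 + a22 * g22) * y"
    by (simp add: z1_def z2_def algebra_simps)
  then have e2: "a12 * z1 + a22 * z2 = y" using i1 i2 by simp
  have w': "w = c0 + c1 * s + c2 * y + \<beta> * (z1 * s + z2 * y)"
    unfolding w z1_def z2_def by (simp add: algebra_simps)
  have w12: "w1 = c1 + 2 * \<beta> * z1" "w2 = c2 + 2 * \<beta> * z2"
    unfolding w z1_def z2_def by simp_all
  have "a11 * w1\<^sup>2 + 2 * a12 * w1 * w2 + a22 * w2\<^sup>2 = (c2\<^sup>2 * a22 + 2 * c2 * c1 * a12 + c1\<^sup>2 * a11)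
     + 4 * \<beta> * (c1 * (a11 * z1 + a12 * z2) + c2 * (a12 * z1 + a22 * z2))
     + 4 * \<beta>\<^sup>2 * (z1 * (a11 * z1 + a12 * z2) + z2 * (a12 * z1 + a22 * z2))"
    unfolding w12 by (simp add: algebra_simps power2_eq_square)
  then show ?thesis unfolding tr e1 e2 w' by (simp add: algebra_simps power2_eq_square)
qed

lemma inverse_form_lower_bound:
  fixes a11 a12 a22 :: real
  assumes "d = a11 * a22 - a12\<^sup>2" "d > 0" "a11 > 0" "a22 > 0" "a11 + a22 \<le> 2 * B"
  shows "a22 / d * (s * s) + 2 * (- a12 / d) * (s * y) + a11 / d * (y * y) \<ge> (s * s + y * y) / (2
      * B)"
proof -
  have "(a22 * s - a12 * y)\<^sup>2 + (a12 * s - a11 * y)\<^sup>2 \<ge> 0" by simp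
  then have "d * (s * s + y * y) \<le> (a11 + a22) * (a22 * (s * s) - 2 * a12 * (s * y) +
      a11 * (y * y))"
    unfolding assms(1) by (simp add: algebra_simps power2_eq_square)
  moreover have "X / e \<le> Y / d" if "d * X \<le> e * Y" "e > 0" for X Y e :: real
    using that assms(2) by (simp add: field_simps)
  ultimately have "(s * s + y * y) / (a11 + a22) \<le> (a22 * (s * s) - 2 * a12 * (s * y) +
      a11 * (y * y)) / d"
    using assms(3,4) by simp
  moreover have "(s * s + y * y) / (2 * B) \<le> (s * s + y * y) / (a11 + a22)"
    using assms by (intro divide_left_mono) auto
  ultimately show ?thesis by (simp add: add_divide_distrib diff_divide_distrib)
qed

lemma variation_bound:
  fixes \<rho> :: real
  assumes "\<bar>d11\<bar> \<le> \<omega>" "\<bar>d12\<bar> \<le> \<omega>" "\<bar>d22\<bar> \<le> \<omega>" and "\<bar>g11\<bar> \<le> B1" "\<bar>g12\<bar> \<le> B1" "\<bar>g22\<bar> \<le> B1"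
    and w: "\<bar>w\<bar> \<le> W * \<rho>" "\<bar>w1\<bar> \<le> W" "\<bar>w2\<bar> \<le> W" and \<beta>: "\<bar>\<beta>\<bar> * \<rho> \<le> N" and \<rho>: "0 < \<rho>" "\<rho> \<le> 1"
    and b: "\<bar>b1\<bar> \<le> B" "\<bar>b2\<bar> \<le> B" "\<bar>k\<bar> \<le> B"
  shows "\<bar>2 * \<beta> * w * (d11 * g11 + 2 * d12 * g12 + d22 * g22) - w * (b1 * w1 + b2 * w2)
     - (d11 * w1\<^sup>2 + 2 * d12 * w1 * w2 + d22 * w2\<^sup>2) + k * w\<^sup>2\<bar> \<le> (8 * N * W * B1 + 4 * W\<^sup>2) * \<omega> +
         3 * B * W\<^sup>2 * \<rho>"
proof -
  have nn: "\<omega> \<ge> 0" "B1 \<ge> 0" "W \<ge> 0" "N \<ge> 0" "B \<ge> 0"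
    using order_trans[OF abs_ge_zero assms(1)] order_trans[OF abs_ge_zero assms(4)]
      order_trans[OF abs_ge_zero w(2)] order_trans[OF abs_ge_zero b(1)]
      order_trans[OF mult_nonneg_nonneg[OF abs_ge_zero] \<beta>] \<rho>(1) by simp_all
  have pr: "\<bar>x * y\<bar> \<le> X * Y" if "\<bar>x\<bar> \<le> X" "\<bar>y\<bar> \<le> Y" for x y X Y :: real
    unfolding abs_mult by (rule mult_mono[OF that order_trans[OF abs_ge_zero that(1)] abs_ge_zero])
  have t1: "\<bar>d11 * g11 + 2 * (d12 * g12) + d22 * g22\<bar> \<le> 4 * (\<omega> * B1)"
    using pr[OF assms(1,4)] pr[OF assms(2,5)] pr[OF assms(3,6)] by linarith
  have "\<bar>\<beta> * w\<bar> \<le> \<bar>\<beta>\<bar> * (W * \<rho>)" using w(1) by (simp add: abs_mult mult_left_mono)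
  also have "\<dots> = W * (\<bar>\<beta>\<bar> * \<rho>)" by simp
  also have "\<dots> \<le> W * N" using \<beta> nn by (intro mult_left_mono) auto
  finally have t2: "\<bar>\<beta> * w\<bar> \<le> W * N" .
  note t3 = pr[OF t2 t1]
  have t4: "\<bar>b1 * w1 + b2 * w2\<bar> \<le> 2 * (B * W)"
    using pr[OF b(1) w(2)] pr[OF b(2) w(3)] by linarith
  note t5 = pr[OF w(1) t4]
  have t6: "\<bar>d11 * (w1 * w1) + 2 * (d12 * (w1 * w2)) + d22 * (w2 * w2)\<bar> \<le> 4 * (\<omega> * (W * W))"
    using pr[OF assms(1) pr[OF w(2,2)]] pr[OF assms(2) pr[OF w(2,3)]] pr[OF assms(3) pr[OF
        w(3,3)]] by linarith
  have "\<bar>w * w\<bar> \<le> (W * \<rho>) * (W * \<rho>)" by (rule pr[OF w(1,1)])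
  also have "\<dots> = (W * W * \<rho>) * \<rho>" by simp
  also have "\<dots> \<le> (W * W * \<rho>) * 1" using \<rho> nn by (intro mult_left_mono) auto
  finally have t7: "\<bar>w * w\<bar> \<le> W * W * \<rho>" by simp
  note t8 = pr[OF b(3) t7]
  have "\<bar>2 * (\<beta> * w * (d11 * g11 + 2 * (d12 * g12) + d22 * g22)) - w * (b1 * w1 + b2 * w2)
     - (d11 * (w1 * w1) + 2 * (d12 * (w1 * w2)) + d22 * (w2 * w2)) + k * (w * w)\<bar>
     \<le> 2 * (W * N * (4 * (\<omega> * B1))) + W * \<rho> * (2 * (B * W)) + 4 * (\<omega> * (W * W)) + B * (W * W * \<rho>)"
    using t3 t5 t6 t8 by linarith
  then show ?thesis by (simp add: algebra_simps power2_eq_square)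
qed

section \<open>The equation in a boundary chart\<close>

text \<open>\<open>V\<close> is \<open>e\<^bsup>-u\<^esup>\<close> in a chart, \<open>A\<close> is the inverse metric, and \<open>b\<close> consists of the
  contracted Christoffel symbols. Below, \<open>\<sigma> = 1\<close> stands for barriers below \<open>V\<close> and \<open>\<sigma> = -1\<close> for
  barriers above \<open>V\<close>.\<close>

locale boundary_flow =
  fixes p0 :: "real^2" and R :: real and \<Omega> :: "(real^2) set"
    and A11 A12 A22 b1 b2 \<kappa> :: "real^2 \<Rightarrow> real" and V Vt :: "real^2 \<Rightarrow> real \<Rightarrow> real"
    and B0 m0 M T0 C :: real
  assumes R: "R > 0" and p0: "p0 $ 2 = 0"
    and \<Omega>: "open_hp \<Omega>" "cball p0 R \<inter> half_plane \<subseteq> \<Omega>"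
    and A_cont: "continuous_on (cball p0 R \<inter> half_plane) A11"
      "continuous_on (cball p0 R \<inter> half_plane) A12" "continuous_on (cball p0 R \<inter> half_plane) A22"
    and bounds: "\<And>p. p \<in> cball p0 R \<inter> half_plane \<Longrightarrow> \<bar>A11 p\<bar> \<le> B0 \<and> \<bar>A12 p\<bar> \<le> B0 \<and> \<bar>A22 p\<bar> \<le> B0 \<and>
      \<bar>b1 p\<bar> \<le> B0 \<and> \<bar>b2 p\<bar> \<le> B0 \<and> \<bar>\<kappa> p\<bar> \<le> B0"
    and m0: "m0 > 0" "\<And>p. p \<in> cball p0 R \<inter> half_plane \<Longrightarrow>
      A11 p > 0 \<and> A22 p \<ge> m0 \<and> A11 p * A22 p - (A12 p)\<^sup>2 \<ge> m0"
    and V_C2: "\<And>t. t > 0 \<Longrightarrow> Ck_on 2 UNIV \<Omega> (\<lambda>p. V p t)"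
    and V_pos: "\<And>p t. V p t > 0"
    and V_time: "\<And>p t. p \<in> cball p0 R \<inter> half_plane \<Longrightarrow> t > 0 \<Longrightarrow> (V p has_real_derivative Vt p t) (at
        t)"
    and V_Lip: "\<And>T. T > 0 \<Longrightarrow> \<exists>L. \<forall>p\<in>cball p0 R \<inter> half_plane. \<forall>s\<in>{0..T}. \<forall>t\<in>{0..T}. \<bar>V p s - V p t\<bar>
        \<le> L * \<bar>s - t\<bar>"
    and pde: "\<And>p t. p \<in> cball p0 R \<inter> half_plane \<Longrightarrow> p $ 2 > 0 \<Longrightarrow> t > 0 \<Longrightarrow>
      Vt p t = V p t * (V p t * (A11 p * pd 1 (pd 1 (\<lambda>q. V q t)) p
          + A12 p * (pd 1 (pd 2 (\<lambda>q. V q t)) p + pd 2 (pd 1 (\<lambda>q. V q t)) p)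
          + A22 p * pd 2 (pd 2 (\<lambda>q. V q t)) p - b1 p * pd 1 (\<lambda>q. V q t) p - b2 p * pd 2 (\<lambda>q.
              V q t) p)
        - (A11 p * (pd 1 (\<lambda>q. V q t) p)\<^sup>2 + 2 * A12 p * pd 1 (\<lambda>q. V q t) p * pd 2 (\<lambda>q. V q t) p
          + A22 p * (pd 2 (\<lambda>q. V q t) p)\<^sup>2) + 1 + \<kappa> p * (V p t)\<^sup>2)"
    and T0: "T0 > 0" and V_le: "\<And>p t. p \<in> cball p0 R \<inter> half_plane \<Longrightarrow> t \<ge> T0 \<Longrightarrow> V p t \<le> M"
    and edge_lim: "\<And>e. e > 0 \<Longrightarrow> \<exists>T. \<forall>t\<ge>T. \<forall>p\<in>cball p0 R. p $ 2 = 0 \<longrightarrow> V p t \<le> e"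
    and edge_mono: "\<And>p s t. p \<in> cball p0 R \<Longrightarrow> p $ 2 = 0 \<Longrightarrow> T0 \<le> s \<Longrightarrow> s \<le> t \<Longrightarrow> V p t \<le> V p s"
    and edge_slow: "\<And>e. e > 0 \<Longrightarrow> \<exists>T. \<forall>p\<in>cball p0 R. p $ 2 = 0 \<longrightarrow>
       (\<forall>s t. T \<le> s \<longrightarrow> s \<le> t \<longrightarrow> V p s \<le> exp (e * (t - s)) * V p t)"
    and C: "C > 0" and edge_C: "\<And>p t. p \<in> cball p0 R \<Longrightarrow> p $ 2 = 0 \<Longrightarrow> t \<ge> T0 \<Longrightarrow>
      (pd 1 (\<lambda>q. V q t) p)\<^sup>2 \<le> C * V p t \<and> \<bar>pd 1 (pd 1 (\<lambda>q. V q t)) p\<bar> \<le> C"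
begin

definition K :: "(real^2) set" where "K = cball p0 R \<inter> half_plane"

definition Lop :: "(real^2 \<Rightarrow> real) \<Rightarrow> real^2 \<Rightarrow> real" where
  "Lop f p = A11 p * pd 1 (pd 1 f) p + A12 p * (pd 1 (pd 2 f) p + pd 2 (pd 1 f) p)
          + A22 p * pd 2 (pd 2 f) p - b1 p * pd 1 f p - b2 p * pd 2 f p"

definition grad2 :: "(real^2 \<Rightarrow> real) \<Rightarrow> real^2 \<Rightarrow> real" where
  "grad2 f p = A11 p * (pd 1 f p)\<^sup>2 + 2 * A12 p * pd 1 f p * pd 2 f p + A22 p * (pd 2 f p)\<^sup>2"

definition Fop :: "(real^2 \<Rightarrow> real) \<Rightarrow> real^2 \<Rightarrow> real" where
  "Fop w p = w p * Lop w p - grad2 w p + 1 + \<kappa> p * (w p)\<^sup>2"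

lemma pde': "p \<in> K \<Longrightarrow> p $ 2 > 0 \<Longrightarrow> t > 0 \<Longrightarrow> Vt p t = V p t * Fop (\<lambda>q. V q t) p"
  using pde[of p t] by (simp add: K_def Fop_def Lop_def grad2_def algebra_simps)

lemma compact_K: "compact K"
  unfolding K_def by (rule compact_half_ball)

lemma V_cont: "t > 0 \<Longrightarrow> continuous_on K (\<lambda>p. V p t)"
  using Ck_on_continuous[OF V_C2] \<Omega>(2) by (auto simp: K_def intro: continuous_on_subset)

lemma touching_contradiction:
  assumes \<sigma>: "\<sigma> = 1 \<or> \<sigma> = (-1::real)" and \<epsilon>: "0 < \<epsilon>" "2 * \<epsilon> \<le> 1" and \<theta>: "\<sigma> * (1 - \<theta>) \<ge> 0" "\<theta> > 0"
    and U: "open U" "U \<subseteq> K" "U \<subseteq> {q. q $ 2 > 0}" "p \<in> U" and t: "t > 0"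
    and w: "Ck_on 2 UNIV U w" "\<sigma> * Fop w p \<ge> 2 * \<epsilon>"
    and touch: "V p t = \<theta> * w p" "\<And>q. q \<in> U \<Longrightarrow> \<sigma> * (V q t - \<theta> * w q) \<ge> 0"
    and time: "\<sigma> * Vt p t \<le> \<epsilon> * V p t"
  shows False
proof -
  have U': "open_hp U" using U by (intro open_imp_open_hp) auto
  have UO: "U \<subseteq> \<Omega>" using U(2) \<Omega>(2) by (auto simp: K_def)
  have pK: "p \<in> K" "p $ 2 > 0" using U by auto
  let ?V = "\<lambda>q. V q t"
  let ?D = "\<lambda>q. \<sigma> * ?V q + (- \<sigma> * \<theta>) * w q"
  have V2: "Ck_on 2 UNIV U ?V" using Ck_on_mono[OF V_C2[OF t] UO] .
  have D2: "Ck_on 2 UNIV U ?D" by (intro Ck_on_add Ck_on_cmult U' V2 w(1))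
  have H: "q \<in> half_plane" if "q \<in> U" for q using open_hp_subset[OF U'] that by auto
  have d1: "pd i ?D q = \<sigma> * pd i ?V q + (- \<sigma> * \<theta>) * pd i w q" if "q \<in> U" for i q
    by (rule has_pdv_imp(2)[OF _ H[OF that]])
       (intro has_pdv_add has_pdv_cmult Ck_on_2_pdv[OF V2 that] Ck_on_2_pdv[OF w(1) that])
  have d2: "pd i (pd j ?D) p = \<sigma> * pd i (pd j ?V) p + (- \<sigma> * \<theta>) * pd i (pd j w) p" for i j
  proof -
    have "has_pdv i (\<lambda>q. \<sigma> * pd j ?V q + (- \<sigma> * \<theta>) * pd j w q)
        (\<sigma> * pd i (pd j ?V) p + (- \<sigma> * \<theta>) * pd i (pd j w) p) p"
      by (intro has_pdv_add has_pdv_cmult Ck_on_2_pdv2[OF V2 U(4)] Ck_on_2_pdv2[OF w(1) U(4)])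
    then have "has_pdv i (pd j ?D) (\<sigma> * pd i (pd j ?V) p + (- \<sigma> * \<theta>) * pd i (pd j w) p) p"
      by (rule has_pdv_cong[OF U' U(4), THEN iffD1, rotated]) (simp only: d1)
    from has_pdv_imp(2)[OF this H[OF U(4)]] show ?thesis .
  qed
  have m: "?D p \<le> ?D q" if "q \<in> U" for q
  proof -
    have "?D p = 0" using touch(1) by simp
    moreover have "?D q \<ge> 0" using touch(2)[OF that] by (simp add: algebra_simps)
    ultimately show ?thesis by (simp only:)
  qed
  have A: "A11 p > 0" "(A12 p)\<^sup>2 \<le> A11 p * A22 p" using m0(2)[of p] m0(1) pK by (auto simp: K_def)
  have "\<sigma> \<noteq> 0" using \<sigma> by auto
  then have g: "pd i ?V p = \<theta> * pd i w p" for i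
    using second_derivative_test(1)[OF U(1,3) D2 U(4) m, of i] d1[OF U(4), of i]
    by (auto simp: algebra_simps)
  have "0 \<le> \<sigma> * (A11 p * pd 1 (pd 1 ?V) p + A12 p * (pd 1 (pd 2 ?V) p + pd 2 (pd 1 ?V) p) +
      A22 p * pd 2 (pd 2 ?V) p)
    - \<sigma> * \<theta> * (A11 p * pd 1 (pd 1 w) p + A12 p * (pd 1 (pd 2 w) p + pd 2 (pd 1 w) p) +
        A22 p * pd 2 (pd 2 w) p)"
    using elliptic_at_min[OF U(1,3) D2 U(4) m A] unfolding d2 by (simp add: algebra_simps)
  then have L: "\<sigma> * \<theta> * Lop w p \<le> \<sigma> * Lop ?V p"
    unfolding Lop_def g by (simp add: algebra_simps)
  have G: "grad2 ?V p = \<theta>\<^sup>2 * grad2 w p"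
    unfolding grad2_def g by (simp add: algebra_simps power2_eq_square)
  have Vp: "V p t > 0" by (rule V_pos)
  have wp: "w p > 0" using Vp touch(1) \<theta>(2) by (simp add: zero_less_mult_iff)
  have "\<sigma> * Fop ?V p = V p t * (\<sigma> * Lop ?V p) - \<sigma> * \<theta>\<^sup>2 * grad2 w p + \<sigma> + \<sigma> * \<kappa> p * \<theta>\<^sup>2 * (w p)\<^sup>2"
    unfolding Fop_def G touch(1) by (simp add: algebra_simps power_mult_distrib)
  also have "\<dots> \<ge> V p t * (\<sigma> * \<theta> * Lop w p) - \<sigma> * \<theta>\<^sup>2 * grad2 w p + \<sigma> + \<sigma> * \<kappa> p * \<theta>\<^sup>2 * (w p)\<^sup>2"
    using mult_left_mono[OF L, of "V p t"] Vp by simp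
  also have "V p t * (\<sigma> * \<theta> * Lop w p) - \<sigma> * \<theta>\<^sup>2 * grad2 w p + \<sigma> + \<sigma> * \<kappa> p * \<theta>\<^sup>2 * (w p)\<^sup>2
     = \<sigma> * (1 - \<theta>\<^sup>2) + \<theta>\<^sup>2 * (\<sigma> * Fop w p)"
    unfolding touch(1) Fop_def by (simp add: algebra_simps power2_eq_square)
  finally have F1: "\<sigma> * (1 - \<theta>\<^sup>2) + \<theta>\<^sup>2 * (\<sigma> * Fop w p) \<le> \<sigma> * Fop ?V p" .
  have F2: "\<theta>\<^sup>2 * (2 * \<epsilon>) \<le> \<theta>\<^sup>2 * (\<sigma> * Fop w p)" using w(2) by (intro mult_left_mono) auto
  have F3: "2 * \<epsilon> \<le> \<sigma> * (1 - \<theta>\<^sup>2) + \<theta>\<^sup>2 * (2 * \<epsilon>)"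
    using \<sigma>
  proof
    assume s: "\<sigma> = 1"
    then have "\<theta>\<^sup>2 \<le> 1" using \<theta> by (simp add: power_le_one)
    then have "(1 - \<theta>\<^sup>2) * (2 * \<epsilon>) \<le> (1 - \<theta>\<^sup>2) * 1" using \<epsilon> by (intro mult_left_mono) auto
    then show ?thesis using s by (simp add: algebra_simps)
  next
    assume s: "\<sigma> = -1"
    then have "1 \<le> \<theta>\<^sup>2" using \<theta> by (simp add: one_le_power)
    then have "1 * (2 * \<epsilon>) \<le> \<theta>\<^sup>2 * (2 * \<epsilon>)" using \<epsilon> by (intro mult_right_mono) auto
    then show ?thesis using s \<open>1 \<le> \<theta>\<^sup>2\<close> by (simp add: algebra_simps)
  qed
  have "2 * \<epsilon> \<le> \<sigma> * Fop ?V p" using F1 F2 F3 by linarith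
  then have "V p t * (2 * \<epsilon>) \<le> V p t * (\<sigma> * Fop ?V p)" using Vp by (intro mult_left_mono) auto
  also have "\<dots> = \<sigma> * Vt p t" using pde'[OF pK t] by simp
  also have "\<dots> \<le> \<epsilon> * V p t" by (rule time)
  finally show False using Vp \<epsilon>(1) by (simp add: algebra_simps)
qed

lemma comparison:
  assumes \<sigma>: "\<sigma> = 1 \<or> \<sigma> = (-1::real)" and \<epsilon>: "0 < \<epsilon>" "2 * \<epsilon> \<le> 1"
    and q: "cball q \<rho> \<inter> half_plane \<subseteq> K" and T: "0 < T" "T \<le> t0"
    and w: "\<And>W. open_hp W \<Longrightarrow> Ck_on 2 UNIV W w" "continuous_on UNIV w"
    and F: "\<And>p. p \<in> cball q \<rho> \<Longrightarrow> p $ 2 > 0 \<Longrightarrow> w p > 0 \<Longrightarrow> \<sigma> * Fop w p \<ge> 2 * \<epsilon>"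
    and pos: "\<And>p. \<sigma> = -1 \<Longrightarrow> p \<in> cball q \<rho> \<Longrightarrow> p $ 2 \<ge> 0 \<Longrightarrow> w p > 0"
    and bd: "\<And>p t. p \<in> cball q \<rho> \<Longrightarrow> p $ 2 \<ge> 0 \<Longrightarrow> T \<le> t \<Longrightarrow> t \<le> t0 \<Longrightarrow> t = T \<or> p $ 2 = 0 \<or> dist p q = \<rho> \<Longrightarrow>
       \<sigma> * (V p t - exp (\<sigma> * \<epsilon> * (t - t0)) * w p) \<ge> 0"
    and p: "p \<in> cball q \<rho>" "p $ 2 \<ge> 0"
  shows "\<sigma> * (V p t0 - w p) \<ge> 0"
proof -
  define G where "G = cball q \<rho> \<inter> half_plane"
  have GK: "G \<subseteq> K" using q by (simp add: G_def)
  have G: "compact G" unfolding G_def by (rule compact_half_ball)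
  have pG: "p \<in> G" using p by (simp add: G_def)
  have step: "\<sigma> * (V p t0 - (1 - \<sigma> * \<delta>) * w p) > 0" if \<delta>: "0 < \<delta>" "\<delta> < 1" for \<delta>
  proof (rule ccontr)
    assume neg: "\<not> \<sigma> * (V p t0 - (1 - \<sigma> * \<delta>) * w p) > 0"
    define \<theta> where "\<theta> = (\<lambda>t. (1 - \<sigma> * \<delta>) * exp (\<sigma> * \<epsilon> * (t - t0)))"
    define D where "D = (\<lambda>p t. \<sigma> * (V p t - \<theta> t * w p))"
    have \<theta>_pos: "\<theta> t > 0" for t using \<sigma> \<delta> by (auto simp: \<theta>_def)
    have \<theta>_1: "\<sigma> * (1 - \<theta> t) \<ge> 0" if "t \<le> t0" for t
      using \<sigma>
    proof
      assume s: "\<sigma> = 1"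
      have "(1 - \<delta>) * exp (\<epsilon> * (t - t0)) \<le> 1 * 1"
        using \<delta> \<epsilon> that by (intro mult_mono) (auto simp: mult_nonneg_nonpos)
      then show ?thesis using s by (simp add: \<theta>_def)
    next
      assume s: "\<sigma> = -1"
      have "1 * 1 \<le> (1 + \<delta>) * exp (- (\<epsilon> * (t - t0)))"
        using \<delta> \<epsilon> that by (intro mult_mono) (auto simp: mult_nonneg_nonpos)
      then show ?thesis using s by (simp add: \<theta>_def)
    qed
    have strict: "D p t > 0" if "p \<in> G" "T \<le> t" "t \<le> t0" "t = T \<or> p $ 2 = 0 \<or> dist p q = \<rho>" for p t
    proof -
      define E where "E = exp (\<sigma> * \<epsilon> * (t - t0))"
      have E: "E > 0" by (simp add: E_def)
      have b: "\<sigma> * (V p t - E * w p) \<ge> 0" using bd[of p t] that by (simp add: G_def E_def)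
      have Vp: "V p t > 0" by (rule V_pos)
      show ?thesis using \<sigma>
      proof
        assume s: "\<sigma> = 1"
        have "(1 - \<delta>) * (E * w p) < V p t"
        proof (cases "w p > 0")
          case True
          then have "(1 - \<delta>) * (E * w p) < 1 * (E * w p)" using E \<delta>
              by (intro mult_strict_right_mono) auto
          then show ?thesis using b s by simp
        next
          case False
          then have "E * w p \<le> 0" using E by (simp add: mult_nonneg_nonpos)
          then have "(1 - \<delta>) * (E * w p) \<le> 0" using \<delta> by (simp add: mult_nonneg_nonpos)
          then show ?thesis using Vp by simp
        qed
        then show ?thesis using s by (simp add: D_def \<theta>_def E_def mult.assoc)
      next
        assume s: "\<sigma> = -1"
        then have "E * w p > 0" using pos[of p] that E by (simp add: G_def)
        then have "1 * (E * w p) < (1 + \<delta>) * (E * w p)" using \<delta> by (intro mult_strict_right_mono)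
            auto
        then have "V p t < (1 + \<delta>) * (E * w p)" using b s by simp
        then show ?thesis using s by (simp add: D_def \<theta>_def E_def mult.assoc)
      qed
    qed
    obtain L where L: "\<And>p s t. p \<in> K \<Longrightarrow> s \<in> {0..t0} \<Longrightarrow> t \<in> {0..t0} \<Longrightarrow> \<bar>V p s - V p t\<bar> \<le> L * \<bar>s - t\<bar>"
      using V_Lip[of t0] T unfolding K_def by force
    obtain B where B: "\<And>p. p \<in> G \<Longrightarrow> \<bar>w p\<bar> \<le> B"
    proof -
      have "bounded (w ` G)"
        by (intro compact_imp_bounded compact_continuous_image continuous_on_subset[OF w(2)] G) auto
      then show ?thesis using that by (auto simp: bounded_iff)
    qed
    have min: "\<exists>x\<in>G. \<forall>y\<in>G. D x t \<le> D y t" if "t \<in> {T..t0}" for t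
    proof (rule continuous_attains_inf[OF G])
      show "G \<noteq> {}" using pG by auto
      have "continuous_on G (\<lambda>p. V p t)"
        using V_cont[of t] T that GK by (auto intro: continuous_on_subset)
      then show "continuous_on G (\<lambda>x. D x t)"
        unfolding D_def by (intro continuous_intros continuous_on_subset[OF w(2)]) auto
    qed
    define Lt where "Lt = \<epsilon> * exp (\<epsilon> * (t0 - T))"
    have Lip: "\<bar>D x s - D x t\<bar> \<le> (L + 2 * Lt * B) * \<bar>s - t\<bar>"
      if x: "x \<in> G" and s: "s \<in> {T..t0}" and t: "t \<in> {T..t0}" for x s t
    proof -
      have a: "\<bar>exp (\<sigma> * \<epsilon> * (s - t0)) - exp (\<sigma> * \<epsilon> * (t - t0))\<bar> \<le> Lt * \<bar>s - t\<bar>"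
        unfolding Lt_def using s t \<sigma> \<epsilon> by (intro exp_Lipschitz) (auto simp: abs_mult)
      have "\<bar>\<theta> s - \<theta> t\<bar> = \<bar>1 - \<sigma> * \<delta>\<bar> * \<bar>exp (\<sigma> * \<epsilon> * (s - t0)) - exp (\<sigma> * \<epsilon> * (t - t0))\<bar>"
        unfolding \<theta>_def by (simp add: abs_mult flip: right_diff_distrib)
      also have "\<dots> \<le> 2 * (Lt * \<bar>s - t\<bar>)"
        using a \<sigma> \<delta> by (intro mult_mono) auto
      finally have th: "\<bar>\<theta> s - \<theta> t\<bar> \<le> 2 * (Lt * \<bar>s - t\<bar>)" .
      have "\<bar>(\<theta> s - \<theta> t) * w x\<bar> \<le> 2 * (Lt * \<bar>s - t\<bar>) * B"
        unfolding abs_mult using th B[OF x] by (intro mult_mono) auto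
      moreover have "\<bar>V x s - V x t\<bar> \<le> L * \<bar>s - t\<bar>" using L[of x s t] x GK s t T by auto
      moreover have "\<bar>D x s - D x t\<bar> = \<bar>(V x s - V x t) - (\<theta> s - \<theta> t) * w x\<bar>"
        using \<sigma> by (auto simp: D_def algebra_simps abs_minus_commute)
      ultimately have "\<bar>D x s - D x t\<bar> \<le> L * \<bar>s - t\<bar> + 2 * (Lt * \<bar>s - t\<bar>) * B" by linarith
      then show ?thesis by (simp add: algebra_simps)
    qed
    have D0: "D p t0 \<le> 0" using neg by (simp add: D_def \<theta>_def)
    obtain x t where xt: "x \<in> G" "T < t" "t \<le> t0" "D x t = 0"
      "\<And>y s. y \<in> G \<Longrightarrow> T \<le> s \<Longrightarrow> s \<le> t \<Longrightarrow> D y s \<ge> 0"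
      using first_touch[of T t0 G D, OF min Lip strict pG _ D0] T by auto
    have t: "t > 0" using xt T by simp
    have nb: "x $ 2 > 0" "dist x q < \<rho>"
      using strict[of x t] xt by (auto simp: G_def less_le dist_commute)
    define U where "U = ball q \<rho> \<inter> {p. p $ 2 > 0}"
    have U: "open U" "U \<subseteq> {p. p $ 2 > 0}" "x \<in> U" "U \<subseteq> G"
      using nb by (auto simp: U_def G_def dist_commute intro!: open_Int open_Collect_less
          continuous_intros)
    have s0: "\<sigma> \<noteq> 0" "\<sigma> * \<sigma> = 1" using \<sigma> by auto
    have tch: "V x t = \<theta> t * w x" using xt(4) s0 by (simp add: D_def)
    have wx: "w x > 0" using tch V_pos[of x t] \<theta>_pos[of t] by (simp add: zero_less_mult_iff)
    have "(\<theta> has_real_derivative \<sigma> * \<epsilon> * \<theta> t) (at t)"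
      unfolding \<theta>_def by (auto intro!: derivative_eq_intros)
    moreover have "(V x has_real_derivative Vt x t) (at t)"
      using V_time[of x t] subsetD[OF GK xt(1)] t unfolding K_def by simp
    ultimately have "(D x has_real_derivative \<sigma> * (Vt x t - \<sigma> * \<epsilon> * \<theta> t * w x)) (at t)"
      unfolding D_def by (auto intro!: derivative_eq_intros)
    then have le: "\<sigma> * (Vt x t - \<sigma> * \<epsilon> * \<theta> t * w x) \<le> 0"
      by (rule deriv_le_0_of_left[OF _ xt(2)]) (use xt in auto)
    then have time: "\<sigma> * Vt x t \<le> \<epsilon> * V x t"
    proof -
      have "\<sigma> * (Vt x t - \<sigma> * \<epsilon> * \<theta> t * w x) = \<sigma> * Vt x t - (\<sigma> * \<sigma>) * (\<epsilon> * (\<theta> t * w x))"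
        by (simp only: right_diff_distrib mult.assoc)
      with le show ?thesis unfolding s0(2) tch by simp
    qed
    show False
    proof (rule touching_contradiction[OF \<sigma> \<epsilon> \<theta>_1 \<theta>_pos U(1) _ U(2,3) t w(1) _ tch _ time])
      show "U \<subseteq> K" using U GK by auto
      show "open_hp U" using U by (intro open_imp_open_hp) (auto simp: G_def)
      show "2 * \<epsilon> \<le> \<sigma> * Fop w x" using F[of x] nb wx by (auto simp: dist_commute)
      show "0 \<le> \<sigma> * (V y t - \<theta> t * w y)" if "y \<in> U" for y
        using xt(5)[of y t] that U xt(2) by (auto simp: D_def)
    qed (use xt in auto)
  qed
  have "((\<lambda>\<delta>. \<sigma> * (V p t0 - (1 - \<sigma> * \<delta>) * w p)) \<longlongrightarrow> \<sigma> * (V p t0 - (1 - \<sigma> * 0) * w p)) (at_right 0)"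
    by (intro tendsto_intros)
  moreover have "\<forall>\<^sub>F \<delta> in at_right 0. 0 \<le> \<sigma> * (V p t0 - (1 - \<sigma> * \<delta>) * w p)"
    using eventually_at_right_real[of 0 1] by (auto elim!: eventually_mono intro: less_imp_le[OF
        step])
  ultimately show ?thesis
    using tendsto_lowerbound[of _ _ "at_right (0::real)"] by fastforce
qed

lemma B0_nonneg: "B0 \<ge> 0"
  using bounds[of p0] R p0 by force

lemma in_K: "p \<in> half_plane \<Longrightarrow> dist p p0 \<le> R \<Longrightarrow> p \<in> K"
  by (simp add: K_def dist_commute)

lemma edge_point:
  fixes q1 :: real
  obtains q :: "real^2" where "q $ 1 = q1" "q $ 2 = 0"
  using that[of "vector [q1, 0]"] by simp

lemma dist_edge:
  fixes p q :: "real^2"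
  assumes "q $ 2 = 0"
  shows "(dist p q)\<^sup>2 = (p $ 1 - q $ 1) * (p $ 1 - q $ 1) + p $ 2 * p $ 2"
  using norm_2_sq[of "p - q"] assms by (simp add: dist_norm power2_eq_square)

lemma rough_bound:
  obtains \<Lambda> \<rho> where "\<Lambda> > 0" "\<rho> > 0"
    "\<And>\<eta>. \<eta> > 0 \<Longrightarrow> \<exists>T. \<forall>t\<ge>T. \<forall>p\<in>half_plane. dist p p0 \<le> 3 * R / 4 \<and> p $ 2 \<le> \<rho> \<longrightarrow>
       V p t \<le> \<eta> + 2 * \<Lambda> * p $ 2"
proof -
  define B where "B = B0 + 1"
  have B: "B \<ge> 1" "B0 \<le> B" using B0_nonneg by (auto simp: B_def)
  define m1 where "m1 = m0 / B"
  have m1: "m1 > 0" using m0(1) B by (simp add: m1_def)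
  define k where "k = 1 + 5 * B / (2 * m0)"
  have k: "k \<ge> 1" "2 * m0 * (k - 1) = 5 * B" using m0(1) B by (auto simp: k_def)
  define \<rho> where "\<rho> = min (R / 4) (min (1 / (4 * k)) (m1 / (72 * B)))"
  have \<rho>: "\<rho> > 0" "\<rho> \<le> R / 4" "\<rho> \<le> 1 / (4 * k)" "\<rho> \<le> m1 / (72 * B)"
    using R k m1 B by (auto simp: \<rho>_def)
  have \<rho>k: "\<rho> * k \<le> 1 / 4" using \<rho>(3) k by (simp add: field_simps)
  have \<rho>1: "\<rho> \<le> 1 / 4" using \<rho>k mult_left_mono[OF k(1), of \<rho>] \<rho>(1) by linarith
  define \<Lambda> where "\<Lambda> = 1 + 16 / m1 + \<bar>M\<bar> / \<rho>\<^sup>2"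
  have \<Lambda>0: "\<Lambda> \<ge> 1" "\<Lambda> \<ge> 16 / m1" "\<Lambda> \<ge> \<bar>M\<bar> / \<rho>\<^sup>2"
    using m1 \<rho>(1) unfolding \<Lambda>_def by (smt (verit) divide_nonneg_nonneg zero_le_power2 abs_ge_zero)+
  have \<Lambda>M: "M \<le> \<Lambda> * \<rho>\<^sup>2" using \<Lambda>0(3) \<rho>(1) by (simp add: field_simps)
  have \<Lambda>m: "16 \<le> m1 * \<Lambda>\<^sup>2"
  proof -
    have "16 \<le> m1 * \<Lambda>" using \<Lambda>0(2) m1 by (simp add: field_simps)
    also have "\<dots> \<le> m1 * (\<Lambda> * \<Lambda>)" using m1 \<Lambda>0(1) by (intro mult_left_mono) auto
    finally show ?thesis by (simp add: power2_eq_square)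
  qed
  have main: "\<exists>T. \<forall>t\<ge>T. \<forall>p\<in>half_plane. dist p p0 \<le> 3 * R / 4 \<and> p $ 2 \<le> \<rho> \<longrightarrow>
       V p t \<le> \<eta> + 2 * \<Lambda> * p $ 2" if \<eta>: "\<eta> > 0" "\<eta> \<le> \<Lambda> * \<rho>" for \<eta>
  proof -
    obtain T1 where T1: "\<And>p s t. p \<in> cball p0 R \<Longrightarrow> p $ 2 = 0 \<Longrightarrow> T1 \<le> s \<Longrightarrow> s \<le> t \<Longrightarrow>
        V p s \<le> exp (1 / 2 * (t - s)) * V p t"
      using edge_slow[of "1 / 2"] by (metis half_gt_zero_iff zero_less_one)
    obtain T2 where T2: "\<And>p t. t \<ge> T2 \<Longrightarrow> p \<in> cball p0 R \<Longrightarrow> p $ 2 = 0 \<Longrightarrow> V p t \<le> \<eta>"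
      using edge_lim[OF \<eta>(1)] by blast
    define T where "T = max T0 (max T1 T2)"
    have T: "T \<ge> T0" "T \<ge> T1" "T \<ge> T2" by (auto simp: T_def)
    define m where "m = \<bar>M\<bar> / \<eta>"
    have m: "m \<ge> 0" "\<bar>M\<bar> = m * \<eta>" using \<eta>(1) by (simp_all add: m_def)
    have "V p t0 \<le> \<eta> + 2 * \<Lambda> * p $ 2"
      if t0: "t0 \<ge> T + 2 * m" and p: "p \<in> half_plane" "dist p p0 \<le> 3 * R / 4" "p $ 2 \<le> \<rho>" for t0 p
    proof -
      have t0T: "T \<le> t0" using t0 m by simp
      obtain q :: "real^2" where q: "q $ 1 = p $ 1" "q $ 2 = 0" by (rule edge_point)
      have "(dist q p0)\<^sup>2 \<le> (dist p p0)\<^sup>2"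
        using dist_edge[OF p0, of q] dist_edge[OF p0, of p] q by simp
      then have qp0: "dist q p0 \<le> 3 * R / 4"
        using p(2) power2_le_imp_le[of "dist q p0" "dist p p0"] by simp
      have sub: "dist x p0 \<le> R" if "x \<in> cball q \<rho>" for x
        using dist_triangle[of x p0 q] that qp0 \<rho>(2) by (auto simp: dist_commute)
      have qK: "cball q \<rho> \<inter> half_plane \<subseteq> K"
        using sub by (auto intro!: in_K)
      define w where "w = quad \<eta> 0 \<Lambda> \<Lambda> 0 (\<Lambda> * (1 - k)) (q $ 1)"
      have xy: "\<bar>x $ 1 - q $ 1\<bar> \<le> \<rho>" "\<bar>x $ 2\<bar> \<le> \<rho>" if "x \<in> cball q \<rho>" for x
        using component_le_norm_cart[of "x - q" 1] component_le_norm_cart[of "x - q" 2] that q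
        by (auto simp: dist_norm norm_minus_commute)
      have w_alt: "w x = \<eta> + \<Lambda> * ((x $ 1 - q $ 1) * (x $ 1 - q $ 1) + x $ 2 * x $ 2 + x $ 2 * (1 -
          k * x $ 2))" for x
        by (simp add: w_def quad_def algebra_simps)
      have ky: "k * x $ 2 \<le> 1 / 4" if "x \<in> cball q \<rho>" for x
        using mult_left_mono[OF abs_le_D1[OF xy(2)[OF that]], of k] k(1) \<rho>k mult.commute[of \<rho> k]
            by linarith
      have w_ge: "w x \<ge> \<eta> + \<Lambda> * (dist x q)\<^sup>2" if "x \<in> cball q \<rho>" "x $ 2 \<ge> 0" for x
      proof -
        have "0 \<le> \<Lambda> * (x $ 2 * (1 - k * x $ 2))" using ky[OF that(1)] that(2) \<Lambda>0(1) by simp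
        then show ?thesis unfolding w_alt dist_edge[OF q(2)] by (simp add: algebra_simps)
      qed
      have "-1 * (V p t0 - w p) \<ge> 0"
      proof (rule comparison[where \<epsilon> = "1 / 2" and q = q and \<rho> = \<rho> and T = T and w = w])
        show "cball q \<rho> \<inter> half_plane \<subseteq> K" by (rule qK)
        show "0 < T" using T T0 by simp
        show "T \<le> t0" by (rule t0T)
        show "Ck_on 2 UNIV W w" if "open_hp W" for W unfolding w_def by (rule quad_Ck[OF that])
        show "continuous_on UNIV w" unfolding w_def by (rule quad_continuous)
        show "w x > 0" if "x \<in> cball q \<rho>" "x $ 2 \<ge> 0" for x
          using w_ge[OF that] \<eta> \<Lambda>0(1) by (smt (verit) mult_nonneg_nonneg zero_le_power2)
        show "p \<in> cball q \<rho>"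
        proof -
          have "(dist p q)\<^sup>2 = (p $ 2)\<^sup>2" using dist_edge[OF q(2), of p] q
              by (simp add: power2_eq_square)
          then have "dist p q = p $ 2" using p(1) by (simp add: power2_eq_iff_nonneg)
          then show ?thesis using p(3) by (simp add: dist_commute)
        qed
        show "p $ 2 \<ge> 0" using p by simp
        show "-1 * Fop w x \<ge> 2 * (1 / 2)" if x: "x \<in> cball q \<rho>" "x $ 2 > 0" "w x > 0" for x
        proof -
          have xH: "x \<in> half_plane" using x by simp
          have xK: "x \<in> K" using qK x xH by blast
          note bd = bounds[OF xK[unfolded K_def]] and el = m0(2)[OF xK[unfolded K_def]]
          define s where "s = x $ 1 - q $ 1"
          define y where "y = x $ 2"
          define w1 where "w1 = 2 * \<Lambda> * s"
          define w2 where "w2 = \<Lambda> * (1 + 2 * (1 - k) * y)"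
          have s: "\<bar>s\<bar> \<le> 1 / 4" "y > 0" "y \<le> 1 / 4" "k * y \<le> 1 / 4"
            using xy[OF x(1)] \<rho>1 x ky[OF x(1)] by (auto simp: s_def y_def)
          have P: "pd 1 w x = w1" "pd 2 w x = w2"
            "pd 1 (pd 1 w) x = 2 * \<Lambda>" "pd 1 (pd 2 w) x = 0" "pd 2 (pd 1 w) x = 0" "pd 2 (pd 2 w) x
                = 2 * (\<Lambda> * (1 - k))"
            unfolding w_def quad_pd2[OF xH] quad_pd[OF xH] by (simp_all add: quad_def w1_def
                w2_def s_def y_def algebra_simps)
          have f: "1 / 2 \<le> 1 + 2 * (1 - k) * y" "1 + 2 * (1 - k) * y \<le> 1"
            using s k(1) by (auto simp: algebra_simps mult_le_cancel_left1)
          have "Lop w x = \<Lambda> * (2 * A11 x + 2 * (1 - k) * A22 x - b1 x * (2 * s) - b2 x * (1 +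
              2 * (1 - k) * y))"
            unfolding Lop_def P by (simp add: w1_def w2_def algebra_simps)
          also have "\<dots> \<le> 0"
          proof -
            have "\<bar>b1 x * (2 * s)\<bar> \<le> B * 1" unfolding abs_mult using bd s B
                by (intro mult_mono) auto
            moreover have "\<bar>b2 x * (1 + 2 * (1 - k) * y)\<bar> \<le> B * 1"
              unfolding abs_mult using bd f B by (intro mult_mono) auto
            moreover have "2 * (k - 1) * A22 x \<ge> 2 * (k - 1) * m0" using el k
                by (intro mult_left_mono) auto
            ultimately have "2 * A11 x + 2 * (1 - k) * A22 x - b1 x * (2 * s) - b2 x * (1 +
                2 * (1 - k) * y) \<le> 0"
              using k(2) bd B by (auto simp: algebra_simps)
            then show ?thesis using \<Lambda>0(1) by (simp add: mult_nonneg_nonpos)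
          qed
          finally have L: "w x * Lop w x \<le> 0" using x(3) by (simp add: mult_nonneg_nonpos)
          have G: "grad2 w x \<ge> m1 * (\<Lambda>\<^sup>2 / 4)"
          proof -
            have A: "A11 x > 0" "A11 x \<le> B" using el bd B by auto
            have "0 \<le> (A11 x * w1 + A12 x * w2)\<^sup>2" by simp
            then have "(A11 x * A22 x - (A12 x)\<^sup>2) * w2\<^sup>2 \<le> A11 x * grad2 w x"
              unfolding grad2_def P by (simp add: algebra_simps power2_eq_square)
            moreover have "m0 * w2\<^sup>2 \<le> (A11 x * A22 x - (A12 x)\<^sup>2) * w2\<^sup>2" using el
                by (intro mult_right_mono) auto
            ultimately have g1: "m0 * w2\<^sup>2 \<le> A11 x * grad2 w x" by simp
            then have "0 \<le> A11 x * grad2 w x" using m0(1) by (smt (verit) mult_nonneg_nonneg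
                zero_le_power2)
            then have "grad2 w x \<ge> 0" using A by (simp add: zero_le_mult_iff)
            then have "A11 x * grad2 w x \<le> B * grad2 w x" using A by (intro mult_right_mono) auto
            then have g2: "m1 * w2\<^sup>2 \<le> grad2 w x" using g1 B unfolding m1_def
                by (simp add: field_simps)
            have "\<Lambda> * (1 / 2) \<le> w2" unfolding w2_def using f \<Lambda>0(1) by (intro mult_left_mono) auto
            then have "(\<Lambda> * (1 / 2))\<^sup>2 \<le> w2\<^sup>2" using \<Lambda>0(1) by (intro power_mono) auto
            then have "m1 * (\<Lambda>\<^sup>2 / 4) \<le> m1 * w2\<^sup>2" using m1 by (intro mult_left_mono) (auto simp:
                power2_eq_square)
            then show ?thesis using g2 by simp
          qed
          have W: "\<kappa> x * (w x)\<^sup>2 \<le> m1 * (\<Lambda>\<^sup>2 / 8)"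
          proof -
            have "s * s \<le> \<rho>" using xy(1)[OF x(1)] \<rho>1 mult_mono[of "\<bar>s\<bar>" \<rho> "\<bar>s\<bar>" 1] s
                by (auto simp: s_def)
            moreover have "y * (1 + (1 - k) * y) \<le> \<rho> * 1"
              using xy(2)[OF x(1)] s f k(1) by (intro mult_mono) (auto simp: y_def algebra_simps
                  mult_le_cancel_left1)
            ultimately have "w x \<le> \<eta> + \<Lambda> * (2 * \<rho>)"
              unfolding w_alt s_def[symmetric] y_def[symmetric] using \<Lambda>0(1)
              by (intro add_left_mono mult_left_mono) (auto simp: algebra_simps)
            then have "w x \<le> 3 * \<Lambda> * \<rho>" using \<eta>(2) by simp
            then have "(w x)\<^sup>2 \<le> (3 * \<Lambda> * \<rho>)\<^sup>2" using x(3) by (intro power_mono) auto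
            then have "\<kappa> x * (w x)\<^sup>2 \<le> B * (3 * \<Lambda> * \<rho>)\<^sup>2" using bd B by (intro mult_mono) auto
            also have "\<dots> = 9 * B * \<Lambda>\<^sup>2 * (\<rho> * \<rho>)" by (simp add: power2_eq_square)
            also have "\<dots> \<le> 9 * B * \<Lambda>\<^sup>2 * (m1 / (72 * B) * 1)"
              using B \<rho> \<rho>1 m1 by (intro mult_left_mono mult_mono) auto
            also have "\<dots> = m1 * (\<Lambda>\<^sup>2 / 8)" using B by (simp add: field_simps)
            finally show ?thesis .
          qed
          show ?thesis unfolding Fop_def using L G W \<Lambda>m by (simp add: algebra_simps)
        qed
        show "-1 * (V x t - exp (-1 * (1 / 2) * (t - t0)) * w x) \<ge> 0"
          if x: "x \<in> cball q \<rho>" "x $ 2 \<ge> 0" "T \<le> t" "t \<le> t0" and or: "t = T \<or> x $ 2 = 0 \<or>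
              dist x q = \<rho>" for x t
        proof -
          have xK: "x \<in> cball p0 R \<inter> half_plane" using sub[OF x(1)] x(2) by (simp add: dist_commute)
          have VM: "V x t \<le> M" using V_le[OF xK] x(3) T by simp
          define E where "E = exp (1 / 2 * (t0 - t))"
          have E: "E \<ge> 1" using x(4) by (simp add: E_def)
          have wx: "w x \<ge> \<eta>" using w_ge[OF x(1,2)] \<Lambda>0(1) by (smt (verit) mult_nonneg_nonneg
              zero_le_power2)
          have "V x t \<le> E * w x"
            using or
          proof (elim disjE)
            assume t: "t = T"
            have "m \<le> 1 / 2 * (t0 - T)" using t0 by (simp add: field_simps)
            also have "\<dots> \<le> E" unfolding E_def t using exp_ge_add_one_self[of "1 / 2 * (t0 - T)"]
                by linarith
            finally have "\<bar>M\<bar> \<le> E * \<eta>" using \<eta> unfolding m(2) by (intro mult_right_mono) auto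
            also have "\<dots> \<le> E * w x" using wx E by (intro mult_left_mono) auto
            finally show ?thesis using VM by simp
          next
            assume e: "x $ 2 = 0"
            have "V x t \<le> E * V x t0" unfolding E_def using T1[of x t t0] xK e x T by simp
            also have "\<dots> \<le> E * \<eta>" using T2[of t0 x] t0T T xK e E by (intro mult_left_mono) auto
            also have "\<dots> \<le> E * w x" using wx E by (intro mult_left_mono) auto
            finally show ?thesis .
          next
            assume "dist x q = \<rho>"
            then have "M \<le> w x" using w_ge[OF x(1,2)] \<Lambda>M \<eta> by simp
            also have "\<dots> \<le> E * w x" using E wx \<eta> by (simp add: mult_le_cancel_right1)
            finally show ?thesis using VM by simp
          qed
          moreover have "exp (-1 * (1 / 2) * (t - t0)) = E" by (simp add: E_def field_simps)
          ultimately show ?thesis by simp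
        qed
      qed auto
      then have "V p t0 \<le> w p" by simp
      also have "\<dots> \<le> \<eta> + \<Lambda> * (2 * p $ 2)"
      proof -
        have "p $ 2 * (1 + (1 - k) * p $ 2) \<le> p $ 2 * 2"
        proof (rule mult_left_mono)
          have "(1 - k) * p $ 2 \<le> 0" using p(1) k(1) by (simp add: mult_nonpos_nonneg)
          then show "1 + (1 - k) * p $ 2 \<le> 2" by simp
        qed (use p(1) in simp)
        then show ?thesis unfolding w_alt using \<Lambda>0(1) q(1)
          by (intro add_left_mono mult_left_mono) (auto simp: algebra_simps)
      qed
      finally show ?thesis by simp
    qed
    then show ?thesis by blast
  qed
  show ?thesis
  proof (rule that[of \<Lambda> \<rho>])
    show "\<Lambda> > 0" "\<rho> > 0" using \<Lambda>0 \<rho> by auto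
    fix \<eta> :: real assume "\<eta> > 0"
    then have "min \<eta> (\<Lambda> * \<rho>) > 0" using \<Lambda>0 \<rho> by auto
    from main[OF this] obtain T where "\<forall>t\<ge>T. \<forall>p\<in>half_plane. dist p p0 \<le> 3 * R / 4 \<and> p $ 2 \<le> \<rho> \<longrightarrow>
       V p t \<le> min \<eta> (\<Lambda> * \<rho>) + 2 * \<Lambda> * p $ 2" by auto
    then show "\<exists>T. \<forall>t\<ge>T. \<forall>p\<in>half_plane. dist p p0 \<le> 3 * R / 4 \<and> p $ 2 \<le> \<rho> \<longrightarrow>
       V p t \<le> \<eta> + 2 * \<Lambda> * p $ 2" by (intro exI[of _ T]) force
  qed
qed

lemma pdv_2_nonneg:
  assumes "has_pdv 2 f D q" "q $ 2 = 0" "f q = 0" "\<rho> > 0"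
    and "\<And>p. p \<in> cball q \<rho> \<Longrightarrow> p $ 2 \<ge> 0 \<Longrightarrow> f p \<ge> 0"
  shows "D \<ge> 0"
proof -
  have "((\<lambda>s. (f (q + s *\<^sub>R axis 2 1) - f q) / s) \<longlongrightarrow> D) (at 0 within pd_dom 2 q)"
    using assms(1) by (simp add: has_pdv_def has_field_derivative_iff)
  moreover have "\<forall>\<^sub>F s in at 0 within pd_dom 2 q. 0 \<le> (f (q + s *\<^sub>R axis 2 1) - f q) / s"
    unfolding eventually_at
  proof (intro exI[of _ \<rho>] conjI ballI impI assms(4))
    fix s assume "s \<in> pd_dom 2 q" "s \<noteq> 0 \<and> dist s 0 < \<rho>"
    then have "s > 0" "s < \<rho>" using assms(2) by (auto simp: pd_dom_2)
    then show "0 \<le> (f (q + s *\<^sub>R axis 2 1) - f q) / s"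
      using assms(2,3) assms(5)[of "q + s *\<^sub>R axis 2 1"] by (simp add: dist_norm)
  qed
  ultimately show ?thesis
    using at_pd_dom_not_bot[of q 2] assms(2) by (intro tendsto_lowerbound) auto
qed

lemma V_edge_taylor:
  assumes q: "q $ 2 = 0" "cball q \<rho> \<subseteq> cball p0 R" and t: "t \<ge> T0"
    and x: "x \<in> cball q \<rho>" "x $ 2 = 0"
  shows "\<bar>V x t - V q t - pd 1 (\<lambda>p. V p t) q * (x $ 1 - q $ 1)\<bar> \<le> C * (x $ 1 - q $ 1)\<^sup>2"
proof -
  define P where "P = (\<lambda>s. q + s *\<^sub>R axis 1 (1::real))"
  have P: "P s \<in> cball q \<rho>" "P s $ 2 = 0" if "\<bar>s\<bar> \<le> \<rho>" for s
    using that q by (auto simp: P_def dist_norm)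
  have PR: "P s \<in> cball p0 R" if "\<bar>s\<bar> \<le> \<rho>" for s using P(1)[OF that] q(2) by blast
  have P\<Omega>: "P s \<in> \<Omega>" if "\<bar>s\<bar> \<le> \<rho>" for s using PR[OF that] P(2)[OF that] \<Omega>(2) by auto
  have t0: "t > 0" using t T0 by simp
  have dom: "pd_dom 1 q = UNIV" using q by (intro pd_dom_1) simp
  have "dist x q = \<bar>x $ 1 - q $ 1\<bar>"
    using dist_edge[OF q(1), of x] x(2)
    by (metis abs_power2 add.right_neutral mult_zero_left power2_abs power2_eq_imp_eq
        power2_eq_square zero_le_dist abs_ge_zero)
  then have s: "\<bar>x $ 1 - q $ 1\<bar> \<le> \<rho>" using x by (simp add: dist_commute)
  have xP: "P (x $ 1 - q $ 1) = x" using x q by (simp add: vec_eq_2 P_def)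
  have "\<bar>V (P (x $ 1 - q $ 1)) t - V (P 0) t - pd 1 (\<lambda>p. V p t) (P 0) * (x $ 1 - q $ 1)\<bar> \<le>
      C * (x $ 1 - q $ 1)\<^sup>2"
  proof (rule edge_taylor[where h = \<rho> and g'' = "\<lambda>s. pd 1 (pd 1 (\<lambda>p. V p t)) (P s)"])
    show "((\<lambda>s. V (P s) t) has_real_derivative pd 1 (\<lambda>p. V p t) (P s)) (at s)" if "\<bar>s\<bar> \<le> \<rho>" for s
      using has_pdv_line[OF Ck_on_2_pdv[OF V_C2[OF t0] P\<Omega>[OF that, unfolded P_def], of 1]] dom
      by (simp add: P_def)
    show "((\<lambda>s. pd 1 (\<lambda>p. V p t) (P s)) has_real_derivative pd 1 (pd 1 (\<lambda>p. V p t)) (P s)) (at s)"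
      if "\<bar>s\<bar> \<le> \<rho>" for s
      using has_pdv_line[OF Ck_on_2_pdv2[OF V_C2[OF t0] P\<Omega>[OF that, unfolded P_def], of 1 1]] dom
      by (simp add: P_def)
    show "\<bar>pd 1 (pd 1 (\<lambda>p. V p t)) (P s)\<bar> \<le> C" if "\<bar>s\<bar> \<le> \<rho>" for s
      using edge_C[OF PR[OF that] P(2)[OF that] t] by simp
  qed (rule s)
  then show ?thesis unfolding xP by (simp add: P_def)
qed

lemma A_uniform:
  assumes "\<omega> > 0"
  obtains \<rho> where "\<rho> > 0" "\<And>p q. p \<in> K \<Longrightarrow> q \<in> K \<Longrightarrow> dist p q \<le> \<rho> \<Longrightarrow>
    \<bar>A11 p - A11 q\<bar> \<le> \<omega> \<and> \<bar>A12 p - A12 q\<bar> \<le> \<omega> \<and> \<bar>A22 p - A22 q\<bar> \<le> \<omega>"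
proof -
  have u: "\<exists>d>0. \<forall>p\<in>K. \<forall>q\<in>K. dist p q < d \<longrightarrow> \<bar>f p - f q\<bar> < \<omega>" if "continuous_on K f"
      for f :: "real^2 \<Rightarrow> real"
    using compact_uniformly_continuous[OF that compact_K] assms
    unfolding uniformly_continuous_on_def dist_real_def by (metis dist_commute)
  obtain d1 where d1: "d1 > 0" "\<forall>p\<in>K. \<forall>q\<in>K. dist p q < d1 \<longrightarrow> \<bar>A11 p - A11 q\<bar> < \<omega>"
    using u[OF A_cont(1)[folded K_def]] by (elim exE conjE)
  obtain d2 where d2: "d2 > 0" "\<forall>p\<in>K. \<forall>q\<in>K. dist p q < d2 \<longrightarrow> \<bar>A12 p - A12 q\<bar> < \<omega>"
    using u[OF A_cont(2)[folded K_def]] by (elim exE conjE)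
  obtain d3 where d3: "d3 > 0" "\<forall>p\<in>K. \<forall>q\<in>K. dist p q < d3 \<longrightarrow> \<bar>A22 p - A22 q\<bar> < \<omega>"
    using u[OF A_cont(3)[folded K_def]] by (elim exE conjE)
  note d = d1(1) d2(1) d3(1)
  show ?thesis
  proof (rule that[of "min d1 (min d2 d3) / 2"])
    show "min d1 (min d2 d3) / 2 > 0" using d by simp
    fix p q assume pq: "p \<in> K" "q \<in> K" "dist p q \<le> min d1 (min d2 d3) / 2"
    then have "dist p q < d1" "dist p q < d2" "dist p q < d3" using d by linarith+
    then show "\<bar>A11 p - A11 q\<bar> \<le> \<omega> \<and> \<bar>A12 p - A12 q\<bar> \<le> \<omega> \<and> \<bar>A22 p - A22 q\<bar> \<le> \<omega>"
      using d1(2) d2(2) d3(2) pq(1,2) by (auto intro: less_imp_le)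
  qed
qed

lemma edge_derivative:
  assumes \<sigma>: "\<sigma> = 1 \<or> \<sigma> = (-1::real)" and e: "0 < e" "e \<le> 1"
  shows "\<exists>T. \<forall>t\<ge>T. \<forall>q. q $ 2 = 0 \<and> dist q p0 \<le> R / 2 \<longrightarrow>
    \<sigma> * (sqrt (A22 q) * pd 2 (\<lambda>p. V p t) q - (1 - \<sigma> * e)) \<ge> 0"
proof -
  obtain \<Lambda> \<rho>r where rough: "\<Lambda> > 0" "\<rho>r > 0"
    "\<And>\<eta>. \<eta> > 0 \<Longrightarrow> \<exists>T. \<forall>t\<ge>T. \<forall>p\<in>half_plane. dist p p0 \<le> 3 * R / 4 \<and> p $ 2 \<le> \<rho>r \<longrightarrow>
       V p t \<le> \<eta> + 2 * \<Lambda> * p $ 2" using rough_bound by blast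
  define B where "B = B0 + 1"
  have B: "B \<ge> 1" "B0 \<le> B" using B0_nonneg by (auto simp: B_def)
  define a0 where "a0 = 2 / sqrt m0"
  have a0: "a0 \<ge> 0" using m0(1) by (simp add: a0_def)
  define B1 where "B1 = B / m0"
  have B1: "B1 \<ge> 0" using B m0(1) by (simp add: B1_def)
  define N where "N = 2 * B * (3 + a0 + 2 * \<Lambda>)"
  define lam where "lam = 1 / (2 * B)"
  have Nlam: "N * lam = 3 + a0 + 2 * \<Lambda>" using B by (simp add: N_def lam_def)
  have lam: "lam > 0" using B by (simp add: lam_def)
  have N: "N > 0" unfolding N_def using B a0 rough(1) by (intro mult_pos_pos) auto
  define W where "W = 2 + a0 + 4 * N * B1"
  have W: "W \<ge> 2" "1 + 4 * N * B1 \<le> W" "a0 + 4 * N * B1 \<le> W" using a0 B1 N by (auto simp: W_def)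
  define \<omega> where "\<omega> = e / (8 * (8 * N * W * B1 + 4 * W\<^sup>2))"
  have den: "8 * N * W * B1 + 4 * W\<^sup>2 > 0" using N W(1) B1 by (intro add_nonneg_pos) auto
  have "D * (e / (8 * D)) = e / 8" if "D > 0" for D :: real
    using that by simp
  from this[OF den] have \<omega>: "\<omega> > 0" "(8 * N * W * B1 + 4 * W\<^sup>2) * \<omega> = e / 8"
    using den e(1) unfolding \<omega>_def by simp_all
  obtain \<rho>1 where \<rho>1: "\<rho>1 > 0" "\<And>p q. p \<in> K \<Longrightarrow> q \<in> K \<Longrightarrow> dist p q \<le> \<rho>1 \<Longrightarrow>
    \<bar>A11 p - A11 q\<bar> \<le> \<omega> \<and> \<bar>A12 p - A12 q\<bar> \<le> \<omega> \<and> \<bar>A22 p - A22 q\<bar> \<le> \<omega>"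
    using A_uniform[OF \<omega>(1)] by blast
  define \<rho> where "\<rho> = min (min (R / 4) \<rho>r) (min (min \<rho>1 1) (min (1 / C) (e / (24 * B * W\<^sup>2))))"
  have \<rho>: "\<rho> > 0" "\<rho> \<le> R / 4" "\<rho> \<le> \<rho>r" "\<rho> \<le> \<rho>1" "\<rho> \<le> 1" "\<rho> \<le> 1 / C" "\<rho> \<le> e / (24 * B * W\<^sup>2)"
    using R rough(2) \<rho>1(1) C e(1) B W(1) by (auto simp: \<rho>_def)
  have \<rho>C: "C * \<rho> \<le> 1" using \<rho>(6) C by (simp add: field_simps)
  have \<rho>e: "3 * B * W\<^sup>2 * \<rho> \<le> e / 8"
  proof -
    have "3 * B * W\<^sup>2 * \<rho> \<le> 3 * B * W\<^sup>2 * (e / (24 * B * W\<^sup>2))" using \<rho>(7) B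
        by (intro mult_left_mono) auto
    also have "\<dots> = e / 8" using B W(1) by (simp add: field_simps)
    finally show ?thesis .
  qed
  define \<mu> where "\<mu> = min 1 (e / (16 * ((2 * a0 + 1) * B)))"
  have ab: "(2 * a0 + 1) * B > 0" using a0 B by (intro mult_pos_pos) auto
  have \<mu>: "\<mu> > 0" "\<mu> \<le> 1" "(2 * a0 + 1) * B * \<mu> \<le> e / 16"
  proof -
    show "\<mu> > 0" "\<mu> \<le> 1" using ab e(1) by (auto simp: \<mu>_def)
    have "(2 * a0 + 1) * B * \<mu> \<le> (2 * a0 + 1) * B * (e / (16 * ((2 * a0 + 1) * B)))"
      using ab by (intro mult_left_mono) (auto simp: \<mu>_def)
    also have "\<dots> = e / 16" using ab by (simp add: field_simps)
    finally show "(2 * a0 + 1) * B * \<mu> \<le> e / 16" .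
  qed
  define \<eta> where "\<eta> = min \<rho> (min (\<mu>\<^sup>2 / C) (\<rho> * e / (64 * N)))"
  have \<eta>: "\<eta> > 0" "\<eta> \<le> \<rho>" "\<eta> \<le> \<mu>\<^sup>2 / C" "\<eta> \<le> \<rho> * e / (64 * N)"
    using \<rho>(1) \<mu>(1) C e(1) N by (auto simp: \<eta>_def)
  define \<epsilon> where "\<epsilon> = e / 8"
  have \<epsilon>: "0 < \<epsilon>" "2 * \<epsilon> \<le> 1" using e by (auto simp: \<epsilon>_def)
  have \<epsilon>2: "\<epsilon> / 2 > 0" using \<epsilon> by simp
  obtain T1 where T1: "\<And>p s t. p \<in> cball p0 R \<Longrightarrow> p $ 2 = 0 \<Longrightarrow> T1 \<le> s \<Longrightarrow> s \<le> t \<Longrightarrow>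
      V p s \<le> exp (\<epsilon> / 2 * (t - s)) * V p t"
    using edge_slow[OF \<epsilon>2] by blast
  obtain T2 where T2: "\<And>p t. t \<ge> T2 \<Longrightarrow> p \<in> cball p0 R \<Longrightarrow> p $ 2 = 0 \<Longrightarrow> V p t \<le> \<eta>"
    using edge_lim[OF \<eta>(1)] by blast
  obtain T3 where T3: "\<And>t p. t \<ge> T3 \<Longrightarrow> p \<in> half_plane \<Longrightarrow> dist p p0 \<le> 3 * R / 4 \<Longrightarrow> p $ 2 \<le> \<rho>r \<Longrightarrow>
      V p t \<le> \<rho> + 2 * \<Lambda> * p $ 2"
    using rough(3)[OF \<rho>(1)] by blast
  define T where "T = max (max T0 T1) (max T2 T3)"
  have T: "T \<ge> T0" "T \<ge> T1" "T \<ge> T2" "T \<ge> T3" by (auto simp: T_def)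
  have Tpos: "T > 0" using T T0 by simp
  obtain v where v: "v > 0" "\<And>p. p \<in> K \<Longrightarrow> V p T \<ge> v"
  proof -
    have "K \<noteq> {}" using in_K[of p0] p0 R by auto
    from continuous_attains_inf[OF compact_K this V_cont[OF Tpos]]
    obtain z where "\<forall>y\<in>K. V z T \<le> V y T" by blast
    then show ?thesis using that[of "V z T"] V_pos by blast
  qed
  define X where "X = 2 * (\<bar>M\<bar> / v) + W * \<rho> / v"
  have X: "X \<ge> 0" "2 * \<bar>M\<bar> \<le> X * v" "W * \<rho> \<le> X * v"
    using v(1) W(1) \<rho>(1) by (auto simp: X_def algebra_simps)
  define Y where "Y = 2 * X / \<epsilon>"
  have Y: "Y \<ge> 0" "\<epsilon> / 2 * Y = X" using X \<epsilon> by (auto simp: Y_def)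
  have main: "\<sigma> * (sqrt (A22 q) * pd 2 (\<lambda>p. V p t0) q - (1 - \<sigma> * e)) \<ge> 0"
    if t0: "t0 \<ge> T + Y" and q: "q $ 2 = 0" "dist q p0 \<le> R / 2" for t0 and q :: "real^2"
  proof -
    have t0T: "T \<le> t0" "t0 > 0" using t0 Y Tpos by auto
    have sub': "dist x p0 \<le> 3 * R / 4" if "x \<in> cball q \<rho>" for x
      using dist_triangle[of x p0 q] that q(2) \<rho>(2) by (auto simp: dist_commute)
    have sub: "dist x p0 \<le> R" if "x \<in> cball q \<rho>" for x using sub'[OF that] R by simp
    have cb: "cball q \<rho> \<subseteq> cball p0 R" using sub by (auto simp: dist_commute)
    have qK': "cball q \<rho> \<inter> half_plane \<subseteq> K" using sub by (auto intro!: in_K)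
    have qc: "q \<in> cball q \<rho>" using \<rho>(1) by simp
    have qK: "q \<in> K" using qK' q(1) qc by auto
    have qR: "q \<in> cball p0 R" using cb qc by blast
    note bd = bounds[OF qK[unfolded K_def]] and el = m0(2)[OF qK[unfolded K_def]]
    define r where "r = sqrt (A22 q)"
    have r: "r > 0" "r * r = A22 q" "r \<ge> sqrt m0" using el m0(1) by (auto simp: r_def)
    define a where "a = (1 - \<sigma> * e) / r"
    have ra: "r * a = 1 - \<sigma> * e" using r(1) by (simp add: a_def)
    have a: "0 \<le> a" "a \<le> a0"
    proof -
      have "0 \<le> 1 - \<sigma> * e" "1 - \<sigma> * e \<le> 2" using \<sigma> e by auto
      then show "0 \<le> a" "a \<le> a0" unfolding a_def a0_def using r m0(1) by (auto intro!: frac_le)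
    qed
    define c0 where "c0 = V q t0"
    define c1 where "c1 = pd 1 (\<lambda>p. V p t0) q"
    have c0: "c0 > 0" "c0 \<le> \<eta>" using V_pos T2[of t0 q] t0T T qR q by (auto simp: c0_def)
    have c1s: "c1\<^sup>2 \<le> C * c0" using edge_C[OF qR q(1), of t0] t0T T by (simp add: c0_def c1_def)
    have c1: "\<bar>c1\<bar> \<le> \<mu>"
    proof -
      have "C * c0 \<le> C * (\<mu>\<^sup>2 / C)" using c0 \<eta>(3) C by (intro mult_left_mono) auto
      then have "c1\<^sup>2 \<le> \<mu>\<^sup>2" using c1s C by simp
      then show ?thesis using \<mu>(1) by (metis abs_le_square_iff abs_of_pos)
    qed
    define d where "d = A11 q * A22 q - (A12 q)\<^sup>2"
    have d: "d \<ge> m0" "d > 0" using el m0(1) by (auto simp: d_def)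
    define g11 where "g11 = A22 q / d"
    define g12 where "g12 = - A12 q / d"
    define g22 where "g22 = A11 q / d"
    have gB: "\<bar>g11\<bar> \<le> B1" "\<bar>g12\<bar> \<le> B1" "\<bar>g22\<bar> \<le> B1"
      unfolding g11_def g12_def g22_def B1_def abs_divide abs_minus_cancel using bd B d m0(1)
      by (auto intro!: frac_le)
    define \<beta> where "\<beta> = - \<sigma> * (N / \<rho>)"
    have \<beta>: "\<bar>\<beta>\<bar> = N / \<rho>" "\<bar>\<beta>\<bar> * \<rho> = N" using \<sigma> N \<rho>(1) by (auto simp: \<beta>_def)
    define Q where "Q = (\<lambda>x::real^2. g11 * ((x $ 1 - q $ 1) * (x $ 1 - q $ 1))
        + 2 * g12 * ((x $ 1 - q $ 1) * x $ 2) + g22 * (x $ 2 * x $ 2))"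
    define w where "w = quad c0 c1 a (\<beta> * g11) (\<beta> * g12) (\<beta> * g22) (q $ 1)"
    have w_alt: "w x = c0 + c1 * (x $ 1 - q $ 1) + a * x $ 2 + \<beta> * Q x" for x
      by (simp add: w_def quad_def Q_def algebra_simps)
    have Q_ge: "Q x \<ge> lam * (dist x q)\<^sup>2" for x
      unfolding Q_def dist_edge[OF q(1)] lam_def g11_def g12_def g22_def
      using inverse_form_lower_bound[of d "A11 q" "A22 q" "A12 q" B "x $ 1 - q $ 1" "x $ 2"] d el
          bd B m0(1)
      by (simp add: d_def)
    have xy: "\<bar>x $ 1 - q $ 1\<bar> \<le> \<rho>" "\<bar>x $ 2\<bar> \<le> \<rho>" if "x \<in> cball q \<rho>" for x
      using component_le_norm_cart[of "x - q" 1] component_le_norm_cart[of "x - q" 2] that q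
      by (auto simp: dist_norm norm_minus_commute)
    have pr: "\<bar>x * y\<bar> \<le> X * Y" if "\<bar>x\<bar> \<le> X" "\<bar>y\<bar> \<le> Y" for x y X Y :: real
      unfolding abs_mult by (rule mult_mono[OF that order_trans[OF abs_ge_zero that(1)]
          abs_ge_zero])
    have w_bound: "\<bar>w x\<bar> \<le> W * \<rho>" if x: "x \<in> cball q \<rho>" for x
    proof -
      have 1: "\<bar>c1 * (x $ 1 - q $ 1)\<bar> \<le> 1 * \<rho>" using c1 \<mu>(2) xy(1)[OF x] by (intro pr) auto
      have 2: "\<bar>a * x $ 2\<bar> \<le> a0 * \<rho>" using a xy(2)[OF x] by (intro pr) auto
      have "\<bar>Q x\<bar> \<le> B1 * (\<rho> * \<rho>) + 2 * (B1 * (\<rho> * \<rho>)) + B1 * (\<rho> * \<rho>)"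
        using pr[OF gB(1) pr[OF xy(1)[OF x] xy(1)[OF x]]] pr[OF gB(2) pr[OF xy(1)[OF x] xy(2)[OF
            x]]]
          pr[OF gB(3) pr[OF xy(2)[OF x] xy(2)[OF x]]] unfolding Q_def by linarith
      then have "\<bar>\<beta> * Q x\<bar> \<le> (N / \<rho>) * (4 * (B1 * (\<rho> * \<rho>)))" using \<beta>(1) by (intro pr) auto
      also have "\<dots> = 4 * N * B1 * \<rho>" using \<rho>(1) by simp
      finally have 3: "\<bar>\<beta> * Q x\<bar> \<le> 4 * N * B1 * \<rho>" .
      have "\<bar>w x\<bar> \<le> \<rho> + 1 * \<rho> + a0 * \<rho> + 4 * N * B1 * \<rho>"
        unfolding w_alt using 1 2 3 c0 \<eta>(2) by linarith
      then show ?thesis by (simp add: W_def algebra_simps)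
    qed
    have F: "\<sigma> * Fop w x \<ge> 2 * \<epsilon>" if x: "x \<in> cball q \<rho>" "x $ 2 > 0" for x
    proof -
      have xH: "x \<in> half_plane" using x by simp
      have xK: "x \<in> K" using qK' x xH by blast
      note bdx = bounds[OF xK[unfolded K_def]]
      define s where "s = x $ 1 - q $ 1"
      define y where "y = x $ 2"
      define w1 where "w1 = c1 + 2 * \<beta> * (g11 * s + g12 * y)"
      define w2 where "w2 = a + 2 * \<beta> * (g12 * s + g22 * y)"
      have sy: "\<bar>s\<bar> \<le> \<rho>" "\<bar>y\<bar> \<le> \<rho>" using xy[OF x(1)] by (auto simp: s_def y_def)
      have P: "pd 1 w x = w1" "pd 2 w x = w2" "pd 1 (pd 1 w) x = 2 * \<beta> * g11"
        "pd 1 (pd 2 w) x = 2 * \<beta> * g12" "pd 2 (pd 1 w) x = 2 * \<beta> * g12" "pd 2 (pd 2 w) x =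
            2 * \<beta> * g22"
        unfolding w_def quad_pd2[OF xH] quad_pd[OF xH]
        by (simp_all add: quad_def w1_def w2_def s_def y_def algebra_simps)
      have wx: "w x = c0 + c1 * s + a * y + \<beta> * (g11 * (s * s) + 2 * g12 * (s * y) + g22 * (y * y))"
        by (simp add: w_alt Q_def s_def y_def)
      have 2: "\<bar>2 * \<beta> * z\<bar> \<le> 4 * N * B1" if "\<bar>z\<bar> \<le> 2 * (B1 * \<rho>)" for z
      proof -
        have "\<bar>\<beta> * z\<bar> \<le> (N / \<rho>) * (2 * (B1 * \<rho>))" using that \<beta>(1) by (intro pr) auto
        also have "\<dots> = 2 * N * B1" using \<rho>(1) by simp
        finally show ?thesis by simp
      qed
      have "\<bar>g11 * s + g12 * y\<bar> \<le> 2 * (B1 * \<rho>)" "\<bar>g12 * s + g22 * y\<bar> \<le> 2 * (B1 * \<rho>)"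
        using pr[OF gB(1) sy(1)] pr[OF gB(2) sy(2)] pr[OF gB(2) sy(1)] pr[OF gB(3) sy(2)]
            by linarith+
      from 2[OF this(1)] 2[OF this(2)] have w12: "\<bar>w1\<bar> \<le> W" "\<bar>w2\<bar> \<le> W"
        unfolding w1_def w2_def using c1 \<mu>(2) a W by linarith+
      define f0 where "f0 = w x * (2 * \<beta> * (A11 q * g11 + 2 * A12 q * g12 + A22 q * g22))
         - (A11 q * w1\<^sup>2 + 2 * A12 q * w1 * w2 + A22 q * w2\<^sup>2) + 1"
      have f0: "f0 = 1 - (a\<^sup>2 * A22 q + 2 * a * c1 * A12 q + c1\<^sup>2 * A11 q) + 4 * \<beta> * c0"
        unfolding f0_def
        by (rule frozen_quad_identity[OF _ _ _ _ wx w1_def w2_def])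
           (use d in \<open>simp_all add: g11_def g12_def g22_def flip: d_def\<close>)
      have var: "\<bar>2 * \<beta> * w x * ((A11 x - A11 q) * g11 + 2 * (A12 x - A12 q) * g12 + (A22 x - A22
          q) * g22)
         - w x * (b1 x * w1 + b2 x * w2)
         - ((A11 x - A11 q) * w1\<^sup>2 + 2 * (A12 x - A12 q) * w1 * w2 + (A22 x - A22 q) * w2\<^sup>2) +
             \<kappa> x * (w x)\<^sup>2\<bar>
         \<le> (8 * N * W * B1 + 4 * W\<^sup>2) * \<omega> + 3 * B * W\<^sup>2 * \<rho>"
      proof -
        have "dist x q \<le> \<rho>1" using x(1) \<rho>(4) by (simp add: dist_commute)
        note uA = \<rho>1(2)[OF xK qK this]
        show ?thesis
          by (rule variation_bound[OF uA[THEN conjunct1] uA[THEN conjunct2, THEN conjunct1]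
                uA[THEN conjunct2, THEN conjunct2] gB w_bound[OF x(1)] w12 eq_refl[OF \<beta>(2)] \<rho>(1)
                    \<rho>(5)])
             (use bdx B(2) in linarith)+
      qed
      have "Fop w x = f0 + (2 * \<beta> * w x * ((A11 x - A11 q) * g11 + 2 * (A12 x - A12 q) * g12 +
          (A22 x - A22 q) * g22)
         - w x * (b1 x * w1 + b2 x * w2)
         - ((A11 x - A11 q) * w1\<^sup>2 + 2 * (A12 x - A12 q) * w1 * w2 + (A22 x - A22 q) * w2\<^sup>2) +
             \<kappa> x * (w x)\<^sup>2)"
        unfolding Fop_def Lop_def grad2_def P f0_def by (simp add: algebra_simps)
      then have Ff: "\<bar>Fop w x - f0\<bar> \<le> e / 4" using var \<omega>(2) \<rho>e by linarith
      have aA: "a\<^sup>2 * A22 q = (1 - \<sigma> * e)\<^sup>2"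
        unfolding ra[symmetric] r(2)[symmetric] by (simp add: power2_eq_square algebra_simps)
      have small: "\<bar>2 * (a * (c1 * A12 q)) + c1 * (c1 * A11 q) - 4 * (\<beta> * c0)\<bar> \<le> e / 8"
      proof -
        have "\<bar>a * (c1 * A12 q)\<bar> \<le> a0 * (\<mu> * B)" using a c1 bd B by (intro pr) auto
        moreover have "\<bar>c1 * (c1 * A11 q)\<bar> \<le> 1 * (\<mu> * B)" using c1 \<mu>(2) bd B by (intro pr) auto
        moreover have "\<bar>\<beta> * c0\<bar> \<le> e / 64"
        proof -
          have "\<bar>\<beta> * c0\<bar> \<le> (N / \<rho>) * (\<rho> * e / (64 * N))" using \<beta>(1) c0 \<eta>(4) by (intro pr) auto
          also have "\<dots> = e / 64" using \<rho>(1) N by simp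
          finally show ?thesis .
        qed
        moreover have "2 * (a0 * (\<mu> * B)) + 1 * (\<mu> * B) \<le> e / 16" using \<mu>(3)
            by (simp add: algebra_simps)
        ultimately show ?thesis by linarith
      qed
      define k where "k = 1 - (1 - \<sigma> * e)\<^sup>2"
      have lo: "\<sigma> * k \<ge> e"
      proof -
        have "e * e \<le> e * 1" using e by (intro mult_left_mono) auto
        then show ?thesis using \<sigma> e unfolding k_def by (auto simp: power2_eq_square algebra_simps)
      qed
      have hi: "\<bar>Fop w x - k\<bar> \<le> e / 4 + e / 8"
      proof -
        have "f0 = 1 - (1 - \<sigma> * e)\<^sup>2 - (2 * (a * (c1 * A12 q)) + c1 * (c1 * A11 q) - 4 * (\<beta> * c0))"
          unfolding f0 aA[symmetric] by (simp add: power2_eq_square)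
        then show ?thesis using Ff small unfolding k_def by linarith
      qed
      show ?thesis using \<sigma>
      proof
        assume s: "\<sigma> = 1"
        show ?thesis using lo hi e(1) unfolding \<epsilon>_def s mult_1_left by linarith
      next
        assume s: "\<sigma> = -1"
        show ?thesis using lo hi e(1) unfolding \<epsilon>_def s mult_minus1 by linarith
      qed
    qed
    have taylor: "\<bar>V x t0 - c0 - c1 * (x $ 1 - q $ 1)\<bar> \<le> C * (x $ 1 - q $ 1)\<^sup>2"
      if "x \<in> cball q \<rho>" "x $ 2 = 0" for x
      unfolding c0_def c1_def using V_edge_taylor[OF q(1) cb _ that] t0T T by simp
    have edgeQ: "C * (x $ 1 - q $ 1)\<^sup>2 \<le> N / \<rho> * Q x" if "x $ 2 = 0" for x
    proof -
      have "C \<le> 1 / \<rho>" using \<rho>C \<rho>(1) by (simp add: field_simps)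
      also have "\<dots> \<le> (N * lam) / \<rho>" using Nlam a0 rough(1) \<rho>(1) by (intro divide_right_mono) auto
      finally have "C * (x $ 1 - q $ 1)\<^sup>2 \<le> (N * lam) / \<rho> * (x $ 1 - q $ 1)\<^sup>2"
          by (intro mult_right_mono) auto
      also have "\<dots> = N / \<rho> * (lam * (dist x q)\<^sup>2)"
        unfolding dist_edge[OF q(1)] using that by (simp add: power2_eq_square)
      also have "\<dots> \<le> N / \<rho> * Q x" using Q_ge[of x] N \<rho>(1) by (intro mult_left_mono) auto
      finally show ?thesis .
    qed
    have lateral: "N / \<rho> * Q x \<ge> (3 + a0 + 2 * \<Lambda>) * \<rho>" if "dist x q = \<rho>" for x
    proof -
      have "N / \<rho> * (lam * (dist x q)\<^sup>2) \<le> N / \<rho> * Q x" using Q_ge[of x] N \<rho>(1)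
          by (intro mult_left_mono) auto
      moreover have "N / \<rho> * (lam * (dist x q)\<^sup>2) = (N * lam) * \<rho>"
        using that \<rho>(1) by (simp add: power2_eq_square)
      ultimately show ?thesis unfolding Nlam by simp
    qed
    have c1s': "\<bar>c1 * (x $ 1 - q $ 1)\<bar> \<le> \<rho>" if "x \<in> cball q \<rho>" for x
      using pr[of c1 1 "x $ 1 - q $ 1" \<rho>] c1 \<mu>(2) xy(1)[OF that] by simp
    have ay: "0 \<le> a * x $ 2" "a * x $ 2 \<le> a0 * \<rho>" if "x \<in> cball q \<rho>" "x $ 2 \<ge> 0" for x
      using a that xy(2)[OF that(1)] by (auto intro!: mult_mono)
    have w_pos: "w x \<ge> c0 / 2" if \<sigma>1: "\<sigma> = -1" and x: "x \<in> cball q \<rho>" "x $ 2 \<ge> 0" for x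
    proof -
      define s where "s = x $ 1 - q $ 1"
      have "\<bar>c1\<bar> * \<bar>s\<bar> \<le> c0 / 2 + C * s\<^sup>2 / 2"
      proof -
        have "(\<bar>c1\<bar> * \<bar>s\<bar>)\<^sup>2 \<le> C * c0 * s\<^sup>2"
          using mult_right_mono[OF c1s, of "s\<^sup>2"] by (simp add: power_mult_distrib)
        also have "\<dots> \<le> (c0 / 2 + C * s\<^sup>2 / 2)\<^sup>2"
          using zero_le_power2[of "c0 / 2 - C * s\<^sup>2 / 2"] by (simp add: power2_eq_square
              algebra_simps)
        finally show ?thesis by (rule power2_le_imp_le) (use c0 C in auto)
      qed
      moreover have "C * s\<^sup>2 \<le> N / \<rho> * Q x"
      proof -
        have "C * s\<^sup>2 \<le> (N * lam) / \<rho> * s\<^sup>2"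
        proof (rule mult_right_mono)
          have "C \<le> 1 / \<rho>" using \<rho>C \<rho>(1) by (simp add: field_simps)
          also have "\<dots> \<le> (N * lam) / \<rho>" using Nlam a0 rough(1) \<rho>(1) by (intro divide_right_mono)
              auto
          finally show "C \<le> (N * lam) / \<rho>" .
        qed auto
        also have "\<dots> = N / \<rho> * (lam * s\<^sup>2)" by simp
        also have "\<dots> \<le> N / \<rho> * (lam * (dist x q)\<^sup>2)"
          unfolding dist_edge[OF q(1)] s_def using N lam \<rho>(1)
          by (intro mult_left_mono) (auto simp: power2_eq_square)
        also have "\<dots> \<le> N / \<rho> * Q x" using Q_ge[of x] N \<rho>(1) by (intro mult_left_mono) auto
        finally show ?thesis .
      qed
      moreover have "0 \<le> C * s\<^sup>2" using C by simp
      moreover have "- (\<bar>c1\<bar> * \<bar>s\<bar>) \<le> c1 * s" by (metis abs_ge_minus_self abs_mult minus_le_iff)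
      moreover have "w x = c0 + c1 * s + a * x $ 2 + N / \<rho> * Q x" by (simp add: w_alt \<beta>_def \<sigma>1
          s_def)
      ultimately show ?thesis using ay(1)[OF x] by linarith
    qed
    have cmp: "\<sigma> * (V x t0 - w x) \<ge> 0" if x: "x \<in> cball q \<rho>" "x $ 2 \<ge> 0" for x
    proof (rule comparison[where \<epsilon> = \<epsilon> and q = q and \<rho> = \<rho> and T = T and w = w, OF \<sigma> \<epsilon> qK' Tpos
        t0T(1)])
      show "Ck_on 2 UNIV U w" if "open_hp U" for U unfolding w_def by (rule quad_Ck[OF that])
      show "continuous_on UNIV w" unfolding w_def by (rule quad_continuous)
      show "\<sigma> * Fop w x \<ge> 2 * \<epsilon>" if "x \<in> cball q \<rho>" "x $ 2 > 0" for x by (rule F[OF that])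
      show "w x > 0" if "\<sigma> = -1" "x \<in> cball q \<rho>" "x $ 2 \<ge> 0" for x using w_pos[OF that] c0 by simp
      show "\<sigma> * (V x t - exp (\<sigma> * \<epsilon> * (t - t0)) * w x) \<ge> 0"
        if x: "x \<in> cball q \<rho>" "x $ 2 \<ge> 0" "T \<le> t" "t \<le> t0" and or: "t = T \<or> x $ 2 = 0 \<or> dist x q =
            \<rho>" for x t
      proof -
        have xK: "x \<in> cball p0 R \<inter> half_plane" using sub[OF x(1)] x(2) by (simp add: dist_commute)
        have X1: "X \<le> \<epsilon> / 2 * (t0 - T)"
        proof -
          have "\<epsilon> / 2 * Y \<le> \<epsilon> / 2 * (t0 - T)" using t0 \<epsilon> by (intro mult_left_mono) auto
          then show ?thesis using Y(2) by simp
        qed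
        have Vx: "V x t > 0" by (rule V_pos)
        show ?thesis using \<sigma>
        proof
          assume s1: "\<sigma> = 1"
          define E where "E = exp (\<epsilon> * (t - t0))"
          have E: "0 < E" "E \<le> 1" using x(4) \<epsilon>(1) by (auto simp: E_def mult_nonneg_nonpos)
          have "E * w x \<le> V x t"
            using or
          proof (elim disjE)
            assume t: "t = T"
            have "W * \<rho> \<le> X * v" by (rule X)
            also have "\<dots> \<le> exp (\<epsilon> * (t0 - T)) * v"
            proof (rule mult_right_mono)
              have "X \<le> \<epsilon> * (t0 - T)" using X1 X(1) by simp
              also have "\<dots> \<le> exp (\<epsilon> * (t0 - T))" using exp_ge_add_one_self[of "\<epsilon> * (t0 - T)"]
                  by linarith
              finally show "X \<le> exp (\<epsilon> * (t0 - T))" .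
            qed (use v in auto)
            finally have "w x \<le> exp (\<epsilon> * (t0 - T)) * v" using w_bound[OF x(1)] by simp
            then have "E * w x \<le> E * (exp (\<epsilon> * (t0 - T)) * v)" using E by (intro mult_left_mono)
                auto
            also have "\<dots> = exp (\<epsilon> * (t - t0) + \<epsilon> * (t0 - T)) * v" by (simp add: E_def exp_add)
            also have "\<dots> = v" by (simp add: t algebra_simps)
            finally show ?thesis using v(2)[of x] xK t by (simp add: K_def)
          next
            assume ed: "x $ 2 = 0"
            have "w x \<le> V x t0"
              using taylor[OF x(1) ed] edgeQ[OF ed] by (simp add: w_alt \<beta>_def s1 ed)
            also have "\<dots> \<le> V x t" using edge_mono[of x t t0] xK ed x T by simp
            finally have wV: "w x \<le> V x t" .
            show ?thesis
            proof (cases "w x \<ge> 0")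
              case True
              then have "E * w x \<le> 1 * w x" using E by (intro mult_right_mono) auto
              then show ?thesis using wV by simp
            next
              case False
              then have "E * w x \<le> 0" using E by (simp add: mult_nonneg_nonpos)
              then show ?thesis using Vx by simp
            qed
          next
            assume l: "dist x q = \<rho>"
            have "w x = c0 + c1 * (x $ 1 - q $ 1) + a * x $ 2 - N / \<rho> * Q x"
                by (simp add: w_alt \<beta>_def s1)
            moreover have "(3 + a0 + 2 * \<Lambda>) * \<rho> = 3 * \<rho> + a0 * \<rho> + 2 * (\<Lambda> * \<rho>)"
                by (simp add: algebra_simps)
            moreover have "\<Lambda> * \<rho> \<ge> 0" using rough(1) \<rho>(1) by simp
            ultimately have "w x \<le> 0"
              using lateral[OF l] c1s'[OF x(1)] ay(2)[OF x(1,2)] c0 \<eta>(2) \<rho>(1) by linarith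
            then have "E * w x \<le> 0" using E by (simp add: mult_nonneg_nonpos)
            then show ?thesis using Vx by simp
          qed
          then show ?thesis by (simp add: s1 E_def)
        next
          assume s1: "\<sigma> = -1"
          define E where "E = exp (\<epsilon> * (t0 - t))"
          have E: "1 \<le> E" using x(4) \<epsilon>(1) by (auto simp: E_def)
          have wp: "w x \<ge> c0 / 2" by (rule w_pos[OF s1 x(1,2)])
          have w0: "w x \<ge> 0" using wp c0 by simp
          have wE: "w x \<le> E * w x" using E w0 by (simp add: mult_le_cancel_right1)
          have "V x t \<le> E * w x"
            using or
          proof (elim disjE)
            assume t: "t = T"
            have "v \<le> V q T" using v(2)[OF qK] .
            also have "\<dots> \<le> exp (\<epsilon> / 2 * (t0 - T)) * c0"
              unfolding c0_def using T1[OF qR q(1) T(2) t0T(1)] .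
            finally have vc: "v \<le> exp (\<epsilon> / 2 * (t0 - T)) * c0" .
            have "2 * \<bar>M\<bar> \<le> X * v" by (rule X)
            also have "\<dots> \<le> exp (\<epsilon> / 2 * (t0 - T)) * (exp (\<epsilon> / 2 * (t0 - T)) * c0)"
            proof (rule mult_mono[OF _ vc])
              show "X \<le> exp (\<epsilon> / 2 * (t0 - T))"
                using exp_ge_add_one_self[of "\<epsilon> / 2 * (t0 - T)"] X1 by linarith
            qed (use v in auto)
            also have "\<dots> = E * c0"
              unfolding E_def t mult.assoc[symmetric] exp_add[symmetric] by (simp add: field_simps)
            finally have "\<bar>M\<bar> \<le> E * (c0 / 2)" by simp
            also have "\<dots> \<le> E * w x" using E wp by (intro mult_left_mono) auto
            finally have "\<bar>M\<bar> \<le> E * w x" .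
            then show ?thesis using V_le[OF xK, of t] T t by simp
          next
            assume ed: "x $ 2 = 0"
            have "V x t \<le> exp (\<epsilon> / 2 * (t0 - t)) * V x t0" using T1[of x t t0] xK ed x T by simp
            also have "\<dots> \<le> E * V x t0"
              unfolding E_def using x(4) \<epsilon>(1) V_pos[of x t0] by (intro mult_right_mono) auto
            also have "\<dots> \<le> E * w x"
            proof (rule mult_left_mono)
              show "V x t0 \<le> w x"
                using taylor[OF x(1) ed] edgeQ[OF ed] by (simp add: w_alt \<beta>_def s1 ed)
            qed (use E in auto)
            finally show ?thesis .
          next
            assume l: "dist x q = \<rho>"
            have "V x t \<le> \<rho> + 2 * \<Lambda> * x $ 2"
              using T3[of t x] x T sub'[OF x(1)] xy(2)[OF x(1)] \<rho>(3) by auto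
            also have "\<dots> \<le> \<rho> + 2 * \<Lambda> * \<rho>"
              using xy(2)[OF x(1)] rough(1) by (intro add_left_mono mult_left_mono) auto
            also have "\<dots> \<le> w x"
            proof -
              have "w x = c0 + c1 * (x $ 1 - q $ 1) + a * x $ 2 + N / \<rho> * Q x"
                  by (simp add: w_alt \<beta>_def s1)
              moreover have "(3 + a0 + 2 * \<Lambda>) * \<rho> = 3 * \<rho> + a0 * \<rho> + 2 * \<Lambda> * \<rho>"
                  by (simp add: algebra_simps)
              moreover have "a0 * \<rho> \<ge> 0" using a0 \<rho>(1) by simp
              ultimately show ?thesis
                using lateral[OF l] c1s'[OF x(1)] ay(1)[OF x(1,2)] c0 \<rho>(1) by linarith
            qed
            finally show ?thesis using wE by simp
          qed
          moreover have "\<sigma> * \<epsilon> * (t - t0) = \<epsilon> * (t0 - t)" by (simp add: s1 algebra_simps)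
          ultimately show ?thesis by (simp add: s1 E_def)
        qed
      qed
    qed (use x in auto)
    have q\<Omega>: "q \<in> \<Omega>" using qK \<Omega>(2) by (auto simp: K_def)
    have "has_pdv 2 (\<lambda>x. \<sigma> * (V x t0 - w x)) (\<sigma> * (pd 2 (\<lambda>p. V p t0) q - a)) q"
    proof -
      have "has_pdv 2 w (quad a (2 * (\<beta> * g12)) (2 * (\<beta> * g22)) 0 0 0 (q $ 1) q) q"
        unfolding w_def by (rule quad_pdv)
      moreover have "quad a (2 * (\<beta> * g12)) (2 * (\<beta> * g22)) 0 0 0 (q $ 1) q = a"
        by (simp add: quad_def q)
      ultimately show ?thesis
        by (intro has_pdv_cmult has_pdv_diff Ck_on_2_pdv[OF V_C2[OF t0T(2)] q\<Omega>]) simp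
    qed
    from pdv_2_nonneg[OF this q(1) _ \<rho>(1) cmp]
    have "\<sigma> * (pd 2 (\<lambda>p. V p t0) q - a) \<ge> 0"
      using q by (simp add: w_alt c0_def Q_def)
    then have "0 \<le> r * (\<sigma> * (pd 2 (\<lambda>p. V p t0) q - a))" using r(1) by simp
    also have "\<dots> = \<sigma> * (r * pd 2 (\<lambda>p. V p t0) q - r * a)" by (simp add: algebra_simps)
    finally show ?thesis unfolding ra unfolding r_def .
  qed
  show ?thesis by (rule exI[of _ "T + Y"]) (use main in blast)
qed

end

section \<open>Compositions with functions of one variable\<close>

lemma Ck_on_2_chain:
  assumes W: "open_hp W" and s: "Ck_on 2 UNIV W s"
    and F: "\<And>x. (F has_real_derivative F' x) (at x)" "\<And>x. (F' has_real_derivative F'' x) (at x)"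
    and F'': "continuous_on UNIV F''"
  shows "Ck_on 2 UNIV W (\<lambda>p. F (s p))"
    and "\<And>p i. p \<in> W \<Longrightarrow> pd i (\<lambda>p. F (s p)) p = F' (s p) * pd i s p"
    and "\<And>p i j. p \<in> W \<Longrightarrow> pd i (pd j (\<lambda>p. F (s p))) p = F'' (s p) * pd i s p * pd j s p +
        F' (s p) * pd i (pd j s) p"
proof -
  have cF: "continuous_on UNIV F" "continuous_on UNIV F'"
    by (rule continuous_at_imp_continuous_on, intro ballI, rule DERIV_isCont, rule F)+
  have cs: "continuous_on W s" "\<And>i. continuous_on W (pd i s)" "\<And>i j. continuous_on W (pd i (pd j
      s))"
    using s by (auto simp: Ck_on_2 Ck_on_1)
  have cFs: "continuous_on W (\<lambda>p. F (s p))" "continuous_on W (\<lambda>p. F' (s p))" "continuous_on W (\<lambda>p.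
      F'' (s p))"
    using continuous_on_compose2[OF cF(1) cs(1)] continuous_on_compose2[OF cF(2) cs(1)]
      continuous_on_compose2[OF F'' cs(1)] by auto
  have H: "p \<in> half_plane" if "p \<in> W" for p using that open_hp_subset[OF W] by auto
  have d1: "has_pdv i (\<lambda>p. F (s p)) (F' (s p) * pd i s p) p" if "p \<in> W" for i p
    by (rule has_pdv_chain_real[OF F(1) Ck_on_2_pdv[OF s that]])
  have d2: "has_pdv i (\<lambda>p. F' (s p) * pd j s p) (F' (s p) * pd i (pd j s) p + F'' (s p) * pd i s p
      * pd j s p) p"
    if "p \<in> W" for i j p
    by (intro has_pdv_mult has_pdv_chain_real[OF F(2) Ck_on_2_pdv[OF s that]] Ck_on_2_pdv2[OF s
        that])
  have C1: "Ck_on (Suc 0) UNIV W (\<lambda>p. F' (s p) * pd j s p)" for j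
    by (rule Ck_on_SucI[where D = "\<lambda>i p. F' (s p) * pd i (pd j s) p + F'' (s p) * pd i s p * pd j
        s p", OF W _ d2])
       (auto intro!: continuous_intros cs cFs)
  show "Ck_on 2 UNIV W (\<lambda>p. F (s p))"
    unfolding numeral_2_eq_2 by (rule Ck_on_SucI[OF W cFs(1) d1 C1])
  show p1: "pd i (\<lambda>p. F (s p)) p = F' (s p) * pd i s p" if "p \<in> W" for p i
    by (rule has_pdv_imp(2)[OF d1[OF that] H[OF that]])
  show "pd i (pd j (\<lambda>p. F (s p))) p = F'' (s p) * pd i s p * pd j s p + F' (s p) * pd i (pd j s) p"
    if "p \<in> W" for p i j
  proof -
    have "has_pdv i (pd j (\<lambda>p. F (s p))) (F' (s p) * pd i (pd j s) p + F'' (s p) * pd i s p * pd j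
        s p) p"
      by (rule has_pdv_cong[OF W that, THEN iffD1, rotated, OF d2[OF that]]) (simp add: p1)
    from has_pdv_imp(2)[OF this H[OF that]] show ?thesis by simp
  qed
qed

lemma coord_laplacian_chain:
  assumes "open_hp W" "Ck_on 2 UNIV W s"
    and "\<And>x. (F has_real_derivative F' x) (at x)" "\<And>x. (F' has_real_derivative F'' x) (at x)"
    and "continuous_on UNIV F''" and p: "p \<in> W"
  shows "coord_laplacian G (\<lambda>p. F (s p)) p =
    F'' (s p) * (\<Sum>i\<in>UNIV. \<Sum>j\<in>UNIV. matrix_inv (G p) $ i $ j * pd i s p * pd j s p)
      + F' (s p) * coord_laplacian G s p"
  unfolding coord_laplacian_def Ck_on_2_chain(2,3)[OF assms] sum_2 by (simp add: algebra_simps)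

lemma DERIV_max_power:
  "((\<lambda>x::real. max 0 x ^ Suc (Suc n)) has_real_derivative real (Suc (Suc n)) * max 0 x ^ Suc n)
      (at x)"
proof -
  consider "x > 0" | "x < 0" | "x = 0" by linarith
  then show ?thesis
  proof cases
    case 1
    have "((\<lambda>x. x ^ Suc (Suc n)) has_real_derivative real (Suc (Suc n)) * x ^ Suc n) (at x)"
      using DERIV_pow[of "Suc (Suc n)" x] by simp
    then have "((\<lambda>x. max 0 x ^ Suc (Suc n)) has_real_derivative real (Suc (Suc n)) * x ^ Suc n)
        (at x)"
      by (rule DERIV_cong_ev[THEN iffD1, OF refl _ refl, rotated])
         (use 1 eventually_nhds_in_open[of "{0<..}" x] in \<open>auto elim!: eventually_mono simp:
             max_def\<close>)
    then show ?thesis using 1 by (simp add: max_def)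
  next
    case 2
    have "((\<lambda>x::real. 0) has_real_derivative 0) (at x)" by simp
    then have "((\<lambda>x. max 0 x ^ Suc (Suc n)) has_real_derivative 0) (at x)"
      by (rule DERIV_cong_ev[THEN iffD1, OF refl _ refl, rotated])
         (use 2 eventually_nhds_in_open[of "{..<0}" x] in \<open>auto elim!: eventually_mono simp:
             max_def\<close>)
    then show ?thesis using 2 by (simp add: max_def)
  next
    case 3
    have "((\<lambda>h::real. max 0 h ^ Suc (Suc n) / h) \<longlongrightarrow> 0) (at 0)"
    proof (rule Lim_null_comparison)
      show "\<forall>\<^sub>F h::real in at 0. norm (max 0 h ^ Suc (Suc n) / h) \<le> \<bar>h\<bar> ^ Suc n"
      proof (rule always_eventually, rule allI)
        show "norm (max 0 h ^ Suc (Suc n) / h) \<le> \<bar>h\<bar> ^ Suc n" for h :: real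
        proof (cases "h > 0")
          case False
          then have "max 0 h = 0" by simp
          then show ?thesis by (simp only: power_0_Suc div_0 norm_zero zero_le_power abs_ge_zero)
        qed simp
      qed
      show "((\<lambda>h::real. \<bar>h\<bar> ^ Suc n) \<longlongrightarrow> 0) (at 0)"
        by (rule tendsto_eq_intros refl tendsto_rabs tendsto_ident_at | simp)+
    qed
    then show ?thesis using 3 by (simp add: DERIV_def)
  qed
qed

section \<open>Functions on the surface\<close>

context riemannian_surface begin

lemma chart_preimage_open:
  assumes c: "c \<in> atlas S" and V: "open_hp V" "V \<subseteq> chart_image c"
  shows "openin (top_of S) {y \<in> fst c. snd c y \<in> V}"
proof -
  have "openin (top_of_set (chart_image c)) V"
    using V openin_subset_trans open_hp_subset[OF chart_image_open[OF c]] by blast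
  then have "openin (subtopology (top_of S) (fst c)) {y \<in> topspace (subtopology (top_of S) (fst
      c)). snd c y \<in> V}"
    by (rule openin_continuous_map_preimage[OF homeomorphic_imp_continuous_map[OF chart_homeo[OF
        c]]])
  then show ?thesis
    unfolding chart_topspace[OF c] using openin_trans_full chart_open[OF c] by blast
qed

lemma local_to_global:
  fixes P :: "'a \<Rightarrow> real \<Rightarrow> bool"
  assumes mono: "\<And>y a b. P y a \<Longrightarrow> a \<le> b \<Longrightarrow> P y b"
    and loc: "\<And>x. x \<in> topspace (top_of S) \<Longrightarrow> \<exists>U a. openin (top_of S) U \<and> x \<in> U \<and> (\<forall>y\<in>U. P y a)"
  shows "\<exists>a. \<forall>y\<in>topspace (top_of S). P y a"
proof -
  from loc obtain U a where Ua: "\<And>x. x \<in> topspace (top_of S) \<Longrightarrow> openin (top_of S) (U x)"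
    "\<And>x. x \<in> topspace (top_of S) \<Longrightarrow> x \<in> U x" "\<And>x y. x \<in> topspace (top_of S) \<Longrightarrow> y \<in> U x \<Longrightarrow> P y (a x)"
    by metis
  have "\<exists>\<F>. finite \<F> \<and> \<F> \<subseteq> U ` topspace (top_of S) \<and> topspace (top_of S) \<subseteq> \<Union>\<F>"
    by (rule compactinD) (use compact_S Ua(1,2) in \<open>auto simp: compact_space_def\<close>)
  then obtain \<F> where F: "finite \<F>" "\<F> \<subseteq> U ` topspace (top_of S)" "topspace (top_of S) \<subseteq> \<Union>\<F>"
      by blast
  obtain X where X: "X \<subseteq> topspace (top_of S)" "finite X" "\<F> = U ` X"
    using finite_subset_image[OF F(1,2)] by blast
  have "P y (Max (a ` X))" if y: "y \<in> topspace (top_of S)" for y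
  proof -
    obtain x where x: "x \<in> X" "y \<in> U x" using F(3) X y by blast
    have "a x \<le> Max (a ` X)" using x X by (intro Max_ge) auto
    then show ?thesis using mono Ua(3)[OF _ x(2)] x X by blast
  qed
  then show ?thesis by blast
qed

lemma chart_cball:
  assumes V: "open_hp V" "p \<in> V"
  obtains r where "r > 0" "cball p r \<inter> half_plane \<subseteq> V"
proof -
  obtain T where T: "open T" "V = half_plane \<inter> T" using V(1) by (auto simp: openin_open)
  then obtain r where "r > 0" "cball p r \<subseteq> T" using V(2) by (meson IntD2 open_contains_cball)
  then show ?thesis using that[of r] T by auto
qed

lemma open_half_ball: "open_hp (ball p r \<inter> half_plane)"
  by (auto simp: openin_open)

lemma chart_ball_nbhd:
  assumes x: "x \<in> topspace (top_of S)"
  obtains c r where "c \<in> atlas S" "x \<in> fst c" "r > 0" "cball (snd c x) r \<inter> half_plane \<subseteq>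
      chart_image c"
    "openin (top_of S) {y \<in> fst c. snd c y \<in> ball (snd c x) r \<inter> half_plane}"
    "x \<in> {y \<in> fst c. snd c y \<in> ball (snd c x) r \<inter> half_plane}"
proof -
  note c = chart_at[OF x]
  obtain r where r: "r > 0" "cball (snd (chart_at S x) x) r \<inter> half_plane \<subseteq> chart_image (chart_at S
      x)"
    using chart_cball[OF chart_image_open[OF c(1)] snd_in_image[OF c(2)]] .
  have "x \<in> {y \<in> fst (chart_at S x). snd (chart_at S x) y \<in> ball (snd (chart_at S x) x) r \<inter>
      half_plane}"
    using c r chart_image_half_plane[OF c(1) snd_in_image[OF c(2)]] by simp
  moreover have "ball (snd (chart_at S x) x) r \<inter> half_plane \<subseteq> chart_image (chart_at S x)"
    using r(2) ball_subset_cball by blast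
  ultimately show ?thesis
    using that[OF c r] chart_preimage_open[OF c(1) open_half_ball] by blast
qed

lemma continuous_map_local:
  fixes f :: "'a \<Rightarrow> real"
  assumes "\<And>x. x \<in> topspace (top_of S) \<Longrightarrow> \<exists>c\<in>atlas S. x \<in> fst c \<and> (\<exists>V g. open_hp V \<and>
      V \<subseteq> chart_image c \<and>
     snd c x \<in> V \<and> continuous_on V g \<and> (\<forall>y\<in>fst c. snd c y \<in> V \<longrightarrow> f y = g (snd c y)))"
  shows "continuous_map (top_of S) euclideanreal f"
proof -
  have "openin (top_of S) {x \<in> topspace (top_of S). f x \<in> U}" if U: "open U" for U
  proof (subst openin_subopen, safe)
    fix x assume x: "x \<in> topspace (top_of S)" "f x \<in> U"
    obtain c V g where c: "c \<in> atlas S" "x \<in> fst c" and V: "open_hp V" "V \<subseteq> chart_image c" "snd c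
        x \<in> V"
      "continuous_on V g" and g: "\<And>y. y \<in> fst c \<Longrightarrow> snd c y \<in> V \<Longrightarrow> f y = g (snd c y)"
      using assms[OF x(1)] by metis
    have "openin (top_of_set V) (V \<inter> g -` U)"
      by (rule continuous_openin_preimage_gen[OF V(4) U])
    then have W: "open_hp (V \<inter> g -` U)" using V(1) openin_trans by blast
    have "openin (top_of S) {y \<in> fst c. snd c y \<in> V \<inter> g -` U}"
      by (rule chart_preimage_open[OF c(1) W]) (use V in auto)
    moreover have "x \<in> {y \<in> fst c. snd c y \<in> V \<inter> g -` U}" using c V x g by auto
    moreover have "{y \<in> fst c. snd c y \<in> V \<inter> g -` U} \<subseteq> {x \<in> topspace (top_of S). f x \<in> U}"
      using g chart_subset[OF c(1)] by auto
    ultimately show "\<exists>T. openin (top_of S) T \<and> x \<in> T \<and> T \<subseteq> {x \<in> topspace (top_of S). f x \<in> U}"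
        by blast
  qed
  then show ?thesis
    unfolding continuous_map_def by (simp flip: open_openin)
qed

lemma compactin_attains_inf:
  fixes f :: "'a \<Rightarrow> real"
  assumes "compactin (top_of S) Z" "Z \<noteq> {}" "continuous_map (top_of S) euclideanreal f"
  shows "\<exists>x\<in>Z. \<forall>y\<in>Z. f x \<le> f y"
proof -
  have "compact (f ` Z)"
    using image_compactin[OF assms(1,3)] by simp
  from compact_attains_inf[OF this] show ?thesis using assms(2) by auto
qed

lemma continuous_inverse_metric:
  assumes c: "c \<in> atlas S"
  shows "continuous_on (chart_image c) (\<lambda>p. matrix_inv (metric S c p) $ i $ j)"
proof -
  have G: "continuous_on (chart_image c) (\<lambda>p. metric S c p $ i $ j)" for i j
    using Ck_on_continuous[OF metric_smooth[OF c]] .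
  have D: "continuous_on (chart_image c) (\<lambda>p. det (metric S c p))"
    unfolding det_2 by (intro continuous_intros G)
  have nz: "det (metric S c p) \<noteq> 0" if "p \<in> chart_image c" for p
    using matrix_inv_2(6)[OF metric_pos[OF c that]] by simp
  have q: "continuous_on (chart_image c) (\<lambda>p. s * metric S c p $ i $ j / det (metric S c p))"
      for s i j
    using nz by (intro continuous_intros G D) auto
  have e: "matrix_inv (metric S c p) $ 1 $ 1 = 1 * metric S c p $ 2 $ 2 / det (metric S c p)"
    "matrix_inv (metric S c p) $ 1 $ 2 = -1 * metric S c p $ 1 $ 2 / det (metric S c p)"
    "matrix_inv (metric S c p) $ 2 $ 1 = -1 * metric S c p $ 1 $ 2 / det (metric S c p)"
    "matrix_inv (metric S c p) $ 2 $ 2 = 1 * metric S c p $ 1 $ 1 / det (metric S c p)"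
    if "p \<in> chart_image c" for p
    using matrix_inv_2[OF metric_pos[OF c that]] by simp_all
  show ?thesis
    using exhaust_2[of i] exhaust_2[of j]
    by (elim disjE; simp only: e q cong: continuous_on_cong)
qed

lemma continuous_christoffel:
  assumes c: "c \<in> atlas S"
  shows "continuous_on (chart_image c) (christoffel (metric S c) k i j)"
proof -
  have "continuous_on (chart_image c) (pd l (\<lambda>q. metric S c q $ i $ j))" for l i j
    using metric_smooth[OF c, of 1 i j] by (simp add: Ck_on_1)
  then show ?thesis
    unfolding christoffel_def[abs_def] sum_2
    by (intro continuous_intros continuous_inverse_metric[OF c]) auto
qed

lemma continuous_coord_laplacian:
  assumes c: "c \<in> atlas S" and V: "V \<subseteq> chart_image c" and f: "Ck_on 2 UNIV V f"
  shows "continuous_on V (coord_laplacian (metric S c) f)"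
proof -
  have "continuous_on V (pd i f)" "continuous_on V (pd i (pd j f))" for i j
    using f by (auto simp: Ck_on_2 Ck_on_1)
  then show ?thesis
    unfolding coord_laplacian_def[abs_def] sum_2
    by (intro continuous_intros continuous_on_subset[OF continuous_inverse_metric[OF c] V]
        continuous_on_subset[OF continuous_christoffel[OF c] V])
qed

lemma C2_near_eq:
  assumes "C2_near f x" "c \<in> atlas S" "x \<in> fst c"
  obtains V where "open_hp V" "V \<subseteq> chart_image c" "snd c x \<in> V" "Ck_on 2 UNIV V (coord_rep c f)"
    "\<And>y. y \<in> fst c \<Longrightarrow> snd c y \<in> V \<Longrightarrow>
       C2_near f y \<and> laplacian S f y = coord_laplacian (metric S c) (coord_rep c f) (snd c y)"
proof -
  obtain V where V: "open_hp V" "V \<subseteq> chart_image c" "snd c x \<in> V" "Ck_on 2 UNIV V (coord_rep c f)"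
    using C2_near_chart[OF assms] .
  have near: "C2_near f y" if "y \<in> fst c" "snd c y \<in> V" for y
    using V that assms(2) unfolding C2_near_def by blast
  show ?thesis
    by (rule that[OF V]) (use near laplacian_chart[OF near assms(2)] in blast)
qed

definition C2S :: "('a \<Rightarrow> real) \<Rightarrow> bool" where
  "C2S f \<longleftrightarrow> (\<forall>x\<in>topspace (top_of S). C2_near f x)"

lemma C2S_continuous:
  assumes "C2S f"
  shows "continuous_map (top_of S) euclideanreal f" "continuous_map (top_of S) euclideanreal
      (laplacian S f)"
proof -
  show "continuous_map (top_of S) euclideanreal f"
  proof (rule continuous_map_local)
    fix x assume x: "x \<in> topspace (top_of S)"
    note c = chart_at[OF x]
    obtain V where V: "open_hp V" "V \<subseteq> chart_image (chart_at S x)" "snd (chart_at S x) x \<in> V"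
      "Ck_on 2 UNIV V (coord_rep (chart_at S x) f)"
      using C2_near_chart[OF _ c] assms x unfolding C2S_def by metis
    have "f y = coord_rep (chart_at S x) f (snd (chart_at S x) y)" if "y \<in> fst (chart_at S x)" for y
      using that c by (simp add: coord_rep_def)
    then show "\<exists>c\<in>atlas S. x \<in> fst c \<and> (\<exists>V g. open_hp V \<and> V \<subseteq> chart_image c \<and>
     snd c x \<in> V \<and> continuous_on V g \<and> (\<forall>y\<in>fst c. snd c y \<in> V \<longrightarrow> f y = g (snd c y)))"
      using c V Ck_on_continuous[OF V(4)] by blast
  qed
  show "continuous_map (top_of S) euclideanreal (laplacian S f)"
  proof (rule continuous_map_local)
    fix x assume x: "x \<in> topspace (top_of S)"
    note c = chart_at[OF x]
    obtain V where V: "open_hp V" "V \<subseteq> chart_image (chart_at S x)" "snd (chart_at S x) x \<in> V"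
      "Ck_on 2 UNIV V (coord_rep (chart_at S x) f)" "\<And>y. y \<in> fst (chart_at S x) \<Longrightarrow> snd (chart_at S
          x) y \<in> V \<Longrightarrow>
       C2_near f y \<and> laplacian S f y = coord_laplacian (metric S (chart_at S x)) (coord_rep
           (chart_at S x) f) (snd (chart_at S x) y)"
      using C2_near_eq[OF _ c] assms x unfolding C2S_def by metis
    then show "\<exists>c\<in>atlas S. x \<in> fst c \<and> (\<exists>V g. open_hp V \<and> V \<subseteq> chart_image c \<and>
     snd c x \<in> V \<and> continuous_on V g \<and> (\<forall>y\<in>fst c. snd c y \<in> V \<longrightarrow> laplacian S f y = g (snd c y)))"
      using c continuous_coord_laplacian[OF c(1) V(2,4)] by blast
  qed
qed

lemma laplacian_linear:
  assumes x: "x \<in> topspace (top_of S)" and f: "C2_near f x" and g: "C2_near g x"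
  shows "C2_near (\<lambda>y. f y + a * g y) x"
    "laplacian S (\<lambda>y. f y + a * g y) x = laplacian S f x + a * laplacian S g x"
proof -
  note c = chart_at[OF x]
  let ?c = "chart_at S x"
  obtain V where V: "open_hp V" "V \<subseteq> chart_image ?c" "snd ?c x \<in> V" "Ck_on 2 UNIV V (coord_rep ?c
      f)"
    using C2_near_chart[OF f c] .
  obtain V' where V': "open_hp V'" "V' \<subseteq> chart_image ?c" "snd ?c x \<in> V'" "Ck_on 2 UNIV V'
      (coord_rep ?c g)"
    using C2_near_chart[OF g c] .
  define W where "W = V \<inter> V'"
  have W: "open_hp W" "W \<subseteq> chart_image ?c" "snd ?c x \<in> W" using V V'
      by (auto simp: W_def openin_Int)
  have fW: "Ck_on 2 UNIV W (coord_rep ?c f)" and gW: "Ck_on 2 UNIV W (coord_rep ?c g)"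
    using Ck_on_mono V(4) V'(4) by (auto simp: W_def)
  let ?h = "\<lambda>p. coord_rep ?c f p + a * coord_rep ?c g p"
  have h: "coord_rep ?c (\<lambda>y. f y + a * g y) = ?h" by (simp add: coord_rep_def fun_eq_iff)
  have "Ck_on 2 UNIV W ?h" by (intro Ck_on_add Ck_on_cmult W fW gW)
  then show n: "C2_near (\<lambda>y. f y + a * g y) x"     unfolding C2_near_def
    by (intro bexI[of _ ?c] conjI exI[of _ W]) (use c W h in simp_all)
  have H: "q \<in> half_plane" if "q \<in> W" for q using open_hp_subset[OF W(1)] that by auto
  have 1: "pd i ?h q = pd i (coord_rep ?c f) q + a * pd i (coord_rep ?c g) q" if "q \<in> W" for i q
    by (rule has_pdv_imp(2)[OF has_pdv_add[OF Ck_on_2_pdv[OF fW that] has_pdv_cmult[OF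
        Ck_on_2_pdv[OF gW that]]] H[OF that]])
  have 2: "pd i (pd j ?h) (snd ?c x) = pd i (pd j (coord_rep ?c f)) (snd ?c x) + a * pd i (pd j
      (coord_rep ?c g)) (snd ?c x)" for i j
  proof -
    have "has_pdv i (\<lambda>q. pd j (coord_rep ?c f) q + a * pd j (coord_rep ?c g) q)
       (pd i (pd j (coord_rep ?c f)) (snd ?c x) + a * pd i (pd j (coord_rep ?c g)) (snd ?c x))
           (snd ?c x)"
      by (intro has_pdv_add has_pdv_cmult Ck_on_2_pdv2[OF fW W(3)] Ck_on_2_pdv2[OF gW W(3)])
    then have "has_pdv i (pd j ?h)
       (pd i (pd j (coord_rep ?c f)) (snd ?c x) + a * pd i (pd j (coord_rep ?c g)) (snd ?c x))
           (snd ?c x)"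
      by (rule has_pdv_cong[OF W(1,3), THEN iffD1, rotated]) (simp add: 1)
    from has_pdv_imp(2)[OF this H[OF W(3)]] show ?thesis .
  qed
  show "laplacian S (\<lambda>y. f y + a * g y) x = laplacian S f x + a * laplacian S g x"
    unfolding laplacian_chart[OF n c] laplacian_chart[OF f c] laplacian_chart[OF g c] h
      coord_laplacian_def 1[OF W(3)] 2 sum_2 by (simp add: algebra_simps)
qed

lemma laplacian_at_min:
  assumes x: "x \<in> inner_part S" and f: "C2_near f x" and h: "C2_near h x"
    and U: "openin (top_of S) U" "x \<in> U" and m: "\<And>y. y \<in> U \<Longrightarrow> f x - h x \<le> f y - h y"
  shows "laplacian S h x \<le> laplacian S f x"
proof -
  have xt: "x \<in> topspace (top_of S)" using x by (simp add: inner_part_def)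
  note c = chart_at[OF xt]
  let ?c = "chart_at S x"
  let ?d = "\<lambda>y. f y + (-1) * h y"
  have n: "C2_near ?d x" by (rule laplacian_linear(1)[OF xt f h])
  obtain V where V: "open_hp V" "V \<subseteq> chart_image ?c" "snd ?c x \<in> V" "Ck_on 2 UNIV V (coord_rep ?c
      ?d)"
    using C2_near_chart[OF n c] .
  have "open_hp (snd ?c ` (U \<inter> fst ?c))"
    by (rule chart_image_openin[OF c(1)]) (auto intro: openin_Int U chart_open c)
  then have "open_hp (V \<inter> snd ?c ` (U \<inter> fst ?c))" using V(1) by (intro openin_Int)
  then obtain T where T: "open T" "V \<inter> snd ?c ` (U \<inter> fst ?c) = half_plane \<inter> T"
      by (auto simp: openin_open)
  define W where "W = T \<inter> {q. q $ 2 > 0}"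
  have W: "open W" "W \<subseteq> {q. q $ 2 > 0}" "W \<subseteq> V \<inter> snd ?c ` (U \<inter> fst ?c)"
  proof -
    show "open W" unfolding W_def by (intro open_Int T(1) open_Collect_less continuous_intros)
    show "W \<subseteq> {q. q $ 2 > 0}" by (simp add: W_def)
    have "W \<subseteq> half_plane \<inter> T" by (auto simp: W_def)
    then show "W \<subseteq> V \<inter> snd ?c ` (U \<inter> fst ?c)" unfolding T(2) .
  qed
  have "snd ?c x \<in> half_plane \<inter> T" unfolding T(2)[symmetric] using U V(3) c by blast
  then have xW: "snd ?c x \<in> W"
    using inner_chart[OF c] x by (simp add: W_def)
  have d2: "Ck_on 2 UNIV W (coord_rep ?c ?d)" using Ck_on_mono[OF V(4)] W(3) by auto
  have min: "coord_rep ?c ?d (snd ?c x) \<le> coord_rep ?c ?d q" if qW: "q \<in> W" for q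
  proof -
    obtain y where "y \<in> U" "y \<in> fst ?c" "q = snd ?c y" using subsetD[OF W(3) qW] by auto
    then show ?thesis using m[of y] c by (simp add: coord_rep_def)
  qed
  let ?A = "matrix_inv (metric S ?c (snd ?c x))"
  note A = matrix_inv_pos[OF metric_pos[OF c(1) snd_in_image[OF c(2)]]]
  have z: "pd i (coord_rep ?c ?d) (snd ?c x) = 0" for i
    by (rule second_derivative_test(1)[OF W(1,2) d2 xW min])
  have "0 \<le> ?A $ 1 $ 1 * pd 1 (pd 1 (coord_rep ?c ?d)) (snd ?c x) + ?A $ 1 $ 2 *
     (pd 1 (pd 2 (coord_rep ?c ?d)) (snd ?c x) + pd 2 (pd 1 (coord_rep ?c ?d)) (snd ?c x))
     + ?A $ 2 $ 2 * pd 2 (pd 2 (coord_rep ?c ?d)) (snd ?c x)"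
    by (rule elliptic_at_min[OF W(1,2) d2 xW min A(1) less_imp_le[OF A(4)]])
  then have "0 \<le> laplacian S ?d x"
    unfolding laplacian_chart[OF n c] coord_laplacian_def sum_2 z A(3) by (simp add: algebra_simps)
  then show ?thesis unfolding laplacian_linear(2)[OF xt f h] by simp
qed

end

section \<open>Subharmonic functions\<close>

definition bump :: "real \<Rightarrow> real \<Rightarrow> real" where
  "bump l x = max 0 x ^ 3 * exp (l * x)"

definition bump' :: "real \<Rightarrow> real \<Rightarrow> real" where
  "bump' l x = (3 * max 0 x ^ 2 + l * max 0 x ^ 3) * exp (l * x)"

definition bump'' :: "real \<Rightarrow> real \<Rightarrow> real" where
  "bump'' l x = (6 * max 0 x + 6 * l * max 0 x ^ 2 + l\<^sup>2 * max 0 x ^ 3) * exp (l * x)"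

lemma DERIV_max_3: "((\<lambda>x::real. max 0 x ^ 3) has_real_derivative 3 * max 0 x ^ 2) (at x)"
  using DERIV_max_power[of 1 x] by (simp add: numeral_eq_Suc)

lemma DERIV_max_2: "((\<lambda>x::real. max 0 x ^ 2) has_real_derivative 2 * max 0 x) (at x)"
  using DERIV_max_power[of 0 x] by (simp add: numeral_eq_Suc)

lemma bump_deriv: "(bump l has_real_derivative bump' l x) (at x)"
proof -
  have e: "((\<lambda>x. exp (l * x)) has_real_derivative l * exp (l * x)) (at x)"
    by (auto intro!: derivative_eq_intros)
  show ?thesis
    unfolding bump_def[abs_def] bump'_def
    by (rule DERIV_cong[OF DERIV_mult[OF DERIV_max_3 e]]) (simp add: algebra_simps)
qed

lemma bump'_deriv: "(bump' l has_real_derivative bump'' l x) (at x)"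
proof -
  have e: "((\<lambda>x. exp (l * x)) has_real_derivative l * exp (l * x)) (at x)"
    by (auto intro!: derivative_eq_intros)
  show ?thesis
    unfolding bump'_def[abs_def] bump''_def
    by (rule DERIV_cong[OF DERIV_mult[OF DERIV_add[OF DERIV_cmult[OF DERIV_max_2] DERIV_cmult[OF
        DERIV_max_3]] e]])
       (simp add: algebra_simps power2_eq_square)
qed

lemma bump''_continuous: "continuous_on UNIV (bump'' l)"
  unfolding bump''_def[abs_def] by (intro continuous_intros)

lemma bump_nonpos: "x \<le> 0 \<Longrightarrow> bump l x = 0" "x \<le> 0 \<Longrightarrow> bump' l x = 0" "x \<le> 0 \<Longrightarrow> bump'' l x = 0"
  by (simp_all add: bump_def bump'_def bump''_def max_def)

lemma bump_pos:
  assumes "x > 0" "l \<ge> 0"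
  shows "bump' l x > 0" "bump'' l x \<ge> l * bump' l x"
proof -
  have m: "max 0 x = x" using assms by simp
  show "bump' l x > 0" unfolding bump'_def m using assms by (intro mult_pos_pos add_pos_nonneg) auto
  have "l * (3 * x\<^sup>2 + l * x ^ 3) \<le> 6 * x + 6 * l * x\<^sup>2 + l\<^sup>2 * x ^ 3"
    using assms by (simp add: algebra_simps power2_eq_square)
  then have "l * (3 * x\<^sup>2 + l * x ^ 3) * exp (l * x) \<le> (6 * x + 6 * l * x\<^sup>2 + l\<^sup>2 * x ^ 3) * exp
      (l * x)"
    by (intro mult_right_mono) auto
  then show "bump'' l x \<ge> l * bump' l x" unfolding bump'_def bump''_def m by (simp add: mult.assoc)
qed

definition paraboloid :: "real^2 \<Rightarrow> real \<Rightarrow> real^2 \<Rightarrow> real" where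
  "paraboloid q r = quad (r\<^sup>2 - (q $ 2)\<^sup>2) 0 (2 * q $ 2) (-1) 0 (-1) (q $ 1)"

lemma paraboloid_eq: "paraboloid q r p = r\<^sup>2 - (dist p q)\<^sup>2"
  using norm_2_sq[of "p - q"]
  by (simp add: paraboloid_def quad_def dist_norm power2_eq_square algebra_simps)

lemma paraboloid_sign:
  assumes "r > 0"
  shows "paraboloid q r p > 0 \<longleftrightarrow> dist p q < r"
  using assms by (auto simp: paraboloid_eq power_strict_mono abs_le_square_iff intro:
      power2_less_imp_less)

context riemannian_surface begin

definition bump_fun :: "'a chart \<Rightarrow> real^2 \<Rightarrow> real \<Rightarrow> real \<Rightarrow> 'a \<Rightarrow> real" where
  "bump_fun c q r l y = (if y \<in> fst c then bump l (paraboloid q r (snd c y)) else 0)"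

lemma bump_fun_chart:
  assumes c: "c \<in> atlas S" and sub: "cball q r \<inter> half_plane \<subseteq> chart_image c" and r: "r > 0"
  shows "C2S (bump_fun c q r l)"
    and "\<And>y. y \<in> topspace (top_of S) \<Longrightarrow> \<not> (y \<in> fst c \<and> dist (snd c y) q < r) \<Longrightarrow> laplacian S
        (bump_fun c q r l) y = 0"
    and "\<And>y. y \<in> fst c \<Longrightarrow> laplacian S (bump_fun c q r l) y =
      bump'' l (paraboloid q r (snd c y)) * (\<Sum>i\<in>UNIV. \<Sum>j\<in>UNIV. matrix_inv (metric S c (snd c y)) $
          i $ j *
         pd i (paraboloid q r) (snd c y) * pd j (paraboloid q r) (snd c y))
      + bump' l (paraboloid q r (snd c y)) * coord_laplacian (metric S c) (paraboloid q r) (snd c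
          y)"
proof -
  let ?f = "bump_fun c q r l"
  have rep: "coord_rep c ?f p = bump l (paraboloid q r p)" if "p \<in> chart_image c" for p
    using that chart_inv_in[OF that] by (simp add: coord_rep_def bump_fun_def)
  have P2: "Ck_on 2 UNIV (chart_image c) (paraboloid q r)"
    unfolding paraboloid_def by (rule quad_Ck[OF chart_image_open[OF c]])
  have B2: "Ck_on 2 UNIV (chart_image c) (\<lambda>p. bump l (paraboloid q r p))"
    by (rule Ck_on_2_chain(1)[OF chart_image_open[OF c] P2 bump_deriv bump'_deriv
        bump''_continuous])
  then have f2: "Ck_on 2 UNIV (chart_image c) (coord_rep c ?f)"
    using Ck_on_cong[where f = "coord_rep c ?f", OF chart_image_open[OF c] rep] by blast
  have near1: "C2_near ?f y" if "y \<in> fst c" for y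
    unfolding C2_near_def
    by (intro bexI[of _ c] conjI exI[of _ "chart_image c"]) (use that c f2 chart_image_open[OF c]
        in simp_all)
  show l1: "laplacian S ?f y =
      bump'' l (paraboloid q r (snd c y)) * (\<Sum>i\<in>UNIV. \<Sum>j\<in>UNIV. matrix_inv (metric S c (snd c y)) $
          i $ j *
         pd i (paraboloid q r) (snd c y) * pd j (paraboloid q r) (snd c y))
      + bump' l (paraboloid q r (snd c y)) * coord_laplacian (metric S c) (paraboloid q r) (snd c
          y)"
    if y: "y \<in> fst c" for y
  proof -
    have "laplacian S ?f y = coord_laplacian (metric S c) (coord_rep c ?f) (snd c y)"
      by (rule laplacian_chart[OF near1[OF y] c y])
    also have "\<dots> = coord_laplacian (metric S c) (\<lambda>p. bump l (paraboloid q r p)) (snd c y)"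
      by (rule coord_laplacian_cong[OF chart_image_open[OF c] snd_in_image[OF y] f2 rep])
    also have "\<dots> = bump'' l (paraboloid q r (snd c y)) * (\<Sum>i\<in>UNIV. \<Sum>j\<in>UNIV. matrix_inv (metric S c
        (snd c y)) $ i $ j *
         pd i (paraboloid q r) (snd c y) * pd j (paraboloid q r) (snd c y))
      + bump' l (paraboloid q r (snd c y)) * coord_laplacian (metric S c) (paraboloid q r) (snd c
          y)"
      by (rule coord_laplacian_chain[OF chart_image_open[OF c] P2 bump_deriv bump'_deriv
          bump''_continuous
            snd_in_image[OF y]])
    finally show ?thesis .
  qed
  define Z where "Z = chart_inv c ` (cball q r \<inter> half_plane)"
  have "compactin (top_of S) Z"
  proof -
    have hi: "homeomorphic_map (subtopology (top_of S) (fst c)) (top_of_set (chart_image c)) (snd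
        c)"
      by (rule chart_homeo[OF c])
    then obtain g where g: "homeomorphic_maps (subtopology (top_of S) (fst c)) (top_of_set
        (chart_image c)) (snd c) g"
      by (auto simp: homeomorphic_map_maps)
    have gc: "g p = chart_inv c p" if "p \<in> chart_image c" for p
    proof -
      have "snd c (g p) = p" "g p \<in> fst c"
        using g that chart_topspace[OF c] unfolding homeomorphic_maps_def continuous_map_def by auto
      then show ?thesis using chart_inv[OF c] by metis
    qed
    have "compactin (top_of_set (chart_image c)) (cball q r \<inter> half_plane)"
      using sub compact_half_ball by (simp add: compactin_subtopology)
    then have "compactin (subtopology (top_of S) (fst c)) (g ` (cball q r \<inter> half_plane))"
      using g unfolding homeomorphic_maps_def by (blast intro: image_compactin)
    then have "compactin (top_of S) (g ` (cball q r \<inter> half_plane))"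
        by (simp add: compactin_subtopology)
    moreover have "g ` (cball q r \<inter> half_plane) = Z" unfolding Z_def using gc sub
        by (intro image_cong) auto
    ultimately show ?thesis by simp
  qed
  then have "closedin (top_of S) Z" using compactin_imp_closedin[OF Hausdorff_S] by blast
  then have oZ: "openin (top_of S) (topspace (top_of S) - Z)" by blast
  have zero: "?f y = 0" if "y \<notin> Z" for y
  proof (cases "y \<in> fst c")
    case True
    have "snd c y \<in> half_plane" using chart_image_half_plane[OF c snd_in_image[OF True]] by simp
    then have "dist (snd c y) q \<ge> r"
      using that True c unfolding Z_def by (metis Int_iff chart_inv dist_commute image_eqI
          le_less_linear less_imp_le mem_cball)
    then have "\<not> paraboloid q r (snd c y) > 0" using paraboloid_sign[OF r] by simp
    then show ?thesis by (simp add: bump_fun_def bump_nonpos)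
  qed (simp add: bump_fun_def)
  have out: "C2_near ?f y \<and> laplacian S ?f y = 0" if y: "y \<in> topspace (top_of S)" "y \<notin> Z" for y
  proof -
    note d = chart_at[OF y(1)]
    let ?d = "chart_at S y"
    define V where "V = snd ?d ` ((topspace (top_of S) - Z) \<inter> fst ?d)"
    have V: "open_hp V" "V \<subseteq> chart_image ?d" "snd ?d y \<in> V"
      unfolding V_def using y d
      by (auto intro!: chart_image_openin openin_Int oZ chart_open)
    have z: "coord_rep ?d ?f p = 0" if "p \<in> V" for p
      using that zero d by (auto simp: V_def coord_rep_def)
    have C2: "Ck_on 2 UNIV V (coord_rep ?d ?f)"
      using Ck_on_cong[where f = "coord_rep ?d ?f" and g = "\<lambda>p. 0", OF V(1) z] Ck_on_const[OF
          V(1)] by blast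
    have n: "C2_near ?f y" using d V C2 unfolding C2_near_def by blast
    have "laplacian S ?f y = coord_laplacian (metric S ?d) (\<lambda>p. 0) (snd ?d y)"
      unfolding laplacian_chart[OF n d] by (rule coord_laplacian_cong[OF V(1,3) C2 z])
    also have "\<dots> = 0"
    proof -
      have zq: "pd i (\<lambda>p. 0) p = 0" if "p \<in> half_plane" for i p
        by (rule has_pdv_imp(2)[OF has_pdv_const that])
      have H: "open_hp half_plane" by simp
      have pH: "snd ?d y \<in> half_plane" using V open_hp_subset by blast
      have "pd i (pd j (\<lambda>p. 0)) (snd ?d y) = 0" for i j
        by (rule has_pdv_imp(2)[OF _ pH])
           (rule has_pdv_cong[OF H pH, THEN iffD1, OF _ has_pdv_const[of i 0]], simp add: zq)
      then show ?thesis by (simp add: coord_laplacian_def zq[OF pH])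
    qed
    finally show ?thesis using n by simp
  qed
  show "C2S ?f" unfolding C2S_def
  proof
    fix y assume "y \<in> topspace (top_of S)"
    moreover have "Z \<subseteq> fst c" unfolding Z_def using chart_inv_in sub by blast
    ultimately show "C2_near ?f y" using out near1 by blast
  qed
  show "laplacian S ?f y = 0" if "y \<in> topspace (top_of S)" "\<not> (y \<in> fst c \<and> dist (snd c y) q < r)"
      for y
  proof (cases "y \<in> fst c")
    case True
    then have "\<not> paraboloid q r (snd c y) > 0" using paraboloid_sign[OF r] that by auto
    then show ?thesis unfolding l1[OF True] by (simp add: bump_nonpos)
  next
    case False
    moreover have "Z \<subseteq> fst c" unfolding Z_def using chart_inv_in sub by blast
    ultimately have "y \<notin> Z" by blast
    then show ?thesis using out that by blast
  qed
qed

lemma bump_fun_subharmonic: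
  assumes c: "c \<in> atlas S" and sub: "cball q r \<inter> half_plane \<subseteq> chart_image c" and r: "r > 0" "r0 > 0"
  shows "\<exists>l. \<forall>y\<in>fst c. r0 \<le> dist (snd c y) q \<longrightarrow> dist (snd c y) q < r \<longrightarrow> laplacian S (bump_fun c q r
      l) y > 0"
proof -
  let ?P = "paraboloid q r"
  let ?K = "cball q r \<inter> half_plane"
  define g where "g = (\<lambda>p. \<Sum>i\<in>UNIV. \<Sum>j\<in>UNIV. matrix_inv (metric S c p) $ i $ j * pd i ?P p * pd j
      ?P p)"
  have P2: "Ck_on 2 UNIV (chart_image c) ?P"
    unfolding paraboloid_def by (rule quad_Ck[OF chart_image_open[OF c]])
  have pd: "continuous_on (chart_image c) (pd i ?P)" for i using P2 by (auto simp: Ck_on_2 Ck_on_1)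
  have gc: "continuous_on (chart_image c) g"
    unfolding g_def sum_2 by (intro continuous_intros continuous_inverse_metric[OF c] pd)
  have Lc: "continuous_on (chart_image c) (coord_laplacian (metric S c) ?P)"
    by (rule continuous_coord_laplacian[OF c order_refl P2])
  have "bounded (coord_laplacian (metric S c) ?P ` ?K)"
    by (intro compact_imp_bounded compact_continuous_image compact_half_ball
        continuous_on_subset[OF Lc sub])
  then obtain C1 where "\<forall>p\<in>?K. \<bar>coord_laplacian (metric S c) ?P p\<bar> \<le> C1"
    unfolding bounded_iff by auto
  then have C1: "\<And>p. p \<in> ?K \<Longrightarrow> \<bar>coord_laplacian (metric S c) ?P p\<bar> \<le> C1" by blast
  have pdP: "pd 1 ?P p = - 2 * (p $ 1 - q $ 1)" "pd 2 ?P p = - 2 * (p $ 2 - q $ 2)"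
      if "p \<in> half_plane" for p
    unfolding paraboloid_def quad_pd[OF that] by (simp_all add: quad_def)
  have g_pos: "g p \<ge> 0 \<and> (p \<noteq> q \<longrightarrow> g p > 0)" if "p \<in> ?K" for p
  proof -
    have pc: "p \<in> chart_image c" "p \<in> half_plane" using that sub by auto
    note A = matrix_inv_pos[OF metric_pos[OF c pc(1)]]
    let ?a = "matrix_inv (metric S c p) $ 1 $ 1" and ?b = "matrix_inv (metric S c p) $ 1 $ 2"
      and ?d = "matrix_inv (metric S c p) $ 2 $ 2"
    define x where "x = pd 1 ?P p"
    define y where "y = pd 2 ?P p"
    have ge: "?a * g p = (?a * x + ?b * y)\<^sup>2 + (?a * ?d - ?b\<^sup>2) * y\<^sup>2"
      unfolding g_def sum_2 A(3) x_def[symmetric] y_def[symmetric] by (simp add: algebra_simps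
          power2_eq_square)
    have D: "?a * ?d - ?b\<^sup>2 > 0" using A(4) by simp
    have "?a * g p \<ge> 0" unfolding ge using D by simp
    then have 1: "g p \<ge> 0" using A(1) by (simp add: zero_le_mult_iff)
    have "g p \<noteq> 0" if "p \<noteq> q"
    proof
      assume "g p = 0"
      then have z: "(?a * x + ?b * y)\<^sup>2 + (?a * ?d - ?b\<^sup>2) * y\<^sup>2 = 0" using ge by simp
      have "(?a * ?d - ?b\<^sup>2) * y\<^sup>2 \<ge> 0" using D by simp
      then have "(?a * ?d - ?b\<^sup>2) * y\<^sup>2 = 0" "(?a * x + ?b * y)\<^sup>2 = 0"
        using z zero_le_power2[of "?a * x + ?b * y"] by linarith+
      then have "y = 0" "x = 0" using D A(1) by auto
      then show False using that pdP[OF pc(2)] by (auto simp: x_def y_def vec_eq_2)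
    qed
    then show ?thesis using 1 by auto
  qed
  define K' where "K' = ?K \<inter> {p. r0 \<le> dist p q}"
  have K': "compact K'"
    unfolding K'_def by (intro compact_Int_closed compact_half_ball closed_Collect_le
        continuous_intros)
  obtain c2 where c2: "c2 > 0" "\<And>p. p \<in> K' \<Longrightarrow> g p \<ge> c2"
  proof (cases "K' = {}")
    case False
    have "continuous_on K' g" by (rule continuous_on_subset[OF gc]) (use sub in \<open>auto simp: K'_def\<close>)
    from continuous_attains_inf[OF K' False this] obtain z where z: "z \<in> K'" "\<forall>p\<in>K'. g z \<le> g p"
        by blast
    have "z \<noteq> q" using z r(2) by (auto simp: K'_def)
    then have "g z > 0" using g_pos[of z] z by (auto simp: K'_def)
    then show ?thesis using that[of "g z"] z by auto
  qed (use that[of 1] in auto)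
  define l where "l = (\<bar>C1\<bar> + 1) / c2"
  have l: "l \<ge> 0" "l * c2 = \<bar>C1\<bar> + 1" using c2 by (auto simp: l_def)
  show ?thesis
  proof (rule exI[of _ l], intro ballI impI)
    fix y assume y: "y \<in> fst c" and d: "r0 \<le> dist (snd c y) q" "dist (snd c y) q < r"
    let ?p = "snd c y"
    have pK: "?p \<in> ?K" using d chart_image_half_plane[OF c snd_in_image[OF y]]
        by (simp add: dist_commute)
    have pK': "?p \<in> K'" using pK d by (simp add: K'_def)
    have s: "?P ?p > 0" using paraboloid_sign[OF r(1)] d by simp
    note b = bump_pos[OF s l(1)]
    have "l * bump' l (?P ?p) * c2 \<le> bump'' l (?P ?p) * g ?p"
    proof (rule mult_mono[OF b(2) c2(2)[OF pK']])
      have "0 \<le> l * bump' l (?P ?p)" using l(1) b(1) by simp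
      then show "0 \<le> bump'' l (?P ?p)" using b(2) by linarith
    qed (use c2 in auto)
    moreover have "bump' l (?P ?p) * (- \<bar>C1\<bar>) \<le> bump' l (?P ?p) * coord_laplacian (metric S c) ?P
        ?p"
      using C1[OF pK] b(1) by (intro mult_left_mono) auto
    moreover have "l * bump' l (?P ?p) * c2 + bump' l (?P ?p) * (- \<bar>C1\<bar>) = bump' l (?P ?p) * (l *
        c2 - \<bar>C1\<bar>)"
      by (simp add: algebra_simps)
    moreover have "laplacian S (bump_fun c q r l) y =
        bump'' l (?P ?p) * g ?p + bump' l (?P ?p) * coord_laplacian (metric S c) ?P ?p"
      unfolding g_def by (rule bump_fun_chart(3)[OF c sub r(1) y])
    ultimately have "bump' l (?P ?p) * 1 \<le> laplacian S (bump_fun c q r l) y"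
      unfolding l(2) by simp
    then show "laplacian S (bump_fun c q r l) y > 0" using b(1) by linarith
  qed
qed

definition subharmonic :: "('a \<Rightarrow> real) \<Rightarrow> bool" where
  "subharmonic h \<longleftrightarrow> C2S h \<and> (\<forall>y\<in>topspace (top_of S). laplacian S h y \<ge> 0)"

text \<open>Since \<open>S\<close> need not be connected, the set of points at which some subharmonic function has
  positive Laplacian replaces the union of the components that meet the boundary.\<close>

definition good :: "'a set" where
  "good = {x \<in> topspace (top_of S). \<exists>h. subharmonic h \<and> laplacian S h x > 0}"

lemma subharmonic_add:
  assumes "subharmonic f" "subharmonic h" "a \<ge> 0"
  shows "subharmonic (\<lambda>y. f y + a * h y)"
    "\<And>y. y \<in> topspace (top_of S) \<Longrightarrow> laplacian S (\<lambda>y. f y + a * h y) y = laplacian S f y +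
        a * laplacian S h y"
  using assms laplacian_linear unfolding subharmonic_def C2S_def by auto

lemma positive_laplacian_open:
  assumes "C2S h"
  shows "openin (top_of S) {y \<in> topspace (top_of S). laplacian S h y > b}"
  using openin_continuous_map_preimage[OF C2S_continuous(2)[OF assms], of "{b<..}"] by simp

lemma good_open: "openin (top_of S) good"
proof (subst openin_subopen, safe)
  fix x assume "x \<in> good"
  then obtain h where h: "subharmonic h" "laplacian S h x > 0" "x \<in> topspace (top_of S)"
      by (auto simp: good_def)
  show "\<exists>T. openin (top_of S) T \<and> x \<in> T \<and> T \<subseteq> good"
    by (rule exI[of _ "{y \<in> topspace (top_of S). laplacian S h y > 0}"])
       (use h positive_laplacian_open in \<open>auto simp: good_def subharmonic_def\<close>)
qed

lemma boundary_good: "boundary_of S \<subseteq> good"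
proof
  fix x assume x: "x \<in> boundary_of S"
  note c = chart_at[OF boundary_subset[OF x]]
  let ?c = "chart_at S x"
  let ?p = "snd ?c x"
  have p2: "?p $ 2 = 0" using boundary_chart[OF c] x by simp
  obtain R where R: "R > 0" "cball ?p R \<inter> half_plane \<subseteq> chart_image ?c"
    using chart_cball[OF chart_image_open[OF c(1)] snd_in_image[OF c(2)]] .
  define r where "r = R / 2"
  define q :: "real^2" where "q = ?p - (r / 2) *\<^sub>R axis 2 1"
  have r: "r > 0" "r / 2 > 0" using R by (auto simp: r_def)
  have dpq: "dist ?p q = r / 2" using r by (simp add: q_def dist_norm)
  have "dist ?p y \<le> R" if "y \<in> cball q r" for y
    using dist_triangle[of ?p y q] that dpq r by (simp add: r_def)
  then have "cball q r \<subseteq> cball ?p R" by auto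
  then have sub: "cball q r \<inter> half_plane \<subseteq> chart_image ?c" using R(2) by blast
  obtain l where l: "\<And>y. y \<in> fst ?c \<Longrightarrow> r / 2 \<le> dist (snd ?c y) q \<Longrightarrow> dist (snd ?c y) q < r \<Longrightarrow>
      laplacian S (bump_fun ?c q r l) y > 0"
    using bump_fun_subharmonic[OF c(1) sub r] by blast
  have far: "r / 2 \<le> dist (snd ?c y) q" if "y \<in> fst ?c" for y
  proof -
    have "r / 2 \<le> \<bar>(snd ?c y - q) $ 2\<bar>"
      using chart_image_half_plane[OF c(1) snd_in_image[OF that]] p2 r by (simp add: q_def)
    also have "\<dots> \<le> dist (snd ?c y) q" unfolding dist_norm by (rule component_le_norm_cart)
    finally show ?thesis .
  qed
  have "laplacian S (bump_fun ?c q r l) y \<ge> 0" if "y \<in> topspace (top_of S)" for y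
    using bump_fun_chart(2)[OF c(1) sub r(1) that, where l = l] l[of y] far[of y]
    by (cases "y \<in> fst ?c \<and> dist (snd ?c y) q < r") auto
  then have "subharmonic (bump_fun ?c q r l)"
    using bump_fun_chart(1)[OF c(1) sub r(1)] by (simp add: subharmonic_def)
  moreover have "laplacian S (bump_fun ?c q r l) x > 0" using l[OF c(2)] dpq r by simp
  ultimately show "x \<in> good" using boundary_subset[OF x] by (auto simp: good_def)
qed

text \<open>A bump around a nearby good point \<open>z\<close> is subharmonic except close to \<open>z\<close>, where a subharmonic
  function witnessing that \<open>z\<close> is good compensates.\<close>

lemma good_closed: "closedin (top_of S) good"
proof -
  have "openin (top_of S) (topspace (top_of S) - good)"
  proof (subst openin_subopen, safe)
    fix x assume x: "x \<in> topspace (top_of S)" "x \<notin> good"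
    note c = chart_at[OF x(1)]
    let ?c = "chart_at S x"
    let ?p = "snd ?c x"
    obtain R where R: "R > 0" "cball ?p R \<inter> half_plane \<subseteq> chart_image ?c"
      using chart_cball[OF chart_image_open[OF c(1)] snd_in_image[OF c(2)]] .
    define r where "r = R / 2"
    have r: "r > 0" using R by (auto simp: r_def)
    define U where "U = {y \<in> fst ?c. snd ?c y \<in> ball ?p r \<inter> half_plane}"
    have "ball ?p r \<subseteq> cball ?p R" using r by (auto simp: r_def)
    then have "ball ?p r \<inter> half_plane \<subseteq> chart_image ?c" using R(2) by blast
    then have oU: "openin (top_of S) U" unfolding U_def by (intro chart_preimage_open[OF c(1)
        open_half_ball])
    have xU: "x \<in> U" using c r chart_image_half_plane[OF c(1) snd_in_image[OF c(2)]]
        by (simp add: U_def)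
    have "z \<notin> good" if z: "z \<in> U" for z
    proof
      assume "z \<in> good"
      then obtain h where h: "subharmonic h" "laplacian S h z > 0" "z \<in> topspace (top_of S)"
          by (auto simp: good_def)
      define b where "b = laplacian S h z / 2"
      have b: "b > 0" using h(2) by (simp add: b_def)
      define q where "q = snd ?c z"
      have zc: "z \<in> fst ?c" "dist ?p q < r" using z by (auto simp: U_def q_def)
      have "dist ?p y \<le> R" if "y \<in> cball q r" for y
        using dist_triangle[of ?p y q] that zc(2) by (simp add: r_def)
      then have "cball q r \<subseteq> cball ?p R" by auto
      then have sub: "cball q r \<inter> half_plane \<subseteq> chart_image ?c" using R(2) by blast
      define W where "W = {y \<in> topspace (top_of S). laplacian S h y > b} \<inter> fst ?c"
      have oW: "openin (top_of S) W"
        unfolding W_def using h(1) by (intro openin_Int positive_laplacian_open chart_open c)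
            (simp add: subharmonic_def)
      have zW: "z \<in> W" using h zc by (simp add: W_def b_def)
      have "open_hp (snd ?c ` W)" by (rule chart_image_openin[OF c(1) oW]) (simp add: W_def)
      moreover have "q \<in> snd ?c ` W" using zW by (simp add: q_def)
      ultimately obtain r0 where r0: "r0 > 0" "cball q r0 \<inter> half_plane \<subseteq> snd ?c ` W"
        by (rule chart_cball)
      obtain l where l: "\<And>y. y \<in> fst ?c \<Longrightarrow> r0 \<le> dist (snd ?c y) q \<Longrightarrow> dist (snd ?c y) q < r \<Longrightarrow>
          laplacian S (bump_fun ?c q r l) y > 0"
        using bump_fun_subharmonic[OF c(1) sub r r0(1)] by blast
      let ?f = "bump_fun ?c q r l"
      note f = bump_fun_chart[OF c(1) sub r, where l = l]
      have near: "laplacian S h y > b" if y: "y \<in> fst ?c" "dist (snd ?c y) q < r0" for y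
      proof -
        have "snd ?c y \<in> cball q r0 \<inter> half_plane"
          using y chart_image_half_plane[OF c(1) snd_in_image[OF y(1)]] by (simp add: dist_commute)
        then obtain y' where y': "y' \<in> W" "snd ?c y = snd ?c y'" using r0(2) by blast
        then have "y = y'" using y chart_inj[OF c(1)] by (auto simp: W_def dest: inj_onD)
        then show ?thesis using y' by (simp add: W_def)
      qed
      obtain C where C: "C \<ge> 0" "\<And>y. y \<in> topspace (top_of S) \<Longrightarrow> laplacian S ?f y \<ge> - C"
      proof -
        have "continuous_map (top_of S) euclideanreal (laplacian S ?f)"
            by (rule C2S_continuous(2)[OF f(1)])
        moreover have "compactin (top_of S) (topspace (top_of S))" "topspace (top_of S) \<noteq> {}"
          using compact_S x(1) by (auto simp: compact_space_def)
        ultimately obtain y where "\<forall>y'\<in>topspace (top_of S). laplacian S ?f y \<le> laplacian S ?f y'"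
          using compactin_attains_inf by blast
        then show ?thesis using that[of "\<bar>laplacian S ?f y\<bar>"] by fastforce
      qed
      define a where "a = (C + 1) / b"
      have a: "a \<ge> 0" "a * b = C + 1" using b C by (auto simp: a_def)
      have hC: "C2S h" "\<And>y. y \<in> topspace (top_of S) \<Longrightarrow> laplacian S h y \<ge> 0" using h(1)
          by (auto simp: subharmonic_def)
      have lap: "laplacian S (\<lambda>y. ?f y + a * h y) y = laplacian S ?f y + a * laplacian S h y"
        and C2: "C2_near (\<lambda>y. ?f y + a * h y) y" if "y \<in> topspace (top_of S)" for y
        using laplacian_linear[OF that, of ?f h a] f(1) hC(1) that by (auto simp: C2S_def)
      have pos: "laplacian S ?f y + a * laplacian S h y > 0" if y: "y \<in> fst ?c" "dist (snd ?c y) q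
          < r" for y
      proof (cases "dist (snd ?c y) q < r0")
        case True
        have "a * b \<le> a * laplacian S h y" using near[OF y(1) True] a(1) by (intro mult_left_mono)
            auto
        then show ?thesis using C(2)[OF chart_subset[OF c(1) y(1)]] a(2) by linarith
      next
        case False
        have "a * laplacian S h y \<ge> 0" using a(1) hC(2)[OF chart_subset[OF c(1) y(1)]] by simp
        then show ?thesis using l[OF y(1) _ y(2)] False by simp
      qed
      have "laplacian S ?f y + a * laplacian S h y \<ge> 0" if y: "y \<in> topspace (top_of S)" for y
      proof (cases "y \<in> fst ?c \<and> dist (snd ?c y) q < r")
        case False
        then show ?thesis using f(2)[OF y False] a(1) hC(2)[OF y] by simp
      qed (use pos in \<open>auto intro: less_imp_le\<close>)
      then have "subharmonic (\<lambda>y. ?f y + a * h y)" using lap C2 by (simp add: subharmonic_def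
          C2S_def)
      moreover have "laplacian S (\<lambda>y. ?f y + a * h y) x > 0" using lap[OF x(1)] pos[OF c(2) zc(2)]
          by simp
      ultimately have "x \<in> good" using x(1) by (auto simp: good_def)
      then show False using x(2) by simp
    qed
    then show "\<exists>T. openin (top_of S) T \<and> x \<in> T \<and> T \<subseteq> topspace (top_of S) - good"
      using oU xU openin_subset[OF oU] by blast
  qed
  then show ?thesis by (simp add: closedin_def good_def)
qed

lemma good_compact: "compactin (top_of S) good"
  using closedin_compact_space[OF compact_S good_closed] .

lemma subharmonic_on_good:
  obtains h where "C2S h" "\<And>x. x \<in> good \<Longrightarrow> laplacian S h x \<ge> b"
proof -
  have "\<exists>h. subharmonic h \<and> (\<forall>x\<in>good. laplacian S h x > 0)"
  proof -
    from good_def have "\<forall>x\<in>good. \<exists>h. subharmonic h \<and> laplacian S h x > 0" by blast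
    then obtain H where H: "\<And>x. x \<in> good \<Longrightarrow> subharmonic (H x)" "\<And>x. x \<in> good \<Longrightarrow> laplacian S (H x) x
        > 0"
      by metis
    define U where "U = (\<lambda>x. {y \<in> topspace (top_of S). laplacian S (H x) y > 0})"
    have "\<exists>\<F>. finite \<F> \<and> \<F> \<subseteq> U ` good \<and> good \<subseteq> \<Union>\<F>"
    proof (rule compactinD[OF good_compact])
      show "openin (top_of S) V" if "V \<in> U ` good" for V
        using that H(1) positive_laplacian_open by (auto simp: U_def subharmonic_def)
      show "good \<subseteq> \<Union> (U ` good)" using H(2) by (auto simp: U_def good_def)
    qed
    then obtain \<F> where F: "finite \<F>" "\<F> \<subseteq> U ` good" "good \<subseteq> \<Union>\<F>" by blast
    obtain X where X: "X \<subseteq> good" "finite X" "\<F> = U ` X" using finite_subset_image[OF F(1,2)]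
        by blast
    have "\<exists>h. subharmonic h \<and> (\<forall>x\<in>\<Union>(U ` X). laplacian S h x > 0)"
      using X(2,1)
    proof (induction X rule: finite_induct)
      case empty
      have "\<exists>h. subharmonic h"
      proof (cases "good = {}")
        case True
        have "C2_near (\<lambda>y. 0) x" if "x \<in> topspace (top_of S)" for x
          unfolding C2_near_def
          by (intro bexI[of _ "chart_at S x"] conjI exI[of _ "chart_image (chart_at S x)"])
             (use chart_at[OF that] chart_image_open[OF chart_at(1)[OF that]] in
               \<open>auto simp: coord_rep_def[abs_def] intro!: Ck_on_const\<close>)
        note n = this
        have "laplacian S (\<lambda>y. 0) x = 0" if "x \<in> topspace (top_of S)" for x
          using laplacian_linear(2)[OF that n[OF that] n[OF that], of 1] by simp
        then show ?thesis using n by (intro exI[of _ "\<lambda>y. 0"]) (simp add: subharmonic_def C2S_def)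
      qed (use H(1) in blast)
      then show ?case by simp
    next
      case (insert x X)
      then obtain h where h: "subharmonic h" "\<forall>x\<in>\<Union>(U ` X). laplacian S h x > 0" by auto
      have Hx: "subharmonic (H x)" using H insert.prems by simp
      note s = subharmonic_add[OF h(1) Hx zero_le_one]
      have "laplacian S (\<lambda>y. h y + 1 * H x y) y > 0" if "y \<in> \<Union>(U ` insert x X)" for y
      proof -
        have yt: "y \<in> topspace (top_of S)" using that by (auto simp: U_def)
        have "laplacian S h y \<ge> 0" "laplacian S (H x) y \<ge> 0" using h(1) Hx yt
            by (auto simp: subharmonic_def)
        moreover have "laplacian S (H x) y > 0 \<or> laplacian S h y > 0" using that h(2)
            by (auto simp: U_def)
        ultimately show ?thesis unfolding s(2)[OF yt] by auto
      qed
      then show ?case using s(1) by blast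
    qed
    then show ?thesis using F(3) X(3) by blast
  qed
  then obtain h where h: "subharmonic h" "\<And>x. x \<in> good \<Longrightarrow> laplacian S h x > 0" by blast
  have hC: "C2S h" using h(1) by (simp add: subharmonic_def)
  obtain m where m: "m > 0" "\<And>x. x \<in> good \<Longrightarrow> laplacian S h x \<ge> m"
  proof (cases "good = {}")
    case False
    obtain x where "x \<in> good" "\<forall>y\<in>good. laplacian S h x \<le> laplacian S h y"
      using compactin_attains_inf[OF good_compact False C2S_continuous(2)[OF hC]] by blast
    then show ?thesis using that[of "laplacian S h x"] h(2) by auto
  qed (use that[of 1] in auto)
  have gt: "x \<in> topspace (top_of S)" if "x \<in> good" for x using that by (simp add: good_def)
  show ?thesis
  proof (rule that)
    have n: "C2_near h x" if "x \<in> topspace (top_of S)" for x using hC that by (simp add: C2S_def)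
    show "C2S (\<lambda>y. h y + (\<bar>b\<bar> / m) * h y)" using laplacian_linear(1) n unfolding C2S_def by blast
    fix x assume x: "x \<in> good"
    have "\<bar>b\<bar> = (\<bar>b\<bar> / m) * m" using m by simp
    also have "\<dots> \<le> (\<bar>b\<bar> / m) * laplacian S h x" using m x by (intro mult_left_mono) auto
    also have "\<dots> \<le> laplacian S h x + (\<bar>b\<bar> / m) * laplacian S h x" using h(2)[OF x] by simp
    finally show "laplacian S (\<lambda>y. h y + (\<bar>b\<bar> / m) * h y) x \<ge> b"
      unfolding laplacian_linear(2)[OF gt[OF x] n[OF gt[OF x]] n[OF gt[OF x]]] by simp
  qed
qed

end

section \<open>The solution\<close>

lemma time_deriv_eq:
  assumes "0 \<le> t" "t < T"
  shows "time_deriv {0..T} f t = time_deriv {0..} f t"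
proof -
  have "at t within {0..T} = at t within {0..}"
    by (rule at_within_nhd[of t "{..<T}"]) (use assms in auto)
  then show ?thesis by (simp add: time_deriv_def)
qed

locale cauchy_dirichlet = riemannian_surface S for S :: "'a surface" +
  fixes \<alpha> :: real and u\<^sub>0 :: "'a \<Rightarrow> real" and \<phi> u :: "'a \<Rightarrow> real \<Rightarrow> real"
  assumes \<alpha>: "\<alpha> > 0" and adm: "admissible_pair \<alpha> S u\<^sub>0 \<phi>"
    and sol: "cauchy_dirichlet_solution \<alpha> S u\<^sub>0 \<phi> u"
    and sup_lim: "((\<lambda>t. SUP x\<in>boundary_of S. time_deriv {0..} (\<phi> x) t) \<longlongrightarrow> 0) at_top"
begin

definition ut :: "'a \<Rightarrow> real \<Rightarrow> real" where "ut x t = time_deriv {0..} (u x) t"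

lemma par: "T > 0 \<Longrightarrow> c \<in> atlas S \<Longrightarrow>
    coord_par_C2_holder \<alpha> UNIV (chart_image c) T (\<lambda>p t. u (chart_inv c p) t)"
  using sol by (auto simp: cauchy_dirichlet_solution_def par_C2_holder_def)

lemma u_C2:
  assumes "c \<in> atlas S" "t \<ge> 0"
  shows "Ck_on 2 UNIV (chart_image c) (coord_rep c (\<lambda>y. u y t))"
proof -
  have "\<forall>s\<in>{0..t + 1}. Ck_on 2 UNIV (chart_image c) (\<lambda>p. u (chart_inv c p) s)"
    using par[of "t + 1" c] assms unfolding coord_par_C2_holder_def by auto
  moreover have "coord_rep c (\<lambda>y. u y t) = (\<lambda>p. u (chart_inv c p) t)"
    by (simp add: coord_rep_def fun_eq_iff)
  ultimately show ?thesis using assms by simp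
qed

lemma u_C2_near: "x \<in> topspace (top_of S) \<Longrightarrow> t \<ge> 0 \<Longrightarrow> C2_near (\<lambda>y. u y t) x"
  unfolding C2_near_def
  by (intro bexI[of _ "chart_at S x"] conjI exI[of _ "chart_image (chart_at S x)"])
     (use chart_at[of x] chart_image_open u_C2 in simp_all)

lemma u_C2S: "t \<ge> 0 \<Longrightarrow> C2S (\<lambda>y. u y t)"
  by (simp add: C2S_def u_C2_near)

lemma u_deriv_within:
  assumes x: "x \<in> topspace (top_of S)" and t: "0 \<le> t" "t \<le> T"
  shows "(u x has_real_derivative ut x t) (at t within {0..T})"
proof -
  note c = chart_at[OF x]
  have "\<forall>p\<in>chart_image (chart_at S x). \<forall>s\<in>{0..T + 1}.
      u (chart_inv (chart_at S x) p) differentiable (at s within {0..T + 1})"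
    using par[of "T + 1", OF _ c(1)] t unfolding coord_par_C2_holder_def by auto
  then have "u (chart_inv (chart_at S x) (snd (chart_at S x) x)) differentiable (at t within {0..T
      + 1})"
    using snd_in_image[OF c(2)] t by auto
  then have "(u x has_vector_derivative vector_derivative (u x) (at t within {0..T +
      1})) (at t within {0..T + 1})"
    using c by (simp add: vector_derivative_works)
  then have "(u x has_real_derivative ut x t) (at t within {0..T + 1})"
    using time_deriv_eq[of t "T + 1" "u x"] t
    by (simp add: has_real_derivative_iff_has_vector_derivative ut_def time_deriv_def)
  then show ?thesis by (rule DERIV_subset) auto
qed

lemma u_deriv:
  assumes x: "x \<in> topspace (top_of S)" and t: "t > 0"
  shows "(u x has_real_derivative ut x t) (at t)"
proof -
  have "at t within {0..t + 1} = at t"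
    using at_within_interior[of t "{0..t + 1}"] t by simp
  then show ?thesis using u_deriv_within[OF x, of t "t + 1"] t by simp
qed

lemma ut_bounded:
  assumes T: "T \<ge> 0"
  shows "\<exists>L. \<forall>x\<in>topspace (top_of S). \<forall>t\<in>{0..T}. \<bar>ut x t\<bar> \<le> L"
proof (rule local_to_global)
  show "\<forall>t\<in>{0..T}. \<bar>ut y t\<bar> \<le> b" if "\<forall>t\<in>{0..T}. \<bar>ut y t\<bar> \<le> a" "a \<le> b" for y a b
    using that by (meson order_trans)
  fix x assume x: "x \<in> topspace (top_of S)"
  obtain c r where c: "c \<in> atlas S" "x \<in> fst c" and r: "r > 0" "cball (snd c x) r \<inter> half_plane \<subseteq>
      chart_image c"
    and U: "openin (top_of S) {y \<in> fst c. snd c y \<in> ball (snd c x) r \<inter> half_plane}"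
    "x \<in> {y \<in> fst c. snd c y \<in> ball (snd c x) r \<inter> half_plane}"
    by (rule chart_ball_nbhd[OF x])
  let ?K = "cball (snd c x) r \<inter> half_plane"
  let ?F = "\<lambda>p. time_deriv {0..T + 1} (u (chart_inv c p))"
  have "\<forall>K. compact K \<and> K \<subseteq> chart_image c \<longrightarrow> par_holder_on \<alpha> (\<alpha> / 2) K {0..T + 1} ?F"
    using par[of "T + 1", OF _ c(1)] T unfolding coord_par_C2_holder_def by auto
  then have "par_holder_on \<alpha> (\<alpha> / 2) ?K {0..T + 1} ?F" using r compact_half_ball by blast
  then obtain C where C: "\<And>p q s t. p \<in> ?K \<Longrightarrow> q \<in> ?K \<Longrightarrow> s \<in> {0..T + 1} \<Longrightarrow> t \<in> {0..T + 1} \<Longrightarrow>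
      \<bar>?F p s - ?F q t\<bar> \<le> C * (dist p q powr \<alpha> + \<bar>s - t\<bar> powr (\<alpha> / 2))"
    unfolding par_holder_on_def by blast
  let ?L = "\<bar>?F (snd c x) 0\<bar> + \<bar>C\<bar> * (r powr \<alpha> + (T + 1) powr (\<alpha> / 2))"
  have "\<bar>ut y t\<bar> \<le> ?L" if y: "y \<in> fst c" "snd c y \<in> ball (snd c x) r \<inter> half_plane"
      and t: "t \<in> {0..T}" for y t
  proof -
    have yK: "snd c y \<in> ?K" and xK: "snd c x \<in> ?K" using y U(2) r by auto
    have "dist (snd c y) (snd c x) powr \<alpha> \<le> r powr \<alpha>"
      using yK \<alpha> by (intro powr_mono2) (auto simp: dist_commute)
    moreover have "\<bar>t - 0\<bar> powr (\<alpha> / 2) \<le> (T + 1) powr (\<alpha> / 2)" using t \<alpha> by (intro powr_mono2) auto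
    ultimately have "C * (dist (snd c y) (snd c x) powr \<alpha> + \<bar>t - 0\<bar> powr (\<alpha> / 2)) \<le>
        \<bar>C\<bar> * (r powr \<alpha> + (T + 1) powr (\<alpha> / 2))"
      by (intro mult_mono add_mono) auto
    then have "\<bar>?F (snd c y) t\<bar> \<le> ?L" using C[OF yK xK, of t 0] t T by auto
    moreover have "?F (snd c y) t = ut y t"
      using time_deriv_eq[of t "T + 1" "u y"] t c y by (simp add: ut_def)
    ultimately show ?thesis by simp
  qed
  then show "\<exists>U a. openin (top_of S) U \<and> x \<in> U \<and> (\<forall>y\<in>U. \<forall>t\<in>{0..T}. \<bar>ut y t\<bar> \<le> a)"
    using U by (intro exI[of _ "{y \<in> fst c. snd c y \<in> ball (snd c x) r \<inter> half_plane}"] exI[of _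
        ?L]) auto
qed

lemma u_Lipschitz:
  assumes L: "\<And>x t. x \<in> topspace (top_of S) \<Longrightarrow> t \<in> {0..T} \<Longrightarrow> \<bar>ut x t\<bar> \<le> L"
    and "x \<in> topspace (top_of S)" "s \<in> {0..T}" "t \<in> {0..T}"
  shows "\<bar>u x s - u x t\<bar> \<le> L * \<bar>s - t\<bar>"
proof -
  have "norm (u x s - u x t) \<le> L * norm (s - t)"
    by (rule field_differentiable_bound[where S = "{0..T}" and f' = "ut x"])
       (use assms u_deriv_within in auto)
  then show ?thesis by simp
qed

lemma continuous_bounded:
  assumes "continuous_map (top_of S) euclideanreal f"
  obtains B where "\<And>x. x \<in> topspace (top_of S) \<Longrightarrow> \<bar>f x\<bar> \<le> (B::real)"
proof -
  have "compact (f ` topspace (top_of S))"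
    using image_compactin[OF _ assms, of "topspace (top_of S)"] compact_S
        by (simp add: compact_space_def)
  then have "bounded (f ` topspace (top_of S))" by (rule compact_imp_bounded)
  then show ?thesis using that unfolding bounded_iff by auto
qed

lemma evolution:
  assumes "x \<in> inner_part S" "t \<ge> 0"
  shows "ut x t = exp (- 2 * u x t) * (laplacian S (\<lambda>y. u y t) x - gauss_curvature S x) - 1"
  using sol assms by (simp add: cauchy_dirichlet_solution_def ut_def)

text \<open>The equation at time 0 expresses the curvature in terms of the solution, so its boundedness
  needs no computation in charts.\<close>

lemma gauss_curvature_bounded:
  obtains \<kappa> where "\<kappa> \<ge> 0" "\<And>x. x \<in> inner_part S \<Longrightarrow> \<bar>gauss_curvature S x\<bar> \<le> \<kappa>"
proof -
  obtain L where L: "\<forall>x\<in>topspace (top_of S). \<forall>t\<in>{0..0}. \<bar>ut x t\<bar> \<le> L" using ut_bounded[of 0] by auto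
  obtain B where B: "\<And>x. x \<in> topspace (top_of S) \<Longrightarrow> \<bar>u x 0\<bar> \<le> B"
    using continuous_bounded[OF C2S_continuous(1)[OF u_C2S[of 0]]] by auto
  obtain D where D: "\<And>x. x \<in> topspace (top_of S) \<Longrightarrow> \<bar>laplacian S (\<lambda>y. u y 0) x\<bar> \<le> D"
    using continuous_bounded[OF C2S_continuous(2)[OF u_C2S[of 0]]] by auto
  have bd: "\<bar>gauss_curvature S x\<bar> \<le> \<bar>D\<bar> + exp (2 * B) * (1 + \<bar>L\<bar>)" if x: "x \<in> inner_part S" for x
  proof -
    have xt: "x \<in> topspace (top_of S)" using x by (simp add: inner_part_def)
    have "exp (2 * u x 0) * exp (- 2 * u x 0) = 1" by (simp flip: exp_add)
    then have "exp (2 * u x 0) * (exp (- 2 * u x 0) * (laplacian S (\<lambda>y. u y 0) x - gauss_curvature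
        S x)) =
       laplacian S (\<lambda>y. u y 0) x - gauss_curvature S x"
      by (simp only: mult.assoc[symmetric] mult_1_left)
    moreover have "exp (- 2 * u x 0) * (laplacian S (\<lambda>y. u y 0) x - gauss_curvature S x) = 1 +
        ut x 0"
      using evolution[OF x, of 0] by simp
    ultimately have K: "gauss_curvature S x = laplacian S (\<lambda>y. u y 0) x - exp (2 * u x 0) * (1 +
        ut x 0)"
      by (metis diff_diff_eq2 add_diff_cancel_left')
    have "\<bar>1 + ut x 0\<bar> \<le> 1 + \<bar>L\<bar>" using L xt by fastforce
    then have "\<bar>exp (2 * u x 0) * (1 + ut x 0)\<bar> \<le> exp (2 * B) * (1 + \<bar>L\<bar>)"
      unfolding abs_mult using B[OF xt] by (intro mult_mono) auto
    then show ?thesis unfolding K using D[OF xt] by linarith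
  qed
  show ?thesis by (rule that[OF _ bd]) (auto intro!: add_nonneg_nonneg)
qed

lemma boundary_value:
  assumes "x \<in> boundary_of S" "t \<ge> 0"
  shows "u x t = \<phi> x t" "ut x t = time_deriv {0..} (\<phi> x) t"
proof -
  have e: "u x s = \<phi> x s" if "s \<ge> 0" for s
    using sol assms that by (simp add: cauchy_dirichlet_solution_def)
  show "u x t = \<phi> x t" by (rule e[OF assms(2)])
  show "ut x t = time_deriv {0..} (\<phi> x) t"
    unfolding ut_def time_deriv_def
    by (rule vector_derivative_cong_eq) (use e assms in \<open>auto intro: always_eventually\<close>)
qed

lemma boundary_nondecreasing:
  obtains T where "T > 0" "\<And>x t. x \<in> boundary_of S \<Longrightarrow> t \<ge> T \<Longrightarrow> ut x t \<ge> 0"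
proof -
  obtain T where "T > 0" "\<forall>x\<in>boundary_of S. \<forall>t\<ge>T. time_deriv {0..} (\<phi> x) t \<ge> 0"
    using adm unfolding admissible_pair_def by auto
  then show ?thesis using that boundary_value(2) by force
qed

lemma boundary_slow:
  assumes "e > 0"
  obtains T where "T > 0" "\<And>x t. x \<in> boundary_of S \<Longrightarrow> t \<ge> T \<Longrightarrow> ut x t \<le> e"
proof -
  have "\<forall>\<^sub>F t in at_top. (SUP x\<in>boundary_of S. time_deriv {0..} (\<phi> x) t) < e"
    using order_tendstoD(2)[OF sup_lim assms] .
  then obtain T where T: "\<And>t. t \<ge> T \<Longrightarrow> (SUP x\<in>boundary_of S. time_deriv {0..} (\<phi> x) t) < e"
    by (auto simp: eventually_at_top_linorder)
  have "ut x t \<le> e" if x: "x \<in> boundary_of S" and t: "t \<ge> max T 1" for x t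
  proof -
    obtain L where L: "\<forall>x\<in>topspace (top_of S). \<forall>s\<in>{0..t}. \<bar>ut x s\<bar> \<le> L" using ut_bounded[of t] t
        by auto
    have "bdd_above ((\<lambda>x. time_deriv {0..} (\<phi> x) t) ` boundary_of S)"
    proof (rule bdd_aboveI2)
      fix y assume y: "y \<in> boundary_of S"
      then have "\<bar>ut y t\<bar> \<le> L" using L boundary_subset t by auto
      then show "time_deriv {0..} (\<phi> y) t \<le> L" using boundary_value(2)[OF y, of t] t by simp
    qed
    from cSUP_upper[OF x this] show ?thesis using T[of t] t boundary_value(2)[OF x, of t] by simp
  qed
  then show ?thesis using that[of "max T 1"] by auto
qed

lemma boundary_large:
  obtains T where "T > 0" "\<And>x t. x \<in> boundary_of S \<Longrightarrow> t \<ge> T \<Longrightarrow> u x t \<ge> N"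
proof -
  obtain T1 \<xi> where T1: "T1 > 0" "low_speed_increasing \<xi>"
    "\<And>x t. x \<in> boundary_of S \<Longrightarrow> t \<ge> T1 \<Longrightarrow> \<phi> x t \<ge> ln (\<xi> t)"
    using adm unfolding admissible_pair_def by blast
  have "filterlim \<xi> at_top at_top" using T1(2) by (simp add: low_speed_increasing_def)
  then have "\<forall>\<^sub>F t in at_top. exp N \<le> \<xi> t" by (simp add: filterlim_at_top)
  then obtain T2 where T2: "\<And>t. t \<ge> T2 \<Longrightarrow> exp N \<le> \<xi> t" by (auto simp: eventually_at_top_linorder)
  have "u x t \<ge> N" if x: "x \<in> boundary_of S" and t: "t \<ge> max T1 T2" for x t
  proof -
    have "N \<le> ln (\<xi> t)" using T2[of t] t by (metis exp_gt_zero ln_exp ln_mono less_le_trans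
        max.bounded_iff)
    then show ?thesis using T1(3)[OF x, of t] boundary_value(1)[OF x, of t] t T1(1) by simp
  qed
  then show ?thesis using that[of "max T1 T2"] T1(1) by auto
qed

lemma boundary_mono:
  assumes T: "\<And>x t. x \<in> boundary_of S \<Longrightarrow> t \<ge> T \<Longrightarrow> ut x t \<ge> 0" "T > 0"
    and x: "x \<in> boundary_of S" and st: "T \<le> s" "s \<le> t"
  shows "u x s \<le> u x t"
  by (rule DERIV_nonneg_imp_nondecreasing[OF st(2)])
     (use T st u_deriv[OF boundary_subset[OF x]] x in \<open>meson dual_order.strict_trans1 order_trans\<close>)

lemma u_bounded_below:
  "\<exists>A T. T > 0 \<and> (\<forall>x\<in>good. \<forall>t\<ge>T. u x t \<ge> - A)"
proof -
  obtain T where T: "T > 0" "\<And>x t. x \<in> boundary_of S \<Longrightarrow> t \<ge> T \<Longrightarrow> ut x t \<ge> 0"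
    using boundary_nondecreasing by blast
  obtain \<kappa> where \<kappa>: "\<kappa> \<ge> 0" "\<And>x. x \<in> inner_part S \<Longrightarrow> \<bar>gauss_curvature S x\<bar> \<le> \<kappa>"
    using gauss_curvature_bounded by blast
  obtain h where h: "C2S h" "\<And>x. x \<in> good \<Longrightarrow> laplacian S h x \<ge> \<kappa> + 1"
    using subharmonic_on_good by blast
  obtain H where H: "\<And>x. x \<in> topspace (top_of S) \<Longrightarrow> \<bar>h x\<bar> \<le> H"
    using continuous_bounded[OF C2S_continuous(1)[OF h(1)]] by auto
  obtain B where B: "\<And>x. x \<in> topspace (top_of S) \<Longrightarrow> \<bar>u x T\<bar> \<le> B"
    using continuous_bounded[OF C2S_continuous(1)[OF u_C2S[of T]]] T by auto
  define b where "b = (\<lambda>x. h x - (\<bar>H\<bar> + \<bar>B\<bar> + 1))"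
  have gt: "x \<in> topspace (top_of S)" if "x \<in> good" for x using that by (simp add: good_def)
  have b: "b x < 0" "b x < u x T" if "x \<in> topspace (top_of S)" for x
    using H[OF that] B[OF that] by (auto simp: b_def)
  have main: "u x t0 > b x" if x: "x \<in> good" and t0: "t0 \<ge> T" for x t0
  proof (rule ccontr)
    assume neg: "\<not> u x t0 > b x"
    obtain L where L: "\<forall>x\<in>topspace (top_of S). \<forall>s\<in>{0..t0}. \<bar>ut x s\<bar> \<le> L" using ut_bounded[of t0] T
        t0 by auto
    define D where "D = (\<lambda>x t. u x t - b x)"
    have min: "\<exists>x\<in>good. \<forall>y\<in>good. D x t \<le> D y t" if "t \<in> {T..t0}" for t
    proof (rule compactin_attains_inf[OF good_compact])
      have "continuous_map (top_of S) euclideanreal (\<lambda>x. u x t)" "continuous_map (top_of S)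
          euclideanreal h"
        using C2S_continuous(1) u_C2S[of t] h(1) that T by auto
      then show "continuous_map (top_of S) euclideanreal (\<lambda>x. D x t)"
        unfolding D_def b_def by (intro continuous_intros)
    qed (use x in auto)
    have Lip: "\<bar>D x s - D x t\<bar> \<le> L * \<bar>s - t\<bar>" if "x \<in> good" "s \<in> {T..t0}" "t \<in> {T..t0}" for x s t
      using u_Lipschitz[of t0 L x s t] L gt[OF that(1)] that T by (auto simp: D_def)
    obtain y t where yt: "y \<in> good" "T < t" "t \<le> t0" "D y t = 0"
      "\<And>z s. z \<in> good \<Longrightarrow> T \<le> s \<Longrightarrow> s \<le> t \<Longrightarrow> D z s \<ge> 0"
    proof (rule first_touch[of T t0 good D, OF min Lip])
      show "D x T > 0" if "x \<in> good" for x using b(2)[OF gt[OF that]] by (simp add: D_def)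
      show "x \<in> good" "t0 \<in> {T..t0}" "D x t0 \<le> 0" using x t0 neg by (auto simp: D_def)
    qed auto
    have t: "t > 0" using yt T by simp
    have nb: "y \<notin> boundary_of S"
    proof
      assume y: "y \<in> boundary_of S"
      have "u y T \<le> u y t" using boundary_mono[OF T(2) T(1) y] yt by simp
      then show False using b(2)[OF gt[OF yt(1)]] yt(4) by (simp add: D_def)
    qed
    then have yi: "y \<in> inner_part S" using gt[OF yt(1)] by (simp add: inner_part_def)
    have hn: "C2_near h y" using h(1) gt[OF yt(1)] by (simp add: C2S_def)
    have "laplacian S h y \<le> laplacian S (\<lambda>z. u z t) y"
    proof (rule laplacian_at_min[OF yi u_C2_near[OF gt[OF yt(1)]] hn good_open yt(1)])
      show "u y t - h y \<le> u z t - h z" if "z \<in> good" for z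
        using yt(4) yt(5)[OF that, of t] yt(2) by (simp add: D_def b_def)
    qed (use t in simp)
    then have l: "1 \<le> laplacian S (\<lambda>z. u z t) y - gauss_curvature S y"
      using h(2)[OF yt(1)] \<kappa>(2)[OF yi] by linarith
    have uneg: "u y t < 0" using yt(4) b(1)[OF gt[OF yt(1)]] by (simp add: D_def)
    then have "1 < exp (- 2 * u y t)" by simp
    also have "\<dots> \<le> exp (- 2 * u y t) * (laplacian S (\<lambda>z. u z t) y - gauss_curvature S y)"
      using l by (simp add: mult_le_cancel_left1)
    finally have "ut y t > 0" using evolution[OF yi, of t] t by simp
    moreover have "ut y t \<le> 0"
    proof (rule deriv_le_0_of_left[OF u_deriv[OF gt[OF yt(1)] t] yt(2)])
      show "u y t \<le> u y s" if "T \<le> s" "s \<le> t" for s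
        using yt(4) yt(5)[OF yt(1) that] by (simp add: D_def)
    qed
    ultimately show False by simp
  qed
  have "u x t \<ge> - (2 * \<bar>H\<bar> + \<bar>B\<bar> + 1)" if "x \<in> good" "t \<ge> T" for x t
    using main[OF that] H[OF gt[OF that(1)]] by (simp add: b_def)
  then show ?thesis using T(1) by blast
qed

lemma boundary_curvature_local:
  assumes decay: "\<And>x t. x \<in> boundary_of S \<Longrightarrow> t \<ge> T\<^sub>3 \<Longrightarrow>
      exp (- \<phi> x t) * (bd_hess_norm S (\<lambda>y. \<phi> y t) x + (bd_grad_norm S (\<lambda>y. \<phi> y t) x)\<^sup>2
        + bd_grad_norm S (\<lambda>y. \<phi> y t) x) \<le> C\<^sub>1" and C1: "C\<^sub>1 > 0"
    and x0: "x0 \<in> boundary_of S"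
  shows "\<exists>U. openin (top_of S) U \<and> x0 \<in> U \<and> (\<forall>e>0. \<exists>T. \<forall>t\<ge>T. \<forall>y\<in>U \<inter> boundary_of S.
     \<bar>exp (- u y t) * (normal_derivative S (\<lambda>y. u y t) y + geodesic_curvature S y) - 1\<bar> \<le> e)"
proof -
  define c where "c = chart_at S x0"
  have c: "c \<in> atlas S" "x0 \<in> fst c" using chart_at[OF boundary_subset[OF x0]]
      by (simp_all add: c_def)
  define p0 where "p0 = snd c x0"
  have p0: "p0 $ 2 = 0" using boundary_chart[OF c] x0 by (simp add: p0_def)
  have "open_hp (snd c ` (good \<inter> fst c))"
    by (rule chart_image_openin[OF c(1)]) (auto intro: openin_Int good_open chart_open c)
  moreover have "p0 \<in> snd c ` (good \<inter> fst c)" using boundary_good x0 c by (auto simp: p0_def)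
  ultimately obtain R where R: "R > 0" "cball p0 R \<inter> half_plane \<subseteq> snd c ` (good \<inter> fst c)"
      by (rule chart_cball)
  let ?K = "cball p0 R \<inter> half_plane"
  have Kc: "?K \<subseteq> chart_image c" using R(2) by (auto simp: chart_image_def)
  have inv: "chart_inv c p \<in> good" "chart_inv c p \<in> fst c" "chart_inv c p \<in> topspace (top_of S)"
      "snd c (chart_inv c p) = p"
    if "p \<in> ?K" for p
  proof -
    have "p \<in> snd c ` (good \<inter> fst c)" using R(2) that by blast
    then obtain y where "y \<in> good" "y \<in> fst c" "p = snd c y" by blast
    then show "chart_inv c p \<in> good" "chart_inv c p \<in> fst c" "chart_inv c p \<in> topspace (top_of S)"
        "snd c (chart_inv c p) = p"
      using c(1) by (auto simp: good_def)
  qed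
  have bdry: "chart_inv c p \<in> boundary_of S" if "p \<in> ?K" "p $ 2 = 0" for p
    using boundary_chart[OF c(1) inv(2)[OF that(1)]] inv(4)[OF that(1)] that by simp
  have edgeK: "p \<in> ?K" if "p \<in> cball p0 R" "p $ 2 = 0" for p using that by simp
  have inner: "chart_inv c p \<in> inner_part S" if "p \<in> ?K" "p $ 2 > 0" for p
    using inner_chart[OF c(1) inv(2)[OF that(1)]] inv(4)[OF that(1)] that by simp
  have bdd: "\<exists>B\<ge>0. \<forall>p\<in>?K. \<bar>f p\<bar> \<le> B" if "continuous_on (chart_image c) f" for f :: "real^2 \<Rightarrow> real"
  proof -
    have "bounded (f ` ?K)"
      by (intro compact_imp_bounded compact_continuous_image compact_half_ball
          continuous_on_subset[OF that Kc])
    then obtain B where "\<forall>p\<in>?K. \<bar>f p\<bar> \<le> B" unfolding bounded_iff by auto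
    then show ?thesis by (intro exI[of _ "\<bar>B\<bar>"]) force
  qed
  have low: "\<exists>m>0. \<forall>p\<in>?K. m \<le> f p" if f: "continuous_on (chart_image c) f" "\<And>p. p \<in> ?K \<Longrightarrow> f p > 0"
    for f :: "real^2 \<Rightarrow> real"
  proof -
    have "p0 \<in> ?K" using R p0 by simp
    then obtain z where "z \<in> ?K" "\<forall>p\<in>?K. f z \<le> f p"
      using continuous_attains_inf[OF compact_half_ball _ continuous_on_subset[OF f(1) Kc]] by blast
    then show ?thesis using f(2) by blast
  qed

  define A where "A = (\<lambda>i j p. matrix_inv (metric S c p) $ i $ j)"
  define b where "b = (\<lambda>k p. \<Sum>i\<in>UNIV. \<Sum>j\<in>UNIV. A i j p * christoffel (metric S c) k i j p)"
  have Ac: "continuous_on (chart_image c) (A i j)" for i j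
    unfolding A_def by (rule continuous_inverse_metric[OF c(1)])
  have bc: "continuous_on (chart_image c) (b k)" for k
    unfolding b_def sum_2 by (intro continuous_intros Ac continuous_christoffel[OF c(1)])
  have Apos: "A 1 1 p > 0" "A 2 2 p > 0" "A 2 1 p = A 1 2 p" "A 1 1 p * A 2 2 p - (A 1 2 p)\<^sup>2 > 0"
    if "p \<in> chart_image c" for p
    using matrix_inv_pos[OF metric_pos[OF c(1) that]] by (simp_all add: A_def)
  obtain \<kappa>0 where \<kappa>0: "\<kappa>0 \<ge> 0" "\<And>x. x \<in> inner_part S \<Longrightarrow> \<bar>gauss_curvature S x\<bar> \<le> \<kappa>0"
    using gauss_curvature_bounded by blast
  define \<kappa> where "\<kappa> = (\<lambda>p. if p \<in> ?K \<and> p $ 2 > 0 then gauss_curvature S (chart_inv c p) else 0)"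
  obtain B0 where B0: "B0 \<ge> 0" "\<And>p. p \<in> ?K \<Longrightarrow> \<bar>A 1 1 p\<bar> \<le> B0 \<and> \<bar>A 1 2 p\<bar> \<le> B0 \<and> \<bar>A 2 2 p\<bar> \<le> B0 \<and>
      \<bar>b 1 p\<bar> \<le> B0 \<and> \<bar>b 2 p\<bar> \<le> B0 \<and> \<bar>\<kappa> p\<bar> \<le> B0"
  proof -
    obtain B1 B2 B3 B4 B5 where B: "B1 \<ge> 0" "\<forall>p\<in>?K. \<bar>A 1 1 p\<bar> \<le> B1" "B2 \<ge> 0" "\<forall>p\<in>?K. \<bar>A 1 2 p\<bar> \<le> B2"
      "B3 \<ge> 0" "\<forall>p\<in>?K. \<bar>A 2 2 p\<bar> \<le> B3" "B4 \<ge> 0" "\<forall>p\<in>?K. \<bar>b 1 p\<bar> \<le> B4" "B5 \<ge> 0" "\<forall>p\<in>?K. \<bar>b 2 p\<bar> \<le> B5"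
      using bdd[OF Ac[of 1 1]] bdd[OF Ac[of 1 2]] bdd[OF Ac[of 2 2]] bdd[OF bc[of 1]] bdd[OF bc[of
          2]]
      by (elim exE conjE) blast
    have k: "\<bar>\<kappa> p\<bar> \<le> \<kappa>0" for p using \<kappa>0 inner by (simp add: \<kappa>_def)
    show ?thesis
    proof (rule that[of "B1 + B2 + B3 + B4 + B5 + \<kappa>0"])
      show "B1 + B2 + B3 + B4 + B5 + \<kappa>0 \<ge> 0" using B \<kappa>0(1) by simp
      fix p assume p: "p \<in> ?K"
      show "\<bar>A 1 1 p\<bar> \<le> B1 + B2 + B3 + B4 + B5 + \<kappa>0 \<and> \<bar>A 1 2 p\<bar> \<le> B1 + B2 + B3 + B4 + B5 + \<kappa>0 \<and>
        \<bar>A 2 2 p\<bar> \<le> B1 + B2 + B3 + B4 + B5 + \<kappa>0 \<and> \<bar>b 1 p\<bar> \<le> B1 + B2 + B3 + B4 + B5 + \<kappa>0 \<and>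
        \<bar>b 2 p\<bar> \<le> B1 + B2 + B3 + B4 + B5 + \<kappa>0 \<and> \<bar>\<kappa> p\<bar> \<le> B1 + B2 + B3 + B4 + B5 + \<kappa>0"
        using bspec[OF B(2) p] bspec[OF B(4) p] bspec[OF B(6) p] bspec[OF B(8) p] bspec[OF B(10)
            p] k[of p]
          B(1,3,5,7,9) \<kappa>0(1) by linarith
    qed
  qed
  obtain m0 where m0: "m0 > 0" "\<And>p. p \<in> ?K \<Longrightarrow> A 1 1 p > 0 \<and> A 2 2 p \<ge> m0 \<and> A 1 1 p * A 2 2 p - (A 1
      2 p)\<^sup>2 \<ge> m0"
  proof -
    obtain m1 where m1: "m1 > 0" "\<forall>p\<in>?K. m1 \<le> A 2 2 p"
      using low[OF Ac[of 2 2]] Apos(2) Kc by blast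
    have "continuous_on (chart_image c) (\<lambda>p. A 1 1 p * A 2 2 p - (A 1 2 p)\<^sup>2)"
      by (intro continuous_intros Ac)
    then obtain m2 where m2: "m2 > 0" "\<forall>p\<in>?K. m2 \<le> A 1 1 p * A 2 2 p - (A 1 2 p)\<^sup>2"
      using low[of "\<lambda>p. A 1 1 p * A 2 2 p - (A 1 2 p)\<^sup>2"] Apos(4) Kc by blast
    show ?thesis
      by (rule that[of "min m1 m2"]) (use m1 m2 Apos(1) Kc in \<open>auto simp: min_le_iff_disj\<close>)
  qed

  define V where "V = (\<lambda>p t. exp (- u (chart_inv c p) t))"
  define Vt where "Vt = (\<lambda>p t. - V p t * ut (chart_inv c p) t)"
  have Vpos: "V p t > 0" for p t by (simp add: V_def)
  let ?U = "\<lambda>t. coord_rep c (\<lambda>y. u y t)"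
  have V_rep: "(\<lambda>p. V p t) = (\<lambda>p. exp (- ?U t p))" for t by (simp add: V_def coord_rep_def)
  have F: "((\<lambda>x::real. exp (- x)) has_real_derivative - exp (- x)) (at x)"
    "((\<lambda>x::real. - exp (- x)) has_real_derivative exp (- x)) (at x)" for x
    by (auto intro!: derivative_eq_intros)
  have F'': "continuous_on UNIV (\<lambda>x::real. exp (- x))" by (intro continuous_intros)
  note chain = Ck_on_2_chain[OF chart_image_open[OF c(1)] u_C2[OF c(1)] F F'', folded V_rep]
  have V_C2: "Ck_on 2 UNIV (chart_image c) (\<lambda>p. V p t)" if "t > 0" for t
    using chain(1)[of t] that by simp
  have Vexp: "exp (- ?U t p) = V p t" for p t by (simp add: V_def coord_rep_def)
  have V1: "pd i (\<lambda>p. V p t) p = - V p t * pd i (?U t) p" if "p \<in> chart_image c" "t > 0" for p t i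
    using chain(2)[OF _ that(1), of t] that by (simp add: Vexp)
  have V2: "pd i (pd j (\<lambda>p. V p t)) p = V p t * (pd i (?U t) p * pd j (?U t) p - pd i (pd j (?U
      t)) p)"
    if "p \<in> chart_image c" "t > 0" for p t i j
    using chain(3)[OF _ that(1), of t] that by (simp add: Vexp algebra_simps)
  have V_within: "(V p has_real_derivative Vt p t) (at t within {0..T})" if "p \<in> ?K" "0 \<le> t" "t \<le>
      T" for p t T
    unfolding V_def Vt_def
    using u_deriv_within[OF inv(3)[OF that(1)] that(2,3)] by (auto intro!: derivative_eq_intros)
  have V_time: "(V p has_real_derivative Vt p t) (at t)" if "p \<in> ?K" "t > 0" for p t
    unfolding V_def Vt_def
    using u_deriv[OF inv(3)[OF that(1)] that(2)] by (auto intro!: derivative_eq_intros)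
  have V_Lip: "\<exists>L. \<forall>p\<in>?K. \<forall>s\<in>{0..T}. \<forall>t\<in>{0..T}. \<bar>V p s - V p t\<bar> \<le> L * \<bar>s - t\<bar>" if T: "T > 0" for T
  proof -
    obtain L where L: "\<forall>x\<in>topspace (top_of S). \<forall>t\<in>{0..T}. \<bar>ut x t\<bar> \<le> L" using ut_bounded[of T] T
        by auto
    obtain B where B: "\<And>x. x \<in> topspace (top_of S) \<Longrightarrow> \<bar>u x 0\<bar> \<le> B"
      using continuous_bounded[OF C2S_continuous(1)[OF u_C2S[of 0]]] by auto
    define E where "E = exp (B + \<bar>L\<bar> * T)"
    have bd: "\<bar>Vt p t\<bar> \<le> E * \<bar>L\<bar>" if p: "p \<in> ?K" and t: "t \<in> {0..T}" for p t
    proof -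
      let ?x = "chart_inv c p"
      have Lx: "\<bar>ut ?x t\<bar> \<le> L" using L inv(3)[OF p] t by blast
      have "\<bar>u ?x t - u ?x 0\<bar> \<le> L * \<bar>t - 0\<bar>"
        by (rule u_Lipschitz[of T]) (use L inv(3)[OF p] t T in auto)
      also have "\<dots> \<le> \<bar>L\<bar> * T" using t by (intro mult_mono) auto
      finally have "- u ?x t \<le> B + \<bar>L\<bar> * T" using B[OF inv(3)[OF p]] by linarith
      then have "\<bar>V p t\<bar> \<le> E" by (simp add: V_def E_def)
      then show ?thesis unfolding Vt_def abs_mult abs_minus_cancel using Lx
          by (intro mult_mono) auto
    qed
    have "\<bar>V p s - V p t\<bar> \<le> (E * \<bar>L\<bar>) * \<bar>s - t\<bar>" if p: "p \<in> ?K" and "s \<in> {0..T}" "t \<in> {0..T}"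
        for p s t
    proof -
      have "norm (V p s - V p t) \<le> (E * \<bar>L\<bar>) * norm (s - t)"
        by (rule field_differentiable_bound[where S = "{0..T}" and f' = "Vt p"])
           (use that bd[OF p] V_within[OF p] in auto)
      then show ?thesis by simp
    qed
    then show ?thesis by blast
  qed
  have pde: "Vt p t = V p t * (V p t * (A 1 1 p * pd 1 (pd 1 (\<lambda>q. V q t)) p
          + A 1 2 p * (pd 1 (pd 2 (\<lambda>q. V q t)) p + pd 2 (pd 1 (\<lambda>q. V q t)) p)
          + A 2 2 p * pd 2 (pd 2 (\<lambda>q. V q t)) p - b 1 p * pd 1 (\<lambda>q. V q t) p - b 2 p * pd 2 (\<lambda>q.
              V q t) p)
        - (A 1 1 p * (pd 1 (\<lambda>q. V q t) p)\<^sup>2 + 2 * A 1 2 p * pd 1 (\<lambda>q. V q t) p * pd 2 (\<lambda>q. V q t) p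
          + A 2 2 p * (pd 2 (\<lambda>q. V q t) p)\<^sup>2) + 1 + \<kappa> p * (V p t)\<^sup>2)"
    if p: "p \<in> ?K" "p $ 2 > 0" and t: "t > 0" for p t
  proof -
    let ?x = "chart_inv c p"
    have pc: "p \<in> chart_image c" using Kc p by blast
    have sq: "exp (- 2 * u ?x t) = V p t * V p t" by (simp add: V_def flip: exp_add)
    have k: "gauss_curvature S ?x = \<kappa> p" using p by (simp add: \<kappa>_def)
    have lap: "laplacian S (\<lambda>y. u y t) ?x = coord_laplacian (metric S c) (?U t) p"
      using laplacian_chart[OF u_C2_near[OF inv(3)[OF p(1)]] c(1) inv(2)[OF p(1)], of t] inv(4)[OF
          p(1)] t by simp
    have "Vt p t = - V p t * (V p t * V p t * (coord_laplacian (metric S c) (?U t) p - \<kappa> p) - 1)"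
      using evolution[OF inner[OF p], of t] t unfolding Vt_def sq lap k by simp
    also have "coord_laplacian (metric S c) (?U t) p =
        A 1 1 p * pd 1 (pd 1 (?U t)) p + A 1 2 p * (pd 1 (pd 2 (?U t)) p + pd 2 (pd 1 (?U t)) p)
         + A 2 2 p * pd 2 (pd 2 (?U t)) p - b 1 p * pd 1 (?U t) p - b 2 p * pd 2 (?U t) p"
      unfolding coord_laplacian_def b_def A_def[symmetric] sum_2 using Apos(3)[OF pc]
      by (simp add: A_def algebra_simps)
    finally show ?thesis
      unfolding V1[OF pc t] V2[OF pc t] by (simp add: algebra_simps power2_eq_square)
  qed
  obtain Aa Ta where below: "Ta > 0" "\<forall>x\<in>good. \<forall>t\<ge>Ta. u x t \<ge> - Aa"
    using u_bounded_below by (elim exE conjE)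
  obtain Tb where Tb: "Tb > 0" "\<And>x t. x \<in> boundary_of S \<Longrightarrow> t \<ge> Tb \<Longrightarrow> ut x t \<ge> 0"
    using boundary_nondecreasing by blast
  define T0 where "T0 = max (max Ta Tb) T\<^sub>3"
  have T0: "T0 > 0" "T0 \<ge> Ta" "T0 \<ge> Tb" "T0 \<ge> T\<^sub>3" using below(1) by (auto simp: T0_def)
  have V_le: "V p t \<le> exp Aa" if "p \<in> ?K" "t \<ge> T0" for p t
  proof -
    have "- Aa \<le> u (chart_inv c p) t" using below(2) inv(1)[OF that(1)] that(2) T0(2) by auto
    then show ?thesis by (simp add: V_def)
  qed
  have edge_lim: "\<exists>T. \<forall>t\<ge>T. \<forall>p\<in>cball p0 R. p $ 2 = 0 \<longrightarrow> V p t \<le> e" if e: "e > 0" for e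
  proof -
    obtain T where T: "\<And>x t. x \<in> boundary_of S \<Longrightarrow> t \<ge> T \<Longrightarrow> u x t \<ge> - ln e"
      using boundary_large[of "- ln e"] by blast
    have "V p t \<le> e" if "t \<ge> T" "p \<in> cball p0 R" "p $ 2 = 0" for p t
    proof -
      have "- u (chart_inv c p) t \<le> ln e" using T[OF bdry[OF edgeK[OF that(2,3)] that(3)] that(1)]
          by simp
      then have "V p t \<le> exp (ln e)" by (simp only: V_def exp_le_cancel_iff)
      then show ?thesis using e by simp
    qed
    then show ?thesis by blast
  qed
  have edge_mono: "V p t \<le> V p s" if "p \<in> cball p0 R" "p $ 2 = 0" "T0 \<le> s" "s \<le> t" for p s t
    using boundary_mono[OF Tb(2,1) bdry[OF edgeK[OF that(1,2)] that(2)], of s t] that T0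
        by (simp add: V_def)
  have edge_slow: "\<exists>T. \<forall>p\<in>cball p0 R. p $ 2 = 0 \<longrightarrow>
       (\<forall>s t. T \<le> s \<longrightarrow> s \<le> t \<longrightarrow> V p s \<le> exp (e * (t - s)) * V p t)" if e: "e > 0" for e
  proof -
    obtain T where T: "T > 0" "\<And>x t. x \<in> boundary_of S \<Longrightarrow> t \<ge> T \<Longrightarrow> ut x t \<le> e"
      using boundary_slow[OF e] by blast
    have "V p s \<le> exp (e * (t - s)) * V p t" if p: "p \<in> cball p0 R" "p $ 2 = 0" and st: "T \<le>
        s" "s \<le> t" for p s t
    proof -
      let ?x = "chart_inv c p"
      have x: "?x \<in> boundary_of S" by (rule bdry[OF edgeK[OF p] p(2)])
      have "e * s - u ?x s \<le> e * t - u ?x t"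
      proof (rule DERIV_nonneg_imp_nondecreasing[OF st(2)])
        fix r assume r: "s \<le> r" "r \<le> t"
        have "((\<lambda>r. e * r - u ?x r) has_real_derivative e - ut ?x r) (at r)"
          using u_deriv[OF boundary_subset[OF x], of r] r st T(1)
              by (auto intro!: derivative_eq_intros)
        moreover have "e - ut ?x r \<ge> 0" using T(2)[OF x, of r] r st by simp
        ultimately show "\<exists>y. ((\<lambda>r. e * r - u ?x r) has_real_derivative y) (at r) \<and> 0 \<le> y" by blast
      qed
      then have "- u ?x s \<le> e * (t - s) + - u ?x t" by (simp add: algebra_simps)
      then show ?thesis unfolding V_def exp_add[symmetric] exp_le_cancel_iff .
    qed
    then show ?thesis by blast
  qed
  define h where "h = (\<lambda>p. metric S c p $ 1 $ 1)"
  define \<gamma> where "\<gamma> = (\<lambda>p. pd 1 h p / (2 * h p))"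
  have hpos: "h p > 0" if "p \<in> chart_image c" for p using metric_pos[OF c(1) that]
      by (simp add: h_def pos_def_2_def)
  have hc: "continuous_on (chart_image c) h" "continuous_on (chart_image c) (pd 1 h)"
    using metric_smooth[OF c(1), of 1 1 1] unfolding h_def by (simp_all add: Ck_on_1)
  have gc: "continuous_on (chart_image c) \<gamma>"
    unfolding \<gamma>_def using hpos by (intro continuous_intros hc) force
  obtain Bh where Bh: "Bh \<ge> 0" "\<forall>p\<in>?K. \<bar>h p\<bar> \<le> Bh" using bdd[OF hc(1)] by blast
  obtain Bg where Bg: "Bg \<ge> 0" "\<forall>p\<in>?K. \<bar>\<gamma> p\<bar> \<le> Bg" using bdd[OF gc] by blast
  define C where "C = 2 * (Bh * C\<^sub>1) + Bg * ((1 + Bh) * C\<^sub>1) + 1"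
  have C: "C > 0" "Bh * C\<^sub>1 \<le> C" using Bh(1) Bg(1) C1 by (auto simp: C_def intro!: add_nonneg_pos)
  have edge_C: "(pd 1 (\<lambda>q. V q t) p)\<^sup>2 \<le> C * V p t \<and> \<bar>pd 1 (pd 1 (\<lambda>q. V q t)) p\<bar> \<le> C"
    if p: "p \<in> cball p0 R" "p $ 2 = 0" and t: "t \<ge> T0" for p t
  proof -
    let ?x = "chart_inv c p"
    have pK: "p \<in> ?K" by (rule edgeK[OF p])
    have pc: "p \<in> chart_image c" using pK Kc by blast
    have x: "?x \<in> boundary_of S" by (rule bdry[OF pK p(2)])
    have t0: "t > 0" "t \<ge> 0" using t T0 by auto
    define g where "g = bd_grad_norm S (\<lambda>y. \<phi> y t) ?x"
    define H where "H = bd_hess_norm S (\<lambda>y. \<phi> y t) ?x"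
    define U1 where "U1 = pd 1 (?U t) p"
    define U11 where "U11 = pd 1 (pd 1 (?U t)) p"
    define v where "v = V p t"
    have v: "v > 0" by (simp add: v_def V_def)
    note hp = hpos[OF pc]
    have hB: "h p \<le> Bh" "\<bar>\<gamma> p\<bar> \<le> Bg" using bspec[OF Bh(2) pK] bspec[OF Bg(2) pK] by linarith+
    note bn = boundary_norms_chart[where f = "\<lambda>y. u y t" and \<phi> = "\<lambda>y. \<phi> y t", OF x c(1) inv(2)[OF
        pK] u_C2[OF _ t0(2)] boundary_value(1)[OF _ t0(2)]]
    have g: "g = \<bar>U1\<bar> / sqrt (h p)" and H: "H = \<bar>U11 - \<gamma> p * U1\<bar> / h p"
      using bn inv(4)[OF pK] by (simp_all add: g_def H_def U1_def U11_def h_def \<gamma>_def)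
    have gH: "g \<ge> 0" "H \<ge> 0" using hp by (simp_all add: g H)
    have U1: "\<bar>U1\<bar> = g * sqrt (h p)" "U1\<^sup>2 = g\<^sup>2 * h p"
    proof -
      show a: "\<bar>U1\<bar> = g * sqrt (h p)" using hp by (simp add: g)
      have "U1\<^sup>2 = \<bar>U1\<bar>\<^sup>2" by simp
      then show "U1\<^sup>2 = g\<^sup>2 * h p" unfolding a using hp by (simp add: power_mult_distrib)
    qed
    have "v * (H + g\<^sup>2 + g) \<le> C\<^sub>1"
      using decay[OF x, of t] t T0(4) boundary_value(1)[OF x t0(2)] by (simp add: v_def V_def
          H_def g_def)
    moreover have "v * (H + g\<^sup>2 + g) = v * H + v * g\<^sup>2 + v * g" by (simp add: algebra_simps)
    moreover have "v * H \<ge> 0" "v * g\<^sup>2 \<ge> 0" "v * g \<ge> 0" using v gH by auto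
    ultimately have d: "v * H \<le> C\<^sub>1" "v * g\<^sup>2 \<le> C\<^sub>1" "v * g \<le> C\<^sub>1" by linarith+
    have vU: "v * U1\<^sup>2 \<le> Bh * C\<^sub>1"
    proof -
      have "v * U1\<^sup>2 = h p * (v * g\<^sup>2)" unfolding U1(2) by simp
      also have "\<dots> \<le> Bh * C\<^sub>1" using hB(1) d(2) Bh(1) v by (intro mult_mono) auto
      finally show ?thesis .
    qed
    have "(pd 1 (\<lambda>q. V q t) p)\<^sup>2 = v * (v * U1\<^sup>2)"
      unfolding V1[OF pc t0(1)] by (simp add: v_def U1_def power_mult_distrib power2_eq_square)
    also have "\<dots> \<le> v * C" using vU C(2) v by (intro mult_left_mono) auto
    finally have 1: "(pd 1 (\<lambda>q. V q t) p)\<^sup>2 \<le> C * V p t" by (simp add: v_def mult.commute)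
    have "\<bar>U11 - \<gamma> p * U1\<bar> = H * h p" using hp by (simp add: H)
    then have "\<bar>U11\<bar> \<le> H * h p + \<bar>\<gamma> p\<bar> * \<bar>U1\<bar>" using abs_mult[of "\<gamma> p" U1] by linarith
    then have "v * \<bar>U11\<bar> \<le> v * (H * h p + \<bar>\<gamma> p\<bar> * \<bar>U1\<bar>)" using v by (intro mult_left_mono) auto
    also have "\<dots> = h p * (v * H) + \<bar>\<gamma> p\<bar> * (sqrt (h p) * (v * g))" unfolding U1(1)
        by (simp add: algebra_simps)
    also have "\<dots> \<le> Bh * C\<^sub>1 + Bg * ((1 + Bh) * C\<^sub>1)"
    proof (intro add_mono mult_mono)
      have "sqrt (h p) \<le> 1 + h p"
        by (rule real_le_lsqrt) (use hp in \<open>auto simp: power2_eq_square algebra_simps\<close>)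
      then show "sqrt (h p) \<le> 1 + Bh" using hB by simp
    qed (use hB Bh(1) Bg(1) d v gH hp C1 in simp_all)
    finally have vU11: "v * \<bar>U11\<bar> \<le> Bh * C\<^sub>1 + Bg * ((1 + Bh) * C\<^sub>1)" .
    have "pd 1 (pd 1 (\<lambda>q. V q t)) p = v * U1\<^sup>2 - v * U11"
      unfolding V2[OF pc t0(1)] by (simp add: v_def U1_def U11_def algebra_simps power2_eq_square)
    moreover have "\<bar>v * U11\<bar> = v * \<bar>U11\<bar>" "0 \<le> v * U1\<^sup>2" using v by (simp_all add: abs_mult)
    ultimately have "\<bar>pd 1 (pd 1 (\<lambda>q. V q t)) p\<bar> \<le> C" using vU vU11 unfolding C_def by linarith
    then show ?thesis using 1 by simp
  qed
  interpret bf: boundary_flow p0 R "chart_image c" "A 1 1" "A 1 2" "A 2 2" "b 1" "b 2" \<kappa> V Vt B0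
      m0 "exp Aa" T0 C
    by (rule boundary_flow.intro)
       (fact R(1) p0 chart_image_open[OF c(1)] Kc continuous_on_subset[OF Ac Kc] B0(2) m0 V_C2
           Vpos V_time V_Lip pde
         T0(1) V_le edge_lim edge_mono edge_slow C(1) edge_C)+

  define kg where "kg = (\<lambda>p. christoffel (metric S c) 2 1 1 p / (sqrt (A 2 2 p) * h p))"
  have kc: "continuous_on (chart_image c) kg"
    unfolding kg_def using hpos Apos(2)
    by (intro continuous_intros Ac hc continuous_christoffel[OF c(1)]) force
  obtain Bk where Bk: "Bk \<ge> 0" "\<forall>p\<in>?K. \<bar>kg p\<bar> \<le> Bk" using bdd[OF kc] by blast

  define U where "U = {y \<in> fst c. snd c y \<in> ball p0 (R / 2) \<inter> half_plane}"
  have subK: "ball p0 (R / 2) \<inter> half_plane \<subseteq> ?K" using R(1) by auto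
  have oU: "openin (top_of S) U"
    unfolding U_def by (rule chart_preimage_open[OF c(1) open_half_ball]) (use subK Kc in blast)
  have xU: "x0 \<in> U" using c R(1) p0 by (simp add: U_def p0_def)
  have "\<exists>T. \<forall>t\<ge>T. \<forall>y\<in>U \<inter> boundary_of S.
     \<bar>exp (- u y t) * (normal_derivative S (\<lambda>y. u y t) y + geodesic_curvature S y) - 1\<bar> \<le> e"
         if e: "e > 0" for e
  proof -
    define e1 where "e1 = min (e / 3) 1"
    have e1: "0 < e1" "e1 \<le> 1" "e1 \<le> e / 3" using e by (auto simp: e1_def)
    obtain Tp where Tp: "\<And>t q. t \<ge> Tp \<Longrightarrow> q $ 2 = 0 \<Longrightarrow> dist q p0 \<le> R / 2 \<Longrightarrow>
        1 * (sqrt (A 2 2 q) * pd 2 (\<lambda>p. V p t) q - (1 - 1 * e1)) \<ge> 0"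
      using bf.edge_derivative[of 1 e1] e1 by blast
    obtain Tm where Tm: "\<And>t q. t \<ge> Tm \<Longrightarrow> q $ 2 = 0 \<Longrightarrow> dist q p0 \<le> R / 2 \<Longrightarrow>
        -1 * (sqrt (A 2 2 q) * pd 2 (\<lambda>p. V p t) q - (1 - (-1) * e1)) \<ge> 0"
      using bf.edge_derivative[of "-1" e1] e1 by blast
    define d where "d = e * sqrt m0 / (3 * (B0 + 1))"
    have d: "d > 0" using e m0(1) B0(1) by (simp add: d_def)
    define e2 where "e2 = min (d\<^sup>2 / C) (e / (3 * (Bk + 1)))"
    have e2: "e2 > 0" "C * e2 \<le> d\<^sup>2" "Bk * e2 \<le> e / 3"
    proof -
      show "e2 > 0" using d C(1) e Bk(1) by (simp add: e2_def)
      have "C * e2 \<le> C * (d\<^sup>2 / C)" using C(1) by (intro mult_left_mono) (auto simp: e2_def)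
      then show "C * e2 \<le> d\<^sup>2" using C(1) by simp
      have "z * (e / (3 * z)) = e / 3" if "z > 0" for z using that by simp
      from this[of "Bk + 1"] Bk(1) have eq: "(Bk + 1) * (e / (3 * (Bk + 1))) = e / 3" by linarith
      have "Bk * e2 \<le> (Bk + 1) * (e / (3 * (Bk + 1)))"
        using Bk(1) \<open>e2 > 0\<close> e by (intro mult_mono) (auto simp: e2_def)
      also note eq
      finally show "Bk * e2 \<le> e / 3" .
    qed
    obtain Te where Te: "\<And>t p. t \<ge> Te \<Longrightarrow> p \<in> cball p0 R \<Longrightarrow> p $ 2 = 0 \<Longrightarrow> V p t \<le> e2"
      using edge_lim[OF e2(1)] by blast
    have "\<bar>exp (- u y t) * (normal_derivative S (\<lambda>y. u y t) y + geodesic_curvature S y) - 1\<bar> \<le> e"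
      if t: "t \<ge> max (max Tp Tm) (max Te T0)" and y: "y \<in> U" "y \<in> boundary_of S" for t y
    proof -
      define q where "q = snd c y"
      have yc: "y \<in> fst c" "dist q p0 \<le> R / 2" using y by (auto simp: U_def q_def dist_commute)
      have q2: "q $ 2 = 0" using boundary_chart[OF c(1) yc(1)] y by (simp add: q_def)
      have qR: "q \<in> cball p0 R" using yc(2) R(1) by (simp add: dist_commute)
      have qK: "q \<in> ?K" using qR q2 by simp
      have qc: "q \<in> chart_image c" using qK Kc by blast
      have yq: "chart_inv c q = y" using c(1) yc(1) by (simp add: q_def)
      have t0: "t > 0" "t \<ge> 0" "t \<ge> T0" "t \<ge> Tp" "t \<ge> Tm" "t \<ge> Te" using t T0(1) by auto
      define r where "r = sqrt (A 2 2 q)"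
      have r: "r > 0" "r \<ge> sqrt m0" using Apos(2)[OF qc] m0(2)[OF qK] by (auto simp: r_def)
      define v where "v = V q t"
      define v1 where "v1 = pd 1 (\<lambda>p. V p t) q"
      define v2 where "v2 = pd 2 (\<lambda>p. V p t) q"
      have v: "v > 0" "v \<le> e2" "exp (- u y t) = v" using Te[OF t0(6) qR q2] yq
          by (auto simp: v_def V_def)
      have nd: "normal_derivative S (\<lambda>y. u y t) y = - (A 1 2 q * pd 1 (?U t) q + A 2 2 q * pd 2
          (?U t) q) / r"
      proof -
        have "normal_derivative S (\<lambda>y. u y t) y =
            (\<Sum>i\<in>UNIV. coord_normal (metric S c) q $ i * pd i (?U t) q)"
          unfolding q_def by (rule normal_derivative_chart[OF y(2) c(1) yc(1)]) (rule u_C2[OF _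
              t0(2)])
        then show ?thesis
          unfolding sum_2 coord_normal_eq r_def A_def by (simp add: diff_divide_distrib
              add_divide_distrib)
      qed
      have gk: "geodesic_curvature S y = kg q"
        unfolding geodesic_curvature_chart[OF y(2) c(1) yc(1)] q_def[symmetric]
          coord_geodesic_curvature_eq[of "metric S c" q, OF metric_pos[OF c(1) qc]] kg_def A_def
              h_def by simp
      have rr: "A 2 2 q = r * r" using Apos(2)[OF qc] by (simp add: r_def)
      have "v * normal_derivative S (\<lambda>y. u y t) y = (A 1 2 q * v1 + A 2 2 q * v2) / r"
        unfolding nd v1_def v2_def V1[OF qc t0(1)] v_def by (simp add: algebra_simps)
      also have "\<dots> = A 1 2 q * v1 / r + r * v2" unfolding rr using r by (simp add: field_simps)
      finally have main: "exp (- u y t) * (normal_derivative S (\<lambda>y. u y t) y + geodesic_curvature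
          S y) - 1
          = A 1 2 q * v1 / r + (r * v2 - 1) + v * kg q"
        unfolding v(3) gk by (simp add: algebra_simps)
      have 1: "\<bar>r * v2 - 1\<bar> \<le> e / 3"
      proof -
        have "1 - e1 \<le> r * v2" "r * v2 \<le> 1 + e1"
          using Tp[OF t0(4) q2 yc(2)] Tm[OF t0(5) q2 yc(2)] by (simp_all add: r_def v2_def)
        then show ?thesis using e1(3) by linarith
      qed
      have 2: "\<bar>v * kg q\<bar> \<le> e / 3"
      proof -
        have "\<bar>v * kg q\<bar> \<le> e2 * Bk" unfolding abs_mult using v bspec[OF Bk(2) qK] e2(1)
            by (intro mult_mono) auto
        then show ?thesis using e2(3) by (simp add: mult.commute)
      qed
      have 3: "\<bar>A 1 2 q * v1 / r\<bar> \<le> e / 3"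
      proof -
        have "v1\<^sup>2 \<le> C * v" using edge_C[OF qR q2 t0(3)] by (simp add: v1_def v_def)
        also have "\<dots> \<le> C * e2" using v(2) C(1) by (intro mult_left_mono) auto
        also have "\<dots> \<le> d\<^sup>2" by (rule e2(2))
        finally have v1: "\<bar>v1\<bar> \<le> d" using d by (simp add: abs_le_square_iff[symmetric])
        have "\<bar>A 1 2 q * v1 / r\<bar> = \<bar>A 1 2 q\<bar> * \<bar>v1\<bar> / r" using r by (simp add: abs_mult)
        also have "\<dots> \<le> (B0 + 1) * d / sqrt m0"
        proof (rule frac_le)
          have "\<bar>A 1 2 q\<bar> \<le> B0" using B0(2)[OF qK] by blast
          then show "\<bar>A 1 2 q\<bar> * \<bar>v1\<bar> \<le> (B0 + 1) * d" using v1 B0(1) by (intro mult_mono) auto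
        qed (use r m0(1) B0(1) d in auto)
        also have "\<dots> = e / 3"
        proof -
          have "z * (e * s / (3 * z)) / s = e / 3" if "z > 0" "s > 0" for z s using that by simp
          from this[of "B0 + 1" "sqrt m0"] show ?thesis unfolding d_def using B0(1) m0(1) by simp
        qed
        finally show ?thesis .
      qed
      show ?thesis unfolding main using 1 2 3 by linarith
    qed
    then show ?thesis by (intro exI[of _ "max (max Tp Tm) (max Te T0)"]) blast
  qed
  then show ?thesis using oU xU by blast
qed

lemma boundary_curvature_uniform:
  assumes decay: "\<And>x t. x \<in> boundary_of S \<Longrightarrow> t \<ge> T\<^sub>3 \<Longrightarrow>
      exp (- \<phi> x t) * (bd_hess_norm S (\<lambda>y. \<phi> y t) x + (bd_grad_norm S (\<lambda>y. \<phi> y t) x)\<^sup>2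
        + bd_grad_norm S (\<lambda>y. \<phi> y t) x) \<le> C\<^sub>1" and C1: "C\<^sub>1 > 0"
  shows "uniform_limit (boundary_of S)
     (\<lambda>t x. exp (- u x t) * (normal_derivative S (\<lambda>y. u y t) x + geodesic_curvature S x)) (\<lambda>x.
         1) at_top"
proof (rule uniform_limitI)
  fix e :: real assume e: "e > 0"
  let ?k = "\<lambda>t y. exp (- u y t) * (normal_derivative S (\<lambda>y. u y t) y + geodesic_curvature S y)"
  have "\<exists>T. \<forall>y\<in>topspace (top_of S). \<forall>t\<ge>T. y \<in> boundary_of S \<longrightarrow> \<bar>?k t y - 1\<bar> \<le> e / 2"
  proof (rule local_to_global)
    show "\<forall>t\<ge>T'. y \<in> boundary_of S \<longrightarrow> \<bar>?k t y - 1\<bar> \<le> e / 2"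
      if "\<forall>t\<ge>T. y \<in> boundary_of S \<longrightarrow> \<bar>?k t y - 1\<bar> \<le> e / 2" "T \<le> T'" for y T T'
      using that by auto
    fix x assume x: "x \<in> topspace (top_of S)"
    show "\<exists>U T. openin (top_of S) U \<and> x \<in> U \<and> (\<forall>y\<in>U. \<forall>t\<ge>T. y \<in> boundary_of S \<longrightarrow> \<bar>?k t y - 1\<bar> \<le>
        e / 2)"
    proof (cases "x \<in> boundary_of S")
      case True
      from boundary_curvature_local[where T\<^sub>3 = T\<^sub>3, OF decay C1 True] obtain U
          where U: "openin (top_of S) U" "x \<in> U"
        "\<forall>e>0. \<exists>T. \<forall>t\<ge>T. \<forall>y\<in>U \<inter> boundary_of S. \<bar>?k t y - 1\<bar> \<le> e" by auto
      then obtain T where "\<forall>t\<ge>T. \<forall>y\<in>U \<inter> boundary_of S. \<bar>?k t y - 1\<bar> \<le> e / 2" using e half_gt_zero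
          by blast
      then show ?thesis using U(1,2) by blast
    next
      case False
      note c = chart_at[OF x]
      let ?c = "chart_at S x"
      have xi: "snd ?c x $ 2 > 0" using inner_chart[OF c] False x by (simp add: inner_part_def)
      have "open_hp (half_plane \<inter> {p. p $ 2 > 0})"
        by (intro openin_open_Int open_Collect_less continuous_intros)
      with chart_image_open[OF c(1)] have "open_hp (chart_image ?c \<inter> (half_plane \<inter> {p. p $ 2 > 0}))"
        by (rule openin_Int)
      from chart_preimage_open[OF c(1) this]
      have "openin (top_of S) {y \<in> fst ?c. snd ?c y \<in> chart_image ?c \<inter> (half_plane \<inter> {p.
          p $ 2 > 0})}" by blast
      moreover have "y \<notin> boundary_of S" if "y \<in> fst ?c" "snd ?c y $ 2 > 0" for y
        using boundary_chart[OF c(1) that(1)] that(2) by simp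
      ultimately show ?thesis using xi c
        by (intro exI[of _ "{y \<in> fst ?c. snd ?c y \<in> chart_image ?c \<inter> (half_plane \<inter> {p.
            p $ 2 > 0})}"] exI[of _ 0]) auto
    qed
  qed
  then obtain T where T: "\<forall>y\<in>topspace (top_of S). \<forall>t\<ge>T. y \<in> boundary_of S \<longrightarrow> \<bar>?k t y - 1\<bar> \<le> e / 2"
      by blast
  have "\<forall>x\<in>boundary_of S. dist (?k t x) 1 < e" if "t \<ge> T" for t
  proof
    fix x assume x: "x \<in> boundary_of S"
    then have "\<bar>?k t x - 1\<bar> \<le> e / 2" using T boundary_subset that by blast
    then show "dist (?k t x) 1 < e" using e by (simp add: dist_real_def)
  qed
  then show "\<forall>\<^sub>F t in at_top. \<forall>x\<in>boundary_of S. dist (?k t x) 1 < e"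
    by (auto simp: eventually_at_top_linorder)
qed

end

theorem theorem5p2:
  fixes S :: "'a surface" and \<alpha> T\<^sub>3 C\<^sub>1 :: real
    and u\<^sub>0 :: "'a \<Rightarrow> real" and \<phi> u :: "'a \<Rightarrow> real \<Rightarrow> real"
  assumes "compact_riemannian_surface S"
    and "0 < \<alpha>" and "\<alpha> < 1"
    and "admissible_pair \<alpha> S u\<^sub>0 \<phi>"
    and "T\<^sub>3 > 0" and "C\<^sub>1 > 0"
    and "\<forall>x\<in>boundary_of S. \<forall>t\<ge>T\<^sub>3.
           exp (- \<phi> x t) * (bd_hess_norm S (\<lambda>y. \<phi> y t) x + (bd_grad_norm S (\<lambda>y. \<phi> y t) x)\<^sup>2
             + bd_grad_norm S (\<lambda>y. \<phi> y t) x) \<le> C\<^sub>1"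
    and "((\<lambda>t. SUP x\<in>boundary_of S. time_deriv {0..} (\<phi> x) t) \<longlongrightarrow> 0) at_top"
    and "cauchy_dirichlet_solution \<alpha> S u\<^sub>0 \<phi> u"
  shows "(\<forall>x\<in>boundary_of S. \<forall>t\<ge>0.
            geodesic_curvature (conformal (\<lambda>y. u y t) S) x =
              exp (- u x t) * (normal_derivative S (\<lambda>y. u y t) x + geodesic_curvature S x)) \<and>
         uniform_limit (boundary_of S)
           (\<lambda>t x. geodesic_curvature (conformal (\<lambda>y. u y t) S) x) (\<lambda>x. 1) at_top"
proof -
  interpret cauchy_dirichlet S \<alpha> u\<^sub>0 \<phi> u
    by unfold_locales (fact assms)+
  have formula: "geodesic_curvature (conformal (\<lambda>y. u y t) S) x =
      exp (- u x t) * (normal_derivative S (\<lambda>y. u y t) x + geodesic_curvature S x)"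
    if "x \<in> boundary_of S" "t \<ge> 0" for x t
    by (rule geodesic_curvature_conformal[OF that(1) u_C2[OF _ that(2)]])
  have lim: "uniform_limit (boundary_of S)
     (\<lambda>t x. exp (- u x t) * (normal_derivative S (\<lambda>y. u y t) x + geodesic_curvature S x)) (\<lambda>x.
         1) at_top"
    using boundary_curvature_uniform[of T\<^sub>3 C\<^sub>1] assms(6,7) by blast
  have ev: "\<forall>\<^sub>F t in at_top. \<forall>x\<in>boundary_of S.
      exp (- u x t) * (normal_derivative S (\<lambda>y. u y t) x + geodesic_curvature S x) =
      geodesic_curvature (conformal (\<lambda>y. u y t) S) x"
    using eventually_ge_at_top[of "0::real"] by eventually_elim (simp add: formula)
  have "uniform_limit (boundary_of S)
      (\<lambda>t x. geodesic_curvature (conformal (\<lambda>y. u y t) S) x) (\<lambda>x. 1) at_top"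
    by (rule uniform_limit_cong[OF ev, THEN iffD1, OF _ lim]) simp
  then show ?thesis using formula by blast
qed

end
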